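(* Let $n$ be a nonnegative integer, and let $A=\mathbb{N}/(n=n+1)$. Then $W(A)$ is countable if and only if $n\le2$. The same is true for $W^{\mathrm{Sch}}(A)$: it is countable if and only if $n\le 2$.
   Context: $\mathbb{N}=\{0,1,\dots\}$. Semirings are commutative with $0,1$; homomorphisms preserve $0,1$. $\mathbb{N}/(n=n+1)$ is the quotient of the semiring $\mathbb{N}$ by the smallest congruence identifying $n$ and $n+1$ (so it is $\{0,1,\dots,n\}$ with operations truncated at $n$). "Countable" means finite or countably infinite. Let $\Lambda_{\mathbb{Z}}$ be the ring of symmetric functions in $x_1,x_2,\dots$, with monomial basis $(m_\lambda)$ and Schur basis $(s_\lambda)$ indexed by partitions. Put $\Lambda_{\mathbb{N}}=\bigoplus_\lambda\mathbb{N}m_\lambda$ and $\Lambda^{\mathrm{Sch}}=\bigoplus_\lambda\mathbb{N}s_\lambda$, subsemirings of $\Lambda_{\mathbb{Z}}$. For a semiring $A$, $W(A)=\mathrm{Hom}_{\mathrm{semiring}}(\Lambda_{\mathbb{N}},A)$ and $W^{\mathrm{Sch}}(A)=\mathrm{Hom}_{\mathrm{semiring}}(\Lambda^{\mathrm{Sch}},A)$. *)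

theory Defs
  imports "HOL-Algebra.Ring" "HOL-Library.Multiset" "HOL-Library.Poly_Mapping" "HOL-Library.Countable_Set"
begin

section \<open>Integral power series in countably many variables\<close>

text \<open>
  The variables are indexed by \<^typ>\<open>nat\<close>, starting at \<open>0\<close>. A monomial is its exponent vector, a
  finitely supported function, and a power series is an arbitrary family of coefficients.
\<close>

type_synonym monom = "nat \<Rightarrow>\<^sub>0 nat"

typedef pseries = "UNIV :: (monom \<Rightarrow> int) set"
  morphisms pcoeff Abs_pseries ..

setup_lifting type_definition_pseries

lemma pseries_eqI: "(\<And>\<alpha>. pcoeff f \<alpha> = pcoeff g \<alpha>) \<Longrightarrow> f = g"
  by transfer auto

lemma finite_splittings: "finite {(\<beta>, \<gamma>). \<beta> + \<gamma> = (\<alpha> :: monom)}"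
proof -
  let ?S = "{f. \<forall>k. (k \<in> Poly_Mapping.keys \<alpha> \<longrightarrow> f k \<in> {..sum (Poly_Mapping.lookup \<alpha>) (Poly_Mapping.keys \<alpha>)})
              \<and> (k \<notin> Poly_Mapping.keys \<alpha> \<longrightarrow> f k = (0::nat))}"
  have "finite ?S"
    by (rule finite_set_of_finite_funs) auto
  moreover have "(\<lambda>p. (Poly_Mapping.lookup (fst p), Poly_Mapping.lookup (snd p))) `
      {(\<beta>, \<gamma>). \<beta> + \<gamma> = \<alpha>} \<subseteq> ?S \<times> ?S"
  proof -
    have le: "Poly_Mapping.lookup \<alpha> k \<le> sum (Poly_Mapping.lookup \<alpha>) (Poly_Mapping.keys \<alpha>)" for k
      by (cases "k \<in> Poly_Mapping.keys \<alpha>") (auto intro: member_le_sum simp: in_keys_iff)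
    have "Poly_Mapping.lookup \<beta> \<in> ?S \<and> Poly_Mapping.lookup \<gamma> \<in> ?S" if "\<beta> + \<gamma> = \<alpha>" for \<beta> \<gamma>
    proof -
      have *: "Poly_Mapping.lookup \<alpha> k = Poly_Mapping.lookup \<beta> k + Poly_Mapping.lookup \<gamma> k" for k
        using that by (auto simp: lookup_add)
      show ?thesis
        using le * by (auto simp: in_keys_iff) (metis add_leD1 add_leD2)+
    qed
    then show ?thesis by auto
  qed
  ultimately have "finite ((\<lambda>p. (Poly_Mapping.lookup (fst p), Poly_Mapping.lookup (snd p))) `
      {(\<beta>, \<gamma>). \<beta> + \<gamma> = \<alpha>})"
    using finite_subset by blast
  moreover have "inj_on (\<lambda>p. (Poly_Mapping.lookup (fst p), Poly_Mapping.lookup (snd p)))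
      {(\<beta>, \<gamma>). \<beta> + \<gamma> = \<alpha>}"
    by (auto simp: inj_on_def lookup_inject)
  ultimately show ?thesis
    by (rule finite_imageD)
qed

instantiation pseries :: comm_ring_1
begin

lift_definition zero_pseries :: pseries is "\<lambda>_. 0" .

lift_definition one_pseries :: pseries is "\<lambda>\<alpha>. if \<alpha> = 0 then 1 else 0" .

lift_definition plus_pseries :: "pseries \<Rightarrow> pseries \<Rightarrow> pseries" is "\<lambda>f g \<alpha>. f \<alpha> + g \<alpha>" .

lift_definition uminus_pseries :: "pseries \<Rightarrow> pseries" is "\<lambda>f \<alpha>. - f \<alpha>" .

lift_definition minus_pseries :: "pseries \<Rightarrow> pseries \<Rightarrow> pseries" is "\<lambda>f g \<alpha>. f \<alpha> - g \<alpha>" .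

lift_definition times_pseries :: "pseries \<Rightarrow> pseries \<Rightarrow> pseries" is
  "\<lambda>f g \<alpha>. \<Sum>(\<beta>, \<gamma>) | \<beta> + \<gamma> = \<alpha>. f \<beta> * g \<gamma>" .

instance
proof
  fix a b c :: pseries
  show "a * b * c = a * (b * c)"
  proof (rule pseries_eqI)
    fix \<alpha>
    let ?f = "\<lambda>(\<beta>, \<gamma>, \<delta>). pcoeff a \<beta> * pcoeff b \<gamma> * pcoeff c \<delta>"
    have "pcoeff (a * b * c) \<alpha> =
      (\<Sum>p\<in>{(\<mu>, \<delta>). \<mu> + \<delta> = \<alpha>}. \<Sum>q\<in>{(\<beta>, \<gamma>). \<beta> + \<gamma> = fst p}. ?f (fst q, snd q, snd p))"
      by (simp add: times_pseries.rep_eq sum_distrib_right case_prod_beta)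
    also have "\<dots> = (\<Sum>x\<in>(SIGMA p:{(\<mu>, \<delta>). \<mu> + \<delta> = \<alpha>}. {(\<beta>, \<gamma>). \<beta> + \<gamma> = fst p}).
        ?f (fst (snd x), snd (snd x), snd (fst x)))"
      by (subst sum.Sigma) (auto simp: finite_splittings case_prod_beta)
    also have "\<dots> = (\<Sum>x\<in>(SIGMA p:{(\<beta>, \<mu>). \<beta> + \<mu> = \<alpha>}. {(\<gamma>, \<delta>). \<gamma> + \<delta> = snd p}).
        ?f (fst (fst x), fst (snd x), snd (snd x)))"
      by (rule sum.reindex_bij_witness
          [where i = "\<lambda>((\<beta>, \<mu>), (\<gamma>, \<delta>)). ((\<beta> + \<gamma>, \<delta>), (\<beta>, \<gamma>))"
             and j = "\<lambda>((\<mu>, \<delta>), (\<beta>, \<gamma>)). ((\<beta>, \<gamma> + \<delta>), (\<gamma>, \<delta>))"])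
        (auto simp: add.assoc)
    also have "\<dots> = (\<Sum>p\<in>{(\<beta>, \<mu>). \<beta> + \<mu> = \<alpha>}. \<Sum>q\<in>{(\<gamma>, \<delta>). \<gamma> + \<delta> = snd p}. ?f (fst p, fst q, snd q))"
      by (subst sum.Sigma) (auto simp: finite_splittings case_prod_beta)
    also have "\<dots> = pcoeff (a * (b * c)) \<alpha>"
      by (simp add: times_pseries.rep_eq sum_distrib_left mult.assoc case_prod_beta)
    finally show "pcoeff (a * b * c) \<alpha> = pcoeff (a * (b * c)) \<alpha>" .
  qed
  show "a * b = b * a"
    by (rule pseries_eqI, unfold times_pseries.rep_eq,
        rule sum.reindex_bij_witness[where i = prod.swap and j = prod.swap])
      (auto simp: add.commute mult.commute)
  show "1 * a = a"
  proof (rule pseries_eqI)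
    fix \<alpha>
    have "pcoeff (1 * a) \<alpha> = (\<Sum>(\<beta>, \<gamma>) | \<beta> + \<gamma> = \<alpha>. (if \<beta> = 0 then 1 else 0) * pcoeff a \<gamma>)"
      by (simp add: times_pseries.rep_eq one_pseries.rep_eq)
    also have "\<dots> = (\<Sum>(\<beta>, \<gamma>) \<in> {(0 :: monom, \<alpha>)}. (if \<beta> = 0 then 1 else 0) * pcoeff a \<gamma>)"
      by (rule sum.mono_neutral_right) (auto simp: finite_splittings split: if_splits)
    finally show "pcoeff (1 * a) \<alpha> = pcoeff a \<alpha>" by simp
  qed
  show "(a + b) * c = a * c + b * c"
    by (rule pseries_eqI)
      (simp add: times_pseries.rep_eq plus_pseries.rep_eq sum.distrib distrib_right case_prod_beta)
  show "(0::pseries) \<noteq> 1"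
  proof
    assume "(0::pseries) = 1"
    then have "pcoeff 0 0 = pcoeff 1 0" by (rule arg_cong)
    then show False by (simp add: one_pseries.rep_eq zero_pseries.rep_eq)
  qed
qed (rule pseries_eqI; simp add: plus_pseries.rep_eq zero_pseries.rep_eq uminus_pseries.rep_eq
    minus_pseries.rep_eq)+

end

section \<open>Symmetric functions\<close>

definition symmetric :: "pseries \<Rightarrow> bool" where
  "symmetric f \<longleftrightarrow> (\<forall>\<pi> :: nat \<Rightarrow> nat. bij \<pi> \<longrightarrow> (\<forall>\<alpha>. pcoeff f (Poly_Mapping.map_key \<pi> \<alpha>) = pcoeff f \<alpha>))"

definition total_degree :: "monom \<Rightarrow> nat" where
  "total_degree \<alpha> = (\<Sum>k\<in>Poly_Mapping.keys \<alpha>. Poly_Mapping.lookup \<alpha> k)"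

definition bounded_degree :: "pseries \<Rightarrow> bool" where
  "bounded_degree f \<longleftrightarrow> (\<exists>d. \<forall>\<alpha>. pcoeff f \<alpha> \<noteq> 0 \<longrightarrow> total_degree \<alpha> \<le> d)"

definition Lambda_Z :: "pseries ring" where
  "Lambda_Z = \<lparr>carrier = {f. symmetric f \<and> bounded_degree f},
     monoid.mult = (*), one = 1, zero = 0, add = (+)\<rparr>"

lemma total_degree_superset:
  assumes "finite K" "Poly_Mapping.keys \<alpha> \<subseteq> K"
  shows "total_degree \<alpha> = (\<Sum>k\<in>K. Poly_Mapping.lookup \<alpha> k)"
  unfolding total_degree_def
  by (rule sum.mono_neutral_left) (use assms in \<open>auto simp: in_keys_iff\<close>)

lemma total_degree_add: "total_degree (\<alpha> + \<beta>) = total_degree \<alpha> + total_degree \<beta>"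
proof -
  let ?K = "Poly_Mapping.keys \<alpha> \<union> Poly_Mapping.keys \<beta>"
  have "Poly_Mapping.keys (\<alpha> + \<beta>) \<subseteq> ?K" by (rule Poly_Mapping.keys_add)
  then show ?thesis
    by (simp add: total_degree_superset[of ?K] lookup_add sum.distrib)
qed

lemma symmetric_mult:
  assumes "symmetric f" "symmetric g"
  shows "symmetric (f * g)"
  unfolding symmetric_def
proof (intro allI impI)
  fix \<pi> :: "nat \<Rightarrow> nat" and \<alpha> :: monom assume \<pi>: "bij \<pi>"
  define \<sigma> where "\<sigma> = inv_into UNIV \<pi>"
  have \<sigma>: "bij \<sigma>" "\<pi> \<circ> \<sigma> = id" "\<sigma> \<circ> \<pi> = id"
    using \<pi> by (auto simp: \<sigma>_def bij_imp_bij_inv bij_is_inj bij_is_surj surj_iff[symmetric] inj_iff[symmetric])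
  have mk_inv: "Poly_Mapping.map_key \<pi> (Poly_Mapping.map_key \<sigma> x) = x"
    "Poly_Mapping.map_key \<sigma> (Poly_Mapping.map_key \<pi> x) = x" for x :: monom
    using \<pi> \<sigma> by (simp_all add: map_key_compose bij_is_inj id_def map_key_id)
  have mk_add: "Poly_Mapping.map_key \<pi> (x + y) = Poly_Mapping.map_key \<pi> x + Poly_Mapping.map_key \<pi> y"
    "Poly_Mapping.map_key \<sigma> (x + y) = Poly_Mapping.map_key \<sigma> x + Poly_Mapping.map_key \<sigma> y" for x y :: monom
    using \<pi> \<sigma> by (simp_all add: map_key_plus bij_is_inj)
  have inv2: "Poly_Mapping.map_key \<sigma> b + Poly_Mapping.map_key \<sigma> c = \<alpha>"
    if "b + c = Poly_Mapping.map_key \<pi> \<alpha>" for b c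
    using arg_cong[OF that, of "Poly_Mapping.map_key \<sigma>"] by (simp only: mk_inv mk_add)
  have sym: "pcoeff f (Poly_Mapping.map_key \<sigma> x) = pcoeff f x"
    "pcoeff g (Poly_Mapping.map_key \<sigma> x) = pcoeff g x" for x
    using assms \<sigma>(1) unfolding symmetric_def by blast+
  show "pcoeff (f * g) (Poly_Mapping.map_key \<pi> \<alpha>) = pcoeff (f * g) \<alpha>"
    unfolding times_pseries.rep_eq
    by (rule sum.reindex_bij_witness
        [where i = "\<lambda>(\<beta>, \<gamma>). (Poly_Mapping.map_key \<pi> \<beta>, Poly_Mapping.map_key \<pi> \<gamma>)"
           and j = "\<lambda>(\<beta>, \<gamma>). (Poly_Mapping.map_key \<sigma> \<beta>, Poly_Mapping.map_key \<sigma> \<gamma>)"])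
      (auto simp: mk_inv inv2 sym mk_add[symmetric])
qed

lemma bounded_degree_mult:
  assumes "bounded_degree f" "bounded_degree g"
  shows "bounded_degree (f * g)"
proof -
  obtain d e where d: "\<And>\<alpha>. pcoeff f \<alpha> \<noteq> 0 \<Longrightarrow> total_degree \<alpha> \<le> d"
    and e: "\<And>\<alpha>. pcoeff g \<alpha> \<noteq> 0 \<Longrightarrow> total_degree \<alpha> \<le> e"
    using assms unfolding bounded_degree_def by metis
  have "total_degree \<alpha> \<le> d + e" if "pcoeff (f * g) \<alpha> \<noteq> 0" for \<alpha>
  proof -
    from that obtain x where x: "x \<in> {(\<beta>, \<gamma>). \<beta> + \<gamma> = \<alpha>}"
      "(case x of (\<beta>, \<gamma>) \<Rightarrow> pcoeff f \<beta> * pcoeff g \<gamma>) \<noteq> 0"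
      unfolding times_pseries.rep_eq by (rule sum.not_neutral_contains_not_neutral)
    obtain \<beta> \<gamma> where "x = (\<beta>, \<gamma>)" by (cases x)
    with x have "\<alpha> = \<beta> + \<gamma>" "pcoeff f \<beta> \<noteq> 0" "pcoeff g \<gamma> \<noteq> 0" by auto
    with d[of \<beta>] e[of \<gamma>] show ?thesis by (simp add: total_degree_add)
  qed
  then show ?thesis unfolding bounded_degree_def by blast
qed

lemma symmetric_one: "symmetric 1"
proof -
  have "Poly_Mapping.map_key \<pi> \<alpha> = 0 \<longleftrightarrow> \<alpha> = 0" if "bij \<pi>" for \<pi> :: "nat \<Rightarrow> nat" and \<alpha> :: monom
  proof -
    have "Poly_Mapping.keys (Poly_Mapping.map_key \<pi> \<alpha>) = \<pi> -` Poly_Mapping.keys \<alpha>"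
      using that by (simp add: keys_map_key bij_is_inj)
    then show ?thesis
      using that surj_image_vimage_eq[of \<pi>] bij_is_surj[OF that]
      by (metis image_empty keys_eq_empty vimage_empty)
  qed
  then show ?thesis
    by (simp add: symmetric_def one_pseries.rep_eq)
qed

lemma Lambda_Z_cring: "cring Lambda_Z"
proof (rule cringI)
  have add: "bounded_degree (f + g)" if fg: "bounded_degree f" "bounded_degree g" for f g
  proof -
    obtain d e where d: "\<And>\<alpha>. pcoeff f \<alpha> \<noteq> 0 \<Longrightarrow> total_degree \<alpha> \<le> d"
      and e: "\<And>\<alpha>. pcoeff g \<alpha> \<noteq> 0 \<Longrightarrow> total_degree \<alpha> \<le> e"
      using fg unfolding bounded_degree_def by metis
    have "total_degree \<alpha> \<le> max d e" if "pcoeff (f + g) \<alpha> \<noteq> 0" for \<alpha>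
      using that d[of \<alpha>] e[of \<alpha>] by (cases "pcoeff f \<alpha> = 0") (auto simp: plus_pseries.rep_eq)
    then show ?thesis unfolding bounded_degree_def by blast
  qed
  show "abelian_group Lambda_Z"
  proof (rule abelian_groupI)
    fix f assume "f \<in> carrier Lambda_Z"
    then have "- f \<in> carrier Lambda_Z"
      by (auto simp: Lambda_Z_def symmetric_def bounded_degree_def uminus_pseries.rep_eq)
    then show "\<exists>g\<in>carrier Lambda_Z. g \<oplus>\<^bsub>Lambda_Z\<^esub> f = \<zero>\<^bsub>Lambda_Z\<^esub>"
      by (intro bexI[of _ "- f"]) (auto simp: Lambda_Z_def)
  qed (auto simp: Lambda_Z_def add ac_simps symmetric_def plus_pseries.rep_eq
      zero_pseries.rep_eq bounded_degree_def[of 0])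
  show "comm_monoid Lambda_Z"
    by (rule comm_monoidI)
      (auto simp: Lambda_Z_def symmetric_mult bounded_degree_mult symmetric_one ac_simps
        bounded_degree_def[of 1] one_pseries.rep_eq intro: exI[of _ "total_degree 0"])
qed (auto simp: Lambda_Z_def distrib_right)

definition partitions :: "nat list set" where
  "partitions = {\<mu>. sorted_wrt (\<ge>) \<mu> \<and> 0 \<notin> set \<mu>}"

definition monomial_fun :: "nat list \<Rightarrow> pseries" where
  "monomial_fun \<mu> = Abs_pseries (\<lambda>\<alpha>.
     if image_mset (Poly_Mapping.lookup \<alpha>) (mset_set (Poly_Mapping.keys \<alpha>)) = mset \<mu> then 1 else 0)"

lemma pcoeff_monomial_fun:
  "pcoeff (monomial_fun \<mu>) \<alpha> =
    (if image_mset (Poly_Mapping.lookup \<alpha>) (mset_set (Poly_Mapping.keys \<alpha>)) = mset \<mu> then 1 else 0)"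
  by (simp add: monomial_fun_def Abs_pseries_inverse)

lemma monomial_fun_in_Lambda_Z: "monomial_fun \<mu> \<in> carrier Lambda_Z"
proof -
  have "image_mset (Poly_Mapping.lookup (Poly_Mapping.map_key \<pi> \<alpha>)) (mset_set (Poly_Mapping.keys (Poly_Mapping.map_key \<pi> \<alpha>)))
      = image_mset (Poly_Mapping.lookup \<alpha>) (mset_set (Poly_Mapping.keys \<alpha>))"
    if \<pi>: "bij \<pi>" for \<pi> :: "nat \<Rightarrow> nat" and \<alpha> :: monom
  proof -
    have "image_mset (Poly_Mapping.lookup (Poly_Mapping.map_key \<pi> \<alpha>)) (mset_set (Poly_Mapping.keys (Poly_Mapping.map_key \<pi> \<alpha>)))
      = image_mset (Poly_Mapping.lookup \<alpha>) (image_mset \<pi> (mset_set (\<pi> -` Poly_Mapping.keys \<alpha>)))"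
      using \<pi> by (simp add: keys_map_key bij_is_inj map_key.rep_eq multiset.map_comp)
    also have "image_mset \<pi> (mset_set (\<pi> -` Poly_Mapping.keys \<alpha>)) = mset_set (\<pi> ` (\<pi> -` Poly_Mapping.keys \<alpha>))"
      using \<pi> by (intro image_mset_mset_set) (meson bij_is_inj inj_on_subset subset_UNIV)
    also have "\<pi> ` (\<pi> -` Poly_Mapping.keys \<alpha>) = Poly_Mapping.keys \<alpha>"
      using \<pi> by (simp add: bij_is_surj surj_image_vimage_eq)
    finally show ?thesis .
  qed
  moreover have "total_degree \<alpha> \<le> sum_list \<mu>"
    if "image_mset (Poly_Mapping.lookup \<alpha>) (mset_set (Poly_Mapping.keys \<alpha>)) = mset \<mu>" for \<alpha>
    using arg_cong[OF that, of sum_mset] by (simp add: total_degree_def sum_unfold_sum_mset sum_mset_sum_list)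
  ultimately show ?thesis
    by (auto simp: Lambda_Z_def symmetric_def bounded_degree_def pcoeff_monomial_fun)
qed

definition diagram :: "nat list \<Rightarrow> (nat \<times> nat) set" where
  "diagram \<mu> = {(i, j). i < length \<mu> \<and> j < \<mu> ! i}"

text \<open>
  Semistandard Young tableaux: rows weakly increasing, columns strictly increasing. The entry \<open>k\<close>
  stands for the variable with index \<open>k\<close>, so entries start at \<open>0\<close>.
\<close>

definition ssyt :: "nat list \<Rightarrow> (nat \<times> nat \<Rightarrow> nat) set" where
  "ssyt \<mu> = {T \<in> diagram \<mu> \<rightarrow>\<^sub>E UNIV.
     (\<forall>i j j'. j < j' \<and> (i, j) \<in> diagram \<mu> \<and> (i, j') \<in> diagram \<mu> \<longrightarrow> T (i, j) \<le> T (i, j')) \<and>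
     (\<forall>i i' j. i < i' \<and> (i, j) \<in> diagram \<mu> \<and> (i', j) \<in> diagram \<mu> \<longrightarrow> T (i, j) < T (i', j))}"

definition schur_fun :: "nat list \<Rightarrow> pseries" where
  "schur_fun \<mu> = Abs_pseries (\<lambda>\<alpha>. int (card {T \<in> ssyt \<mu>.
     \<forall>k. card {c \<in> diagram \<mu>. T c = k} = Poly_Mapping.lookup \<alpha> k}))"

text \<open>Finite \<open>\<nat>\<close>-linear combinations of a family indexed by partitions.\<close>

definition nat_span :: "(nat list \<Rightarrow> pseries) \<Rightarrow> pseries set" where
  "nat_span b = {\<Sum>\<mu>\<in>S. of_nat (c \<mu>) * b \<mu> | S c. finite S \<and> S \<subseteq> partitions}"

definition Lambda_N :: "pseries ring" where
  "Lambda_N = Lambda_Z\<lparr>carrier := nat_span monomial_fun\<rparr>"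

definition Lambda_Sch :: "pseries ring" where
  "Lambda_Sch = Lambda_Z\<lparr>carrier := nat_span schur_fun\<rparr>"

section \<open>Semiring homomorphisms and Witt vectors\<close>

text \<open>
  \<^const>\<open>ring_hom\<close> does not demand preservation of \<open>\<zero>\<close>, which is not automatic for semirings.
  Homomorphisms are made extensional so that two of them that agree on the carrier are equal;
  otherwise the arbitrary values outside the carrier would spoil cardinalities.
\<close>

definition semiring_Hom :: "('a, 'm) ring_scheme \<Rightarrow> ('b, 'n) ring_scheme \<Rightarrow> ('a \<Rightarrow> 'b) set" where
  "semiring_Hom R S = {h \<in> ring_hom R S. h \<zero>\<^bsub>R\<^esub> = \<zero>\<^bsub>S\<^esub>} \<inter> extensional (carrier R)"

definition Witt :: "('a, 'm) ring_scheme \<Rightarrow> (pseries \<Rightarrow> 'a) set" where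
  "Witt A = semiring_Hom Lambda_N A"

definition Witt_Sch :: "('a, 'm) ring_scheme \<Rightarrow> (pseries \<Rightarrow> 'a) set" where
  "Witt_Sch A = semiring_Hom Lambda_Sch A"

section \<open>The semiring \<open>\<nat>/(n = n + 1)\<close>\<close>

definition nat_congruence :: "(nat \<times> nat) set \<Rightarrow> bool" where
  "nat_congruence r \<longleftrightarrow> equiv UNIV r \<and>
     (\<forall>a b c d. (a, b) \<in> r \<and> (c, d) \<in> r \<longrightarrow> (a + c, b + d) \<in> r \<and> (a * c, b * d) \<in> r)"

definition trunc_cong :: "nat \<Rightarrow> (nat \<times> nat) set" where
  "trunc_cong n = \<Inter>{r. nat_congruence r \<and> (n, n + 1) \<in> r}"

definition trunc_nat :: "nat \<Rightarrow> nat set ring" where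
  "trunc_nat n = \<lparr>carrier = UNIV // trunc_cong n,
     monoid.mult = (\<lambda>X Y. \<Union>x\<in>X. \<Union>y\<in>Y. trunc_cong n `` {x * y}),
     one = trunc_cong n `` {1},
     zero = trunc_cong n `` {0},
     add = (\<lambda>X Y. \<Union>x\<in>X. \<Union>y\<in>Y. trunc_cong n `` {x + y})\<rparr>"

lemma min_congruence: "nat_congruence {(a, b). min a n = min b n}"
proof -
  have m: "min (a * c) n = min (min a n * min c n) n" for a c :: nat
  proof (cases "a = 0 \<or> c = 0")
    case False
    then have le: "n \<le> n * c" "n \<le> a * n" "a \<le> a * c" "c \<le> a * c" "n \<le> n * n" by auto
    show ?thesis
    proof (cases "a \<le> n \<and> c \<le> n")
      case False
      then have "n \<le> a * c" "n \<le> min a n * min c n"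
        using le by (auto simp: min_def intro: order_trans[of n a] order_trans[of n c])
      then show ?thesis by simp
    qed (simp add: min_absorb1)
  qed auto
  have p: "min (a + c) n = min (min a n + min c n) n" for a c :: nat
    by (auto simp: min_def)
  have "(a, b) \<in> {(a, b). min a n = min b n} \<Longrightarrow> (c, d) \<in> {(a, b). min a n = min b n} \<Longrightarrow>
    min (a + c) n = min (b + d) n \<and> min (a * c) n = min (b * d) n" for a b c d
    using p[of a c] p[of b d] m[of a c] m[of b d] by simp
  moreover have "equiv UNIV {(a, b). min a n = min b n}"
    by (rule equivI) (simp_all add: refl_on_def sym_def trans_def)
  ultimately show ?thesis
    unfolding nat_congruence_def by blast
qed

lemma trunc_cong_iff: "(a, b) \<in> trunc_cong n \<longleftrightarrow> min a n = min b n"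
proof
  show "(a, b) \<in> trunc_cong n \<Longrightarrow> min a n = min b n"
    using min_congruence[of n] by (auto simp: trunc_cong_def)
next
  assume eq: "min a n = min b n"
  have "(a, b) \<in> r" if r: "nat_congruence r" "(n, n + 1) \<in> r" for r
  proof -
    from r have e: "refl r" "sym r" "trans r" and
      add: "\<And>a b c d. (a, b) \<in> r \<Longrightarrow> (c, d) \<in> r \<Longrightarrow> (a + c, b + d) \<in> r"
      by (auto simp: nat_congruence_def equiv_def)
    have up: "(n, n + k) \<in> r" for k
    proof (induction k)
      case 0
      then show ?case using e(1) by (auto simp: refl_on_def)
    next
      case (Suc k)
      have "(k, k) \<in> r" using e(1) by (auto simp: refl_on_def)
      from add[OF r(2) this] have "(n + k, n + Suc k) \<in> r" by simp
      with Suc e(3) show ?case by (meson transD)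
    qed
    show ?thesis
    proof (cases "a < n")
      case True
      with eq have "a = b" by (auto simp: min_def split: if_splits)
      with e(1) show ?thesis by (auto simp: refl_on_def)
    next
      case False
      with eq have "n \<le> a" "n \<le> b" by (auto simp: min_def split: if_splits)
      then have "(n, a) \<in> r" "(n, b) \<in> r"
        using up[of "a - n"] up[of "b - n"] by auto
      with e show ?thesis by (meson symD transD)
    qed
  qed
  then show "(a, b) \<in> trunc_cong n" by (auto simp: trunc_cong_def)
qed

lemma trunc_cong_congruence: "nat_congruence (trunc_cong n)"
proof -
  have "trunc_cong n = {(a, b). min a n = min b n}"
    using trunc_cong_iff by auto
  with min_congruence show ?thesis by simp
qed

lemma trunc_nat_carrier:
  "carrier (trunc_nat n) = (\<lambda>a. trunc_cong n `` {a}) ` {..n}"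
proof -
  have "trunc_cong n `` {a} = trunc_cong n `` {min a n}" for a
    by (auto simp: trunc_cong_iff)
  then have "trunc_cong n `` {a} \<in> (\<lambda>a. trunc_cong n `` {a}) ` {..n}" for a
    by (rule image_eqI[where x = "min a n"]) simp
  then show ?thesis
    by (auto simp: trunc_nat_def quotient_def)
qed

lemma trunc_nat_class_inj: "inj_on (\<lambda>a. trunc_cong n `` {a}) {..n}"
proof (rule inj_onI)
  fix a b assume ab: "a \<in> {..n}" "b \<in> {..n}" and eq: "trunc_cong n `` {a} = trunc_cong n `` {b}"
  have "a \<in> trunc_cong n `` {a}" by (simp add: trunc_cong_iff)
  then have "a \<in> trunc_cong n `` {b}" by (simp only: eq)
  then have "min b n = min a n" by (simp add: trunc_cong_iff)
  with ab show "a = b" by (simp add: min_absorb1)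
qed

lemma trunc_nat_add:
  "add (trunc_nat n) (trunc_cong n `` {a}) (trunc_cong n `` {b}) = trunc_cong n `` {a + b}"
  and trunc_nat_mult:
  "monoid.mult (trunc_nat n) (trunc_cong n `` {a}) (trunc_cong n `` {b}) = trunc_cong n `` {a * b}"
proof -
  let ?C = "\<lambda>a. trunc_cong n `` {a}"
  have c: "?C (x + y) = ?C (a + b)" "?C (x * y) = ?C (a * b)" if "x \<in> ?C a" "y \<in> ?C b" for x y
  proof -
    from that have "(a, x) \<in> trunc_cong n" "(b, y) \<in> trunc_cong n" by auto
    with trunc_cong_congruence[of n]
    have "(a + b, x + y) \<in> trunc_cong n" "(a * b, x * y) \<in> trunc_cong n"
      unfolding nat_congruence_def by blast+
    moreover have "equiv UNIV (trunc_cong n)"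
      using trunc_cong_congruence[of n] by (simp add: nat_congruence_def)
    ultimately show "?C (x + y) = ?C (a + b)" "?C (x * y) = ?C (a * b)"
      using equiv_class_eq by metis+
  qed
  have ne: "a \<in> ?C a" "b \<in> ?C b" by (simp_all add: trunc_cong_iff)
  have "(\<Union>x\<in>?C a. \<Union>y\<in>?C b. ?C (x + y)) = (\<Union>x\<in>?C a. \<Union>y\<in>?C b. ?C (a + b))"
    using c(1) by (intro SUP_cong refl)
  also have "\<dots> = ?C (a + b)" using ne by blast
  finally show "add (trunc_nat n) (?C a) (?C b) = ?C (a + b)" by (simp add: trunc_nat_def)
  have "(\<Union>x\<in>?C a. \<Union>y\<in>?C b. ?C (x * y)) = (\<Union>x\<in>?C a. \<Union>y\<in>?C b. ?C (a * b))"
    using c(2) by (intro SUP_cong refl)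
  also have "\<dots> = ?C (a * b)" using ne by blast
  finally show "monoid.mult (trunc_nat n) (?C a) (?C b) = ?C (a * b)" by (simp add: trunc_nat_def)
qed

lemma trunc_nat_semiring: "semiring (trunc_nat n)"
proof -
  have zero: "\<zero>\<^bsub>trunc_nat n\<^esub> = trunc_cong n `` {0}" and one: "\<one>\<^bsub>trunc_nat n\<^esub> = trunc_cong n `` {1}"
    by (simp_all add: trunc_nat_def)
  have carr: "X \<in> carrier (trunc_nat n) \<longleftrightarrow> (\<exists>a. X = trunc_cong n `` {a})" for X
    by (auto simp: trunc_nat_def quotient_def)
  show ?thesis
    by unfold_locales
      (auto simp: carr zero one trunc_nat_add trunc_nat_mult algebra_simps)
qed

end

theory Submission
  imports Defs "HOL-Combinatorics.Permutations"
begin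

text \<open>
  Write \<open>v\<close> for the values of a homomorphism \<open>h\<close> on the basis elements, and let \<open>P\<close> be the set of
  partitions with \<open>v \<noteq> 0\<close>. Since a product of two nonzero elements of \<open>\<nat>/(n = n + 1)\<close> is nonzero, \<open>P\<close> is
  closed downwards and directed under inclusion of diagrams. In every term of a product, the number of
  boxes outside a hook with \<open>x\<close> infinite rows and \<open>y\<close> infinite columns is at least the sum of the
  numbers for the factors; applied to high powers this forces \<open>P\<close> to be either everything or such a hook.
  If \<open>n \<le> 2\<close>, then \<open>v f = n\<close> as soon as the square of the basis element of \<open>f \<in> P\<close> has two terms in \<open>P\<close>. This
  holds for all \<open>f\<close> outside a sequence of rectangles, on which \<open>v\<close> is encoded by an additively closed set
  of numbers, and there are only countably many of these.

  If \<open>n \<ge> 3\<close>, let \<open>c k\<close> be the coefficient of a product of \<open>k\<close> distinct variables, so that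
  \<open>c k (f * g) = (\<Sum>i\<le>k. (k choose i) * c i f * c (k - i) g)\<close>. For any sequence with \<open>u 0 = 1\<close> and
  \<open>u k \<in> {n - 1, n}\<close> for \<open>k > 0\<close>, both \<open>u i * u j\<close> and \<open>(i + j choose i) * u (i + j)\<close> are at least \<open>n\<close> when
  \<open>i, j > 0\<close>, and so \<open>f \<mapsto> (\<Sum>k. c k f * u k)\<close> is a homomorphism.

  For Schur functions, the terms of products are given by the Littlewood--Richardson rule, proved
  following Stembridge by a sign reversing involution on tableaux encoded as Gelfand--Tsetlin patterns.
\<close>

section \<open>Partitions as functions\<close>

text \<open>The threshold lies in the squares of unsaturated values. For n \<ge> 3 the value n - 1
  satisfies (n - 1)^2 \<ge> n, so products of such values saturate and cannot tell n - 1 from n. For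
  n \<le> 2 the only nonzero value that can be below n is 1, and 1 * 1 = 1 stays unsaturated: a
  value 1 < n at f forces the square of its basis element to have a single term in P.

  Both bases enter only through a few properties of their products, collected in the locale
  \<open>product_basis\<close>. For monomials the terms of a product are sums of rearranged exponent
  vectors. Schur functions have no such description, and alternants exist only in finitely many
  variables; products are computed in N variables, with N beyond every letter that can occur, and
  the required terms are exhibited by explicit patterns.\<close>

definition ptn :: "(nat \<Rightarrow> nat) \<Rightarrow> bool" where
  "ptn f \<longleftrightarrow> antimono f \<and> finite {i. f i \<noteq> 0}"

definition row :: "nat list \<Rightarrow> nat \<Rightarrow> nat" where
  "row \<mu> i = (if i < length \<mu> then \<mu> ! i else 0)"

text \<open>As functions, partitions can be added and compared row by row. \<open>row\<close> and
  \<open>lst\<close> translate to and from the lists that index the bases.\<close>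

definition lst :: "(nat \<Rightarrow> nat) \<Rightarrow> nat list" where
  "lst f = map f [0..<card {i. f i \<noteq> 0}]"

text \<open>Counts the boxes (i, j) of f with x \<le> i and y \<le> j. For x = 0 these are the boxes
  from column y on, which is how tableaux are cut later.\<close>

definition out :: "nat \<Rightarrow> nat \<Rightarrow> (nat \<Rightarrow> nat) \<Rightarrow> nat" where
  "out x y f = (\<Sum>i | x \<le> i \<and> y < f i. f i - y)"

lemma ptn_antimono: "ptn f \<Longrightarrow> i \<le> j \<Longrightarrow> f j \<le> f i"
  by (auto simp: ptn_def dest: antimonoD)

lemma ptnI:
  assumes "\<And>i. f (Suc i) \<le> f i" "\<And>i. N \<le> i \<Longrightarrow> f i = 0"
  shows "ptn f"
proof -
  have "{i. f i \<noteq> 0} \<subseteq> {..<N}" using assms(2) by (auto intro: ccontr)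
  then show ?thesis using assms(1)
    by (auto simp: ptn_def antimono_iff_le_Suc intro: finite_subset)
qed

lemma initial_segment:
  assumes "antimono f" "finite {i. t < f i}"
  shows "{i. t < f i} = {..<card {i. t < f i}}"
proof (cases "\<forall>i. t < f i")
  case True
  then show ?thesis using assms(2) by simp
next
  case False
  define k where "k = (LEAST i. \<not> t < f i)"
  have nk: "\<not> t < f k" using False unfolding k_def by (metis (mono_tags, lifting) LeastI)
  have lk: "t < f i" if "i < k" for i
    using not_less_Least[of i "\<lambda>i. \<not> t < f i"] that unfolding k_def by blast
  have "{i. t < f i} = {..<k}"
  proof (rule Set.set_eqI)
    fix i show "i \<in> {i. t < f i} \<longleftrightarrow> i \<in> {..<k}"
      using nk lk[of i] antimonoD[OF assms(1), of k i] by (cases "i < k") auto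
  qed
  then show ?thesis by simp
qed

lemma ptn_finite: "ptn f \<Longrightarrow> finite {i. t < f i}"
  by (rule finite_subset[of _ "{i. f i \<noteq> 0}"]) (auto simp: ptn_def)

text \<open>The cardinality is the length of column t, a part of the conjugate partition; both sides
  say that the box (i, t) lies in f.\<close>

lemma ptn_less_card_iff: "ptn f \<Longrightarrow> i < card {i. t < f i} \<longleftrightarrow> t < f i"
  using initial_segment[of f t] ptn_finite[of f t] by (auto simp: ptn_def)

lemma ptn_nz_iff: "ptn f \<Longrightarrow> f i \<noteq> 0 \<longleftrightarrow> i < card {i. f i \<noteq> 0}"
  using ptn_less_card_iff[of f i 0] by simp

lemma ptn_eventually_zero: "ptn f \<Longrightarrow> \<exists>N. \<forall>i\<ge>N. f i = 0"
  using ptn_nz_iff by (metis not_le)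

lemma length_lst: "ptn f \<Longrightarrow> i < length (lst f) \<longleftrightarrow> f i \<noteq> 0"
  using ptn_nz_iff[of f i] by (simp only: lst_def length_map length_upt) simp

lemma nth_lst: "i < length (lst f) \<Longrightarrow> lst f ! i = f i"
  by (simp add: lst_def)

lemma row_lst: "ptn f \<Longrightarrow> row (lst f) = f"
  by (rule ext) (auto simp only: row_def length_lst nth_lst split: if_split)

lemma lst_partition:
  assumes "ptn f" shows "lst f \<in> partitions"
proof -
  have "lst f ! j \<le> lst f ! i" if "i < j" "j < length (lst f)" for i j
    using that nth_lst[of i f] nth_lst[of j f] ptn_antimono[OF assms, of i j] by simp
  moreover have "lst f ! i \<noteq> 0" if "i < length (lst f)" for i
    using that length_lst[OF assms, of i] nth_lst[OF that] by simp
  ultimately show ?thesis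
    unfolding partitions_def by (auto simp: sorted_wrt_iff_nth_less in_set_conv_nth)
qed

lemma row_nz: "\<mu> \<in> partitions \<Longrightarrow> row \<mu> i \<noteq> 0 \<longleftrightarrow> i < length \<mu>"
  unfolding partitions_def row_def by (auto simp: in_set_conv_nth)

lemma row_ptn:
  assumes "\<mu> \<in> partitions" shows "ptn (row \<mu>)"
proof (rule ptnI[of _ "length \<mu>"])
  show "row \<mu> (Suc i) \<le> row \<mu> i" for i
    using assms by (auto simp: partitions_def row_def sorted_wrt_iff_nth_less)
qed (auto simp: row_def)

lemma lst_row:
  assumes "\<mu> \<in> partitions" shows "lst (row \<mu>) = \<mu>"
proof -
  have "length (lst (row \<mu>)) = length \<mu>"
    using length_lst[OF row_ptn[OF assms]] row_nz[OF assms] by (metis linorder_neqE_nat less_irrefl)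
  then show ?thesis
    by (intro nth_equalityI) (simp_all add: nth_lst row_def)
qed

lemma diagram_row: "diagram \<mu> = {(i, j). j < row \<mu> i}"
  by (auto simp: diagram_def row_def split: if_splits)

lemma diagram_lst: "ptn f \<Longrightarrow> diagram (lst f) = {(i, j). j < f i}"
  by (simp add: diagram_row row_lst)

lemma ptn_zero: "ptn (\<lambda>_. 0)" by (rule ptnI[of _ 0]) auto

lemma lst_zero: "lst (\<lambda>_. 0) = []" by (simp add: lst_def)

lemma out_eq:
  assumes "\<And>i. N \<le> i \<Longrightarrow> f i = 0"
  shows "out x y f = (\<Sum>i\<in>{x..<N}. f i - y)"
  unfolding out_def
proof (rule sum.mono_neutral_left)
  show "{i. x \<le> i \<and> y < f i} \<subseteq> {x..<N}" using assms by (auto intro: ccontr)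
qed auto

lemma out_pos_iff: "ptn f \<Longrightarrow> 0 < out x y f \<longleftrightarrow> y < f x"
proof -
  assume f: "ptn f"
  have fin: "finite {i. x \<le> i \<and> y < f i}" by (rule finite_subset[OF _ ptn_finite[OF f, of y]]) auto
  have "0 < out x y f \<longleftrightarrow> (\<exists>i\<ge>x. y < f i)"
    unfolding out_def using fin by (auto simp: zero_less_iff_neq_zero)
  also have "\<dots> \<longleftrightarrow> y < f x" using ptn_antimono[OF f] by (meson le_trans le_refl not_le)
  finally show ?thesis .
qed

section \<open>Truncated natural numbers\<close>

abbreviation cls :: "nat \<Rightarrow> nat \<Rightarrow> nat set" where
  "cls n a \<equiv> trunc_cong n `` {a}"

lemma cls_eq_iff: "cls n a = cls n c \<longleftrightarrow> min a n = min c n"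
proof
  assume "cls n a = cls n c"
  moreover have "c \<in> cls n c" by (simp add: trunc_cong_iff)
  ultimately show "min a n = min c n" by (simp add: trunc_cong_iff set_eq_iff)
qed (auto simp: trunc_cong_iff)

lemma Least_cls: "(LEAST k. k \<in> cls n a) = min a n"
  by (rule Least_equality) (auto simp: trunc_cong_iff)

lemma Least_trunc_cong: "(LEAST k. (a, k) \<in> trunc_cong n) = min a n"
  using Least_cls[of n a] by simp

lemma trunc_carrier_iff: "X \<in> carrier (trunc_nat n) \<longleftrightarrow> (\<exists>a. X = cls n a)"
  by (auto simp: trunc_nat_def quotient_def)

lemma trunc_zero: "\<zero>\<^bsub>trunc_nat n\<^esub> = cls n 0" and trunc_one: "\<one>\<^bsub>trunc_nat n\<^esub> = cls n 1"
  by (simp_all add: trunc_nat_def)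

section \<open>Additively closed sets of natural numbers\<close>

inductive_set additive_hull :: "nat set \<Rightarrow> nat set" for F where
  base: "a \<in> F \<Longrightarrow> a \<in> additive_hull F"
| add: "a \<in> additive_hull F \<Longrightarrow> c \<in> additive_hull F \<Longrightarrow> a + c \<in> additive_hull F"

text \<open>Fix m > 0 in S. In each residue class modulo m that S meets, the least member of S
  yields all others by adding multiples of m. So m and these representatives generate S.\<close>

lemma additively_closed_finitely_generated:
  fixes S :: "nat set"
  assumes closed: "\<And>a c. a \<in> S \<Longrightarrow> c \<in> S \<Longrightarrow> a + c \<in> S"
  shows "\<exists>F. finite F \<and> S = additive_hull F"
proof -
  have sub: "additive_hull F \<subseteq> S" if "F \<subseteq> S" for F
  proof
    fix a assume "a \<in> additive_hull F"
    then show "a \<in> S" by induction (use that closed in auto)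
  qed
  show ?thesis
  proof (cases "S \<subseteq> {0}")
    case True
    then have "finite S" using finite_subset by blast
    moreover have "S = additive_hull S" using sub[of S] by (auto intro: additive_hull.base)
    ultimately show ?thesis by blast
  next
    case False
    then obtain m where m: "m \<in> S" "m > 0" by auto
    define f where "f r = (LEAST s. s \<in> S \<and> s mod m = r)" for r
    \<comment> \<open>The intersection with S discards residues that S does not meet, where
      \<open>LEAST\<close> is arbitrary.\<close>
    define F where "F = insert m ({s \<in> S. s \<in> f ` {..<m}})"
    have "finite F" unfolding F_def by (rule finite.insertI, rule finite_subset[of _ "f ` {..<m}"]) auto
    have "s \<in> additive_hull F" if s: "s \<in> S" for s
    proof -
      have *: "f (s mod m) \<in> S \<and> f (s mod m) mod m = s mod m" "f (s mod m) \<le> s"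
        unfolding f_def using s by (auto intro: LeastI2[of _ s] Least_le)
      then obtain k where k: "s = f (s mod m) + m * k"
        by (metis le_add_diff_inverse mod_eq_dvd_iff_nat dvd_def)
      have "f (s mod m) \<in> F" "m \<in> F" unfolding F_def using * m by auto
      then have F: "f (s mod m) \<in> additive_hull F" "m \<in> additive_hull F"
        by (simp_all add: additive_hull.base)
      have "f (s mod m) + m * k' \<in> additive_hull F" for k'
      proof (induction k')
        case (Suc k')
        from additive_hull.add[OF this F(2)] show ?case by (simp add: algebra_simps)
      qed (simp add: F)
      with k show ?thesis by metis
    qed
    moreover have "F \<subseteq> S" using m by (auto simp: F_def)
    ultimately show ?thesis using sub[of F] \<open>finite F\<close> by blast
  qed
qed

lemma countable_additively_closed:
  "countable {S :: nat set. \<forall>a\<in>S. \<forall>c\<in>S. a + c \<in> S}"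
proof (rule countable_subset)
  show "{S :: nat set. \<forall>a\<in>S. \<forall>c\<in>S. a + c \<in> S} \<subseteq> additive_hull ` {F. finite F}"
    using additively_closed_finitely_generated by fastforce
  show "countable (additive_hull ` {F. finite F})"
    by (intro countable_image countable_Collect_finite)
qed

section \<open>Bases with nonnegative structure constants\<close>

definition sqf :: "nat set \<Rightarrow> monom" where
  "sqf S = Abs_poly_mapping (\<lambda>i. if i \<in> S then 1 else 0)"

lemma lookup_sqf: "finite S \<Longrightarrow> Poly_Mapping.lookup (sqf S) i = (if i \<in> S then 1 else 0)"
  unfolding sqf_def by (subst lookup_Abs_poly_mapping) (auto intro: finite_subset[of _ S])

text \<open>\<open>M f g\<close> lists the terms of a product with multiplicity. The family
  \<open>R x y\<close> contains every shape in the hook (x, y) whose square may have fewer than two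
  terms there. \<open>M_out\<close> limits the terms that can occur, \<open>M_box\<close> lets a
  shape grow by one box. The assumptions on coefficients serve the homomorphisms for n \<ge> 3;
  \<open>b_column\<close> reflects that columns give the elementary symmetric functions.\<close>

locale product_basis =
  fixes b :: "nat list \<Rightarrow> pseries"
    and M :: "(nat \<Rightarrow> nat) \<Rightarrow> (nat \<Rightarrow> nat) \<Rightarrow> (nat \<Rightarrow> nat) multiset"
    and R :: "nat \<Rightarrow> nat \<Rightarrow> nat \<Rightarrow> nat \<Rightarrow> nat"
  assumes b_Nil: "b [] = 1"
    and M_ptn: "\<And>f g p. ptn f \<Longrightarrow> ptn g \<Longrightarrow> p \<in># M f g \<Longrightarrow> ptn p"
    and b_mult: "\<And>f g. ptn f \<Longrightarrow> ptn g \<Longrightarrow> b (lst f) * b (lst g) = (\<Sum>p\<in>#M f g. b (lst p))"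
    and M_out: "\<And>f g p x y. ptn f \<Longrightarrow> ptn g \<Longrightarrow> p \<in># M f g \<Longrightarrow> out x y f + out x y g \<le> out x y p"
    and M_box: "\<And>f i. ptn f \<Longrightarrow> ptn (f(i := Suc (f i))) \<Longrightarrow>
      f(i := Suc (f i)) \<in># M f (\<lambda>k. if k = 0 then 1 else 0)"
    and M_square: "\<And>f. ptn f \<Longrightarrow> f \<noteq> (\<lambda>_. 0) \<Longrightarrow> 2 \<le> size (M f f)"
    and M_square_hook: "\<And>f x y. ptn f \<Longrightarrow> f x \<le> y \<Longrightarrow> f \<notin> range (R x y) \<Longrightarrow>
      2 \<le> size {#p \<in># M f f. p x \<le> y#}"
    and R_ptn: "\<And>x y a. ptn (R x y a)"
    and R_hook: "\<And>x y a. R x y a x \<le> y"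
    and R_add: "\<And>x y a c. R x y (a + c) \<in># M (R x y a) (R x y c)"
    and b_nonneg: "\<And>f \<alpha>. ptn f \<Longrightarrow> 0 \<le> pcoeff (b (lst f)) \<alpha>"
    and b_sqf: "\<And>f S. ptn f \<Longrightarrow> finite S \<Longrightarrow>
      pcoeff (b (lst f)) (sqf S) = pcoeff (b (lst f)) (sqf {..<card S})"
    and b_bounded: "\<And>f. ptn f \<Longrightarrow> bounded_degree (b (lst f))"
    and b_column: "\<And>k j. pcoeff (b (replicate k 1)) (sqf {..<j}) = (if j = k then 1 else 0)"
begin

section \<open>Arithmetic in the span of the basis\<close>

abbreviation span :: "pseries ring" where
  "span \<equiv> Lambda_Z\<lparr>carrier := nat_span b\<rparr>"

text \<open>With coefficients in \<nat> a combination is a sum over a multiset, which allows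
  induction over the terms.\<close>

lemma span_mset: "nat_span b = {(\<Sum>p\<in>#N. b (lst p)) | N. \<forall>p\<in>#N. ptn p}"
proof (intro subset_antisym subsetI)
  fix X assume "X \<in> nat_span b"
  then obtain S c where S: "finite S" "S \<subseteq> partitions" and X: "X = (\<Sum>\<mu>\<in>S. of_nat (c \<mu>) * b \<mu>)"
    by (auto simp: nat_span_def)
  define N where "N = (\<Sum>\<mu>\<in>S. replicate_mset (c \<mu>) (row \<mu>))"
  have "(\<Sum>p\<in>#N. b (lst p)) = (\<Sum>\<mu>\<in>S. of_nat (c \<mu>) * b (lst (row \<mu>)))"
    using S(1) unfolding N_def by (induction) auto
  also have "\<dots> = X" unfolding X using S(2) by (intro sum.cong) (auto simp: lst_row)
  finally have "X = (\<Sum>p\<in>#N. b (lst p))" by simp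
  moreover have "\<forall>p\<in>#N. ptn p"
    using S unfolding N_def by (induction) (auto simp: row_ptn)
  ultimately show "X \<in> {(\<Sum>p\<in>#N. b (lst p)) | N. \<forall>p\<in>#N. ptn p}" by blast
next
  fix X assume "X \<in> {(\<Sum>p\<in>#N. b (lst p)) | N. \<forall>p\<in>#N. ptn p}"
  then obtain N where N: "\<forall>p\<in>#N. ptn p" and X: "X = (\<Sum>p\<in>#N. b (lst p))" by blast
  define L where "L = image_mset lst N"
  have "X = (\<Sum>\<mu>\<in>#L. b \<mu>)" by (simp add: X L_def multiset.map_comp comp_def)
  also have "\<dots> = (\<Sum>\<mu>\<in>set_mset L. of_nat (count L \<mu>) * b \<mu>)"
  proof (induction L)
    case (add \<nu> L)
    have "(\<Sum>\<mu>\<in>set_mset (add_mset \<nu> L). of_nat (count (add_mset \<nu> L) \<mu>) * b \<mu>)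
        = (\<Sum>\<mu>\<in>insert \<nu> (set_mset L). of_nat (count L \<mu>) * b \<mu> + (if \<mu> = \<nu> then b \<nu> else 0))"
      by (intro sum.cong) (auto simp: algebra_simps)
    also have "\<dots> = (\<Sum>\<mu>\<in>insert \<nu> (set_mset L). of_nat (count L \<mu>) * b \<mu>) + b \<nu>"
      by (simp add: sum.distrib)
    also have "(\<Sum>\<mu>\<in>insert \<nu> (set_mset L). of_nat (count L \<mu>) * b \<mu>)
        = (\<Sum>\<mu>\<in>set_mset L. of_nat (count L \<mu>) * b \<mu>)"
      by (rule sum.mono_neutral_right) (auto simp: not_in_iff)
    finally show ?case using add by (simp add: add.commute)
  qed simp
  finally have X': "X = (\<Sum>\<mu>\<in>set_mset L. of_nat (count L \<mu>) * b \<mu>)" .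
  have "set_mset L \<subseteq> partitions" using N by (auto simp: L_def lst_partition)
  with X' show "X \<in> nat_span b" unfolding nat_span_def by (auto intro!: exI[of _ "set_mset L"] exI[of _ "count L"])
qed

lemma span_sum: "\<forall>p\<in>#N. ptn p \<Longrightarrow> (\<Sum>p\<in>#N. b (lst p)) \<in> nat_span b"
  unfolding span_mset by blast

lemma span_b: "ptn p \<Longrightarrow> b (lst p) \<in> nat_span b"
  using span_sum[of "{#p#}"] by simp

lemma span_mult: "X \<in> nat_span b \<Longrightarrow> Y \<in> nat_span b \<Longrightarrow> X * Y \<in> nat_span b"
proof -
  assume "X \<in> nat_span b" "Y \<in> nat_span b"
  then obtain N K where N: "\<forall>p\<in>#N. ptn p" "X = (\<Sum>p\<in>#N. b (lst p))"
    and K: "\<forall>p\<in>#K. ptn p" "Y = (\<Sum>p\<in>#K. b (lst p))" unfolding span_mset by blast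
  have "X * Y = (\<Sum>p\<in>#N. \<Sum>q\<in>#K. b (lst p) * b (lst q))"
    unfolding N(2) sum_mset_distrib_right by (simp add: K sum_mset_distrib_left)
  also have "\<dots> = (\<Sum>p\<in>#N. \<Sum>q\<in>#K. \<Sum>r\<in>#M p q. b (lst r))"
    using N(1) K(1) by (intro arg_cong[of _ _ sum_mset] image_mset_cong) (auto simp: b_mult)
  also have "\<dots> = (\<Sum>r\<in>#(\<Sum>p\<in>#N. \<Sum>q\<in>#K. M p q). b (lst r))"
  proof (induction N)
    case (add p N)
    have "(\<Sum>q\<in>#K. \<Sum>r\<in>#M p q. b (lst r)) = (\<Sum>r\<in>#(\<Sum>q\<in>#K. M p q). b (lst r))"
      by (induction K) auto
    with add show ?case by simp
  qed simp
  also have "\<dots> \<in> nat_span b"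
  proof (rule span_sum, rule ballI)
    fix r assume "r \<in># (\<Sum>p\<in>#N. \<Sum>q\<in>#K. M p q)"
    then obtain p q where "p \<in># N" "q \<in># K" "r \<in># M p q"
      by (auto simp: in_Union_mset_iff)
    then show "ptn r" using N K M_ptn by blast
  qed
  finally show ?thesis .
qed

subsection \<open>Homomorphisms as families of values\<close>

text \<open>The least element of the class of a is min a n, so \<open>LEAST\<close> picks the
  representative in {0..n}. The default 0 leaves \<open>val h\<close> determined by h on the
  basis.\<close>

definition val :: "(pseries \<Rightarrow> nat set) \<Rightarrow> (nat \<Rightarrow> nat) \<Rightarrow> nat" where
  "val h p = (if ptn p then LEAST k. k \<in> h (b (lst p)) else 0)"

definition vals :: "nat \<Rightarrow> ((nat \<Rightarrow> nat) \<Rightarrow> nat) set" where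
  "vals n = {v. (\<forall>p. \<not> ptn p \<longrightarrow> v p = 0) \<and> (\<forall>p. v p \<le> n) \<and> v (\<lambda>_. 0) = min 1 n \<and>
     (\<forall>f g. ptn f \<longrightarrow> ptn g \<longrightarrow> min (v f * v g) n = min (\<Sum>p\<in>#M f g. v p) n)}"

context
  fixes h n
  assumes h: "h \<in> semiring_Hom span (trunc_nat n)"
begin

lemma h_hom:
  "X \<in> nat_span b \<Longrightarrow> \<exists>a. h X = cls n a"
  "X \<in> nat_span b \<Longrightarrow> Y \<in> nat_span b \<Longrightarrow> h (X + Y) = h X \<oplus>\<^bsub>trunc_nat n\<^esub> h Y"
  "X \<in> nat_span b \<Longrightarrow> Y \<in> nat_span b \<Longrightarrow> h (X * Y) = h X \<otimes>\<^bsub>trunc_nat n\<^esub> h Y"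
  "h 0 = cls n 0" "h 1 = cls n 1"
  using h unfolding semiring_Hom_def ring_hom_def
  by (auto simp: Lambda_Z_def trunc_carrier_iff trunc_zero trunc_one Pi_iff)

lemma h_b: "ptn p \<Longrightarrow> h (b (lst p)) = cls n (val h p)"
proof -
  assume p: "ptn p"
  then obtain a where a: "h (b (lst p)) = cls n a" using h_hom(1)[OF span_b] by blast
  with p have "val h p = min a n" by (simp only: val_def Least_cls if_True)
  with a show ?thesis by (simp only: cls_eq_iff)
qed

lemma h_sum: "\<forall>p\<in>#N. ptn p \<Longrightarrow> h (\<Sum>p\<in>#N. b (lst p)) = cls n (\<Sum>p\<in>#N. val h p)"
proof (induction N)
  case (add p N)
  then show ?case
    using h_hom(2)[of "b (lst p)" "\<Sum>p\<in>#N. b (lst p)"]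
    by (simp add: span_b span_sum h_b trunc_nat_add)
qed (simp add: h_hom)

lemma val_in_vals: "val h \<in> vals n"
proof -
  have "val h p \<le> n" for p
    using h_hom(1)[OF span_b, of p] by (auto simp: val_def Least_trunc_cong)
  moreover have "val h (\<lambda>_. 0) = min 1 n"
    using h_hom(5) by (simp add: val_def ptn_zero lst_zero b_Nil Least_trunc_cong)
  moreover have "min (val h f * val h g) n = min (\<Sum>p\<in>#M f g. val h p) n" if "ptn f" "ptn g" for f g
  proof -
    have "h (b (lst f) * b (lst g)) = cls n (\<Sum>p\<in>#M f g. val h p)"
      unfolding b_mult[OF that] by (rule h_sum) (use M_ptn[OF that] in blast)
    moreover have "h (b (lst f) * b (lst g)) = cls n (val h f * val h g)"
      using that by (simp add: h_hom span_b h_b trunc_nat_mult)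
    ultimately show ?thesis by (simp add: cls_eq_iff)
  qed
  moreover have "\<not> ptn p \<Longrightarrow> val h p = 0" for p by (simp add: val_def)
  ultimately show ?thesis unfolding vals_def by blast
qed

end

lemma val_inj: "inj_on val (semiring_Hom span (trunc_nat n))"
proof (rule inj_onI)
  fix h h' assume h: "h \<in> semiring_Hom span (trunc_nat n)" "h' \<in> semiring_Hom span (trunc_nat n)"
    and eq: "val h = val h'"
  have "h X = h' X" for X
  proof (cases "X \<in> nat_span b")
    case True
    then show ?thesis using h_sum[OF h(1)] h_sum[OF h(2)] by (auto simp: span_mset eq)
  next
    case False
    then show ?thesis using h by (auto simp: semiring_Hom_def extensional_def)
  qed
  then show "h = h'" by blast
qed

text \<open>Row i of f passes column j exactly if \<open>out i j f\<close> is positive, so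
  superadditivity of \<open>out\<close> at all corners includes the inclusion of diagrams.\<close>

lemma M_contains:
  assumes "ptn f" "ptn g" "p \<in># M f g"
  shows "f i \<le> p i" "g i \<le> p i"
proof -
  have "j < p i" if "j < f i \<or> j < g i" for j
    using M_out[OF assms, of i j] that assms M_ptn[OF assms]
      out_pos_iff[of f i j] out_pos_iff[of g i j] out_pos_iff[of p i j] by auto
  then show "f i \<le> p i" "g i \<le> p i" by (meson leI less_irrefl)+
qed

section \<open>Support and values of a homomorphism for n > 0\<close>

context
  fixes v n
  assumes v: "v \<in> vals n" and n: "0 < n"
begin

lemma v_ptn: "v p \<noteq> 0 \<Longrightarrow> ptn p"
  and v_le: "v p \<le> n"
  and v_mult: "ptn f \<Longrightarrow> ptn g \<Longrightarrow> min (v f * v g) n = min (\<Sum>p\<in>#M f g. v p) n"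
  and v_zero: "v (\<lambda>_. 0) = 1"
  using v n by (auto simp: vals_def)

lemma v_term:
  assumes "v f \<noteq> 0" "v g \<noteq> 0"
  obtains p where "p \<in># M f g" "v p \<noteq> 0"
proof -
  have "min (v f * v g) n \<noteq> 0" using assms n by simp
  then have "\<not> (\<forall>x\<in>#image_mset v (M f g). x = 0)"
    using v_mult[OF v_ptn[OF assms(1)] v_ptn[OF assms(2)]] by (metis min_0L sum_mset_0_iff)
  then obtain p where "p \<in># M f g" "v p \<noteq> 0" by auto
  then show ?thesis by (rule that)
qed

text \<open>Induction on the number of boxes of p missing in f. By \<open>M_box\<close>, f with one
  more box is a term of the product of f with a single box; if v vanished at f, it would vanish at
  all terms of that product.\<close>

lemma v_down: "v p \<noteq> 0 \<Longrightarrow> ptn f \<Longrightarrow> (\<And>i. f i \<le> p i) \<Longrightarrow> v f \<noteq> 0"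
proof (induction "\<Sum>i | p i \<noteq> 0. p i - f i" arbitrary: f rule: less_induct)
  case less
  note p = v_ptn[OF less.prems(1)]
  then have fin: "finite {i. p i \<noteq> 0}" by (simp add: ptn_def)
  show ?case
  proof (cases "f = p")
    case False
    then have "\<exists>i. f i \<noteq> p i" by auto
    \<comment> \<open>A box can be added in the first row where f and p differ: the row above agrees
      with that of p and is longer than row i of f.\<close>
    define i where "i = (LEAST i. f i \<noteq> p i)"
    have i: "f i \<noteq> p i" unfolding i_def by (rule LeastI_ex) fact
    then have lt: "f i < p i" using less.prems(3)[of i] by simp
    have before: "f k = p k" if "k < i" for k
      using not_less_Least that unfolding i_def by blast
    let ?f = "f(i := Suc (f i))"
    have "?f (Suc k) \<le> ?f k" for k
      using ptn_antimono[OF less.prems(2), of k "Suc k"] before[of k] lt ptn_antimono[OF p, of k "Suc k"]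
      by auto
    moreover obtain N where "\<forall>k\<ge>N. f k = 0" using ptn_eventually_zero[OF less.prems(2)] by blast
    ultimately have f': "ptn ?f" by (intro ptnI[of ?f "max N (Suc i)"]) auto
    have le: "?f k \<le> p k" for k using less.prems(3)[of k] lt by auto
    have "(\<Sum>k | p k \<noteq> 0. p k - ?f k) < (\<Sum>k | p k \<noteq> 0. p k - f k)"
      by (rule sum_strict_mono_ex1[OF fin]) (use lt in \<open>auto intro!: exI[of _ i]\<close>)
    then have "v ?f \<noteq> 0" using less.hyps[OF _ less.prems(1) f' le] by blast
    have box: "ptn (\<lambda>k. if k = 0 then 1 else 0 :: nat)" by (rule ptnI[of _ 1]) auto
    have "v ?f \<le> (\<Sum>p\<in>#M f (\<lambda>k. if k = 0 then 1 else 0). v p)"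
      using M_box[OF less.prems(2) f'] by (auto dest!: multi_member_split)
    with \<open>v ?f \<noteq> 0\<close> have "min (\<Sum>p\<in>#M f (\<lambda>k. if k = 0 then 1 else 0). v p) n \<noteq> 0" using n by linarith
    with v_mult[OF less.prems(2) box] show ?thesis by (metis min_0L mult_0)
  qed (use less.prems in auto)
qed

lemma v_directed:
  assumes "finite X" "\<And>i j. (i, j) \<in> X \<Longrightarrow> \<exists>p. v p \<noteq> 0 \<and> j < p i"
  shows "\<exists>p. v p \<noteq> 0 \<and> (\<forall>(i, j)\<in>X. j < p i)"
  using assms
proof (induction X)
  case empty
  then show ?case using v_zero by (intro exI[of _ "\<lambda>_. 0"]) auto
next
  case (insert z X)
  obtain i j where z: "z = (i, j)" by (cases z)
  obtain p where p: "v p \<noteq> 0" "\<forall>(i, j)\<in>X. j < p i" using insert by blast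
  obtain q where q: "v q \<noteq> 0" "j < q i" using insert.prems[of i j] z by blast
  obtain r where "r \<in># M p q" "v r \<noteq> 0" using v_term p q by blast
  then have "\<And>k. p k \<le> r k \<and> q k \<le> r k" using M_contains p q v_ptn by blast
  then show ?case using p q \<open>v r \<noteq> 0\<close> z by (intro exI[of _ r]) (fastforce intro: less_le_trans)
qed

lemma v_boxes:
  assumes "ptn f" "\<And>i j. j < f i \<Longrightarrow> \<exists>p. v p \<noteq> 0 \<and> j < p i"
  shows "v f \<noteq> 0"
proof -
  have "finite (SIGMA i:{i. f i \<noteq> 0}. {..<f i})"
    using assms(1) by (intro finite_SigmaI) (auto simp: ptn_def)
  then obtain p where p: "v p \<noteq> 0" "\<forall>(i, j)\<in>(SIGMA i:{i. f i \<noteq> 0}. {..<f i}). j < p i"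
    using v_directed[of "SIGMA i:{i. f i \<noteq> 0}. {..<f i}"] assms(2) by auto
  have "f i \<le> p i" for i
  proof (rule leI, rule notI)
    assume "p i < f i"
    then have "(i, p i) \<in> (SIGMA i:{i. f i \<noteq> 0}. {..<f i})" by auto
    then have "p i < p i" using p(2) by blast
    then show False by simp
  qed
  then show ?thesis using v_down p(1) assms(1) by blast
qed

lemma v_power:
  assumes "v f \<noteq> 0" shows "\<exists>p. v p \<noteq> 0 \<and> k * out x y f \<le> out x y p"
proof (induction k)
  case (Suc k)
  then obtain p where p: "v p \<noteq> 0" "k * out x y f \<le> out x y p" by blast
  obtain q where "q \<in># M f p" "v q \<noteq> 0" using v_term assms p by blast
  then show ?case using M_out[of f p q x y] p assms v_ptn by (intro exI[of _ q]) auto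
qed (use v_zero in \<open>auto intro!: exI[of _ "\<lambda>_. 0"]\<close>)

text \<open>If P misses some box, x is the first row and y the first column that stay bounded on P.
  Outside the hook (x, y) all shapes in P stay within I rows and J columns, so
  \<open>out x y\<close> is at most I * J on P; powers of a shape that leaves the hook would violate
  this. Conversely each box of the hook lies in an unbounded row or column, so some shape in P
  contains it.\<close>

lemma v_support:
  "(\<forall>f. v f \<noteq> 0 \<longleftrightarrow> ptn f) \<or> (\<exists>x y. \<forall>f. v f \<noteq> 0 \<longleftrightarrow> ptn f \<and> f x \<le> y)"
proof (cases "\<forall>i j. \<exists>p. v p \<noteq> 0 \<and> j < p i")
  case True
  then show ?thesis using v_boxes v_ptn by blast
next
  case False
  then have ex: "\<exists>i j. \<forall>p. v p \<noteq> 0 \<longrightarrow> p i \<le> j" by (meson leI)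
  define x where "x = (LEAST i. \<exists>j. \<forall>p. v p \<noteq> 0 \<longrightarrow> p i \<le> j)"
  define y where "y = (LEAST j. \<exists>i. \<forall>p. v p \<noteq> 0 \<longrightarrow> p i \<le> j)"
  have "\<exists>j. \<forall>p. v p \<noteq> 0 \<longrightarrow> p x \<le> j" unfolding x_def by (rule LeastI_ex) fact
  then obtain J where J: "\<And>p. v p \<noteq> 0 \<Longrightarrow> p x \<le> J" by blast
  have "\<exists>i. \<forall>p. v p \<noteq> 0 \<longrightarrow> p i \<le> y" unfolding y_def by (rule LeastI_ex) (use ex in blast)
  then obtain I where I: "\<And>p. v p \<noteq> 0 \<Longrightarrow> p I \<le> y" by blast
  have row_inf: "\<exists>p. v p \<noteq> 0 \<and> j < p i" if "i < x" for i j
    using not_less_Least[of i "\<lambda>i. \<exists>j. \<forall>p. v p \<noteq> 0 \<longrightarrow> p i \<le> j"] that unfolding x_def by (meson not_le)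
  have col_inf: "\<exists>p. v p \<noteq> 0 \<and> j < p i" if "j < y" for i j
    using not_less_Least[of j "\<lambda>j. \<exists>i. \<forall>p. v p \<noteq> 0 \<longrightarrow> p i \<le> j"] that unfolding y_def by (meson not_le)
  have bound: "out x y f \<le> I * J" if "v f \<noteq> 0" for f
  proof -
    note f = v_ptn[OF that]
    have "{i. x \<le> i \<and> y < f i} \<subseteq> {..<I}"
    proof (intro subsetI, rule ccontr)
      fix i assume i: "i \<in> {i. x \<le> i \<and> y < f i}" "i \<notin> {..<I}"
      then have "f i \<le> f I" by (intro ptn_antimono[OF f]) auto
      with I[OF that] i show False by auto
    qed
    then have c: "card {i. x \<le> i \<and> y < f i} \<le> I" by (metis card_lessThan card_mono finite_lessThan)
    have "f i - y \<le> J" if "x \<le> i" for i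
      using ptn_antimono[OF f that] J[OF \<open>v f \<noteq> 0\<close>] by simp
    then have "out x y f \<le> card {i. x \<le> i \<and> y < f i} * J"
      unfolding out_def using sum_bounded_above[of "{i. x \<le> i \<and> y < f i}" "\<lambda>i. f i - y" J] by simp
    with c show ?thesis by (meson le_trans mult_le_mono1)
  qed
  have hook: "f x \<le> y" if vf: "v f \<noteq> 0" for f
  proof (rule ccontr)
    assume "\<not> f x \<le> y"
    then have "0 < out x y f" using out_pos_iff[OF v_ptn[OF vf]] by simp
    then have "Suc (I * J) \<le> Suc (I * J) * out x y f" by (cases "out x y f") simp_all
    moreover obtain p where p: "v p \<noteq> 0" "Suc (I * J) * out x y f \<le> out x y p" using v_power[OF vf] by blast
    ultimately show False using bound[OF p(1)] by linarith
  qed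
  have "v f \<noteq> 0" if f: "ptn f" "f x \<le> y" for f
  proof (rule v_boxes[OF f(1)])
    fix i j assume j: "j < f i"
    show "\<exists>p. v p \<noteq> 0 \<and> j < p i"
    proof (cases "i < x")
      case False
      then have "j < y" using j f(2) ptn_antimono[OF f(1), of x i] by simp
      then show ?thesis by (rule col_inf)
    qed (rule row_inf)
  qed
  then show ?thesis using hook v_ptn by blast
qed

text \<open>Two nonzero terms make the square of v f at least n, and 1 * 1 < 2 excludes the value 1
  for n = 2. For n = 3 the value 2 would pass this test.\<close>

lemma v_square:
  assumes "ptn f" "n \<le> 2" "2 \<le> size {#p \<in># M f f. v p \<noteq> 0#}"
  shows "v f = n"
proof -
  have "size {#p \<in># N. v p \<noteq> 0#} \<le> (\<Sum>p\<in>#N. v p)" for N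
    by (induction N) auto
  with assms(3) have "2 \<le> (\<Sum>p\<in>#M f f. v p)" using le_trans by blast
  with v_mult[OF assms(1,1)] assms(2) have "n \<le> v f * v f" by simp
  moreover have "v f \<le> n" by (rule v_le)
  moreover have "v f = 0 \<or> v f = 1 \<or> v f = 2" using \<open>v f \<le> n\<close> assms(2) by auto
  ultimately show ?thesis using n assms(2) by auto
qed

text \<open>Off the family \<open>R x y\<close> all values on the hook are n by
  \<open>v_square\<close>. On the family they are 1 or n, and S records where they are 1: the value
  1 at a and c gives truncated total 1 to the terms of the product, among them
  \<open>R x y (a + c)\<close>. So v is determined by x, y and S.\<close>

lemma v_classification:
  assumes "n \<le> 2"
  shows "v = (\<lambda>f. if ptn f then if f = (\<lambda>_. 0) then 1 else n else 0) \<or>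
    (\<exists>x y S. (\<forall>a\<in>S. \<forall>c\<in>S. a + c \<in> S) \<and>
      v = (\<lambda>f. if ptn f \<and> f x \<le> y then if f \<in> R x y ` S then 1 else n else 0))"
  using v_support
proof
  assume P: "\<forall>f. v f \<noteq> 0 \<longleftrightarrow> ptn f"
  have "v f = n" if f: "ptn f" "f \<noteq> (\<lambda>_. 0)" for f
  proof (rule v_square[OF f(1) assms])
    have "{#p \<in># M f f. v p \<noteq> 0#} = M f f"
      using P M_ptn[OF f(1,1)] by (simp add: filter_mset_eq_conv)
    then show "2 \<le> size {#p \<in># M f f. v p \<noteq> 0#}" using M_square[OF f] by simp
  qed
  then show ?thesis using P v_zero by (intro disjI1 ext) auto
next
  assume "\<exists>x y. \<forall>f. v f \<noteq> 0 \<longleftrightarrow> ptn f \<and> f x \<le> y"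
  then obtain x y where P: "\<And>f. v f \<noteq> 0 \<longleftrightarrow> ptn f \<and> f x \<le> y" by blast
  define S where "S = {a. v (R x y a) = 1}"
  have nz: "v (R x y a) \<noteq> 0" for a using P R_ptn R_hook by blast
  have "a + c \<in> S" if "a \<in> S" "c \<in> S" for a c
  proof -
    have "min 1 n = min (\<Sum>p\<in>#M (R x y a) (R x y c). v p) n"
      using v_mult[OF R_ptn R_ptn, of x y a x y c] that by (simp add: S_def)
    moreover have "v (R x y (a + c)) \<le> (\<Sum>p\<in>#M (R x y a) (R x y c). v p)"
      using R_add[of x y a c] by (auto dest!: multi_member_split)
    ultimately show ?thesis using nz[of "a + c"] v_le[of "R x y (a + c)"] n unfolding S_def
      by (auto simp: min_def split: if_splits)
  qed
  moreover have "v f = n" if f: "ptn f" "f x \<le> y" "f \<notin> R x y ` S" for f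
  proof (cases "f \<in> range (R x y)")
    case True
    then have "v f \<noteq> 1" using f(3) by (auto simp: S_def)
    then show ?thesis using P[of f] f v_le[of f] assms by auto
  next
    case False
    show ?thesis
    proof (rule v_square[OF f(1) assms])
      have "{#p \<in># M f f. p x \<le> y#} = {#p \<in># M f f. v p \<noteq> 0#}"
        using M_ptn[OF f(1,1)] P by (intro filter_mset_cong) auto
      then show "2 \<le> size {#p \<in># M f f. v p \<noteq> 0#}" using M_square_hook[OF f(1,2) False] by simp
    qed
  qed
  moreover have "v f = 1" if "f \<in> R x y ` S" for f using that by (auto simp: S_def)
  moreover have "v f = 0 \<longleftrightarrow> \<not> (ptn f \<and> f x \<le> y)" for f using P[of f] by blast
  ultimately show ?thesis using R_ptn R_hook
    by (intro disjI2, rule_tac exI[of _ x], rule_tac exI[of _ y], rule_tac exI[of _ S]) auto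
qed

end

lemma countable_vals:
  assumes "n \<le> 2" shows "countable (vals n)"
proof (cases "n = 0")
  case True
  then have "vals n \<subseteq> {\<lambda>_. 0}" by (auto simp: vals_def)
  then show ?thesis using countable_subset by blast
next
  case False
  let ?C = "{S :: nat set. \<forall>a\<in>S. \<forall>c\<in>S. a + c \<in> S}"
  let ?F = "\<lambda>(x, y, S). \<lambda>f. if ptn f \<and> f x \<le> y then if f \<in> R x y ` S then 1 else n else 0"
  let ?G = "\<lambda>f. if ptn f then if f = (\<lambda>_. 0) then 1 else n else 0"
  have "vals n \<subseteq> insert ?G (?F ` (UNIV \<times> UNIV \<times> ?C))"
  proof
    fix v assume "v \<in> vals n"
    from v_classification[OF this _ assms] False consider "v = ?G"
      | x y S where "S \<in> ?C" "v = ?F (x, y, S)" by auto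
    then show "v \<in> insert ?G (?F ` (UNIV \<times> UNIV \<times> ?C))"
    proof cases
      case 2
      then show ?thesis by (intro insertI2, rule_tac image_eqI[of _ _ "(x, y, S)"]) simp_all
    qed (simp only: insertI1)
  qed
  moreover have "countable (insert ?G (?F ` (UNIV \<times> UNIV \<times> ?C)))"
    using countable_additively_closed by (intro countable_insert countable_image countable_SIGMA) auto
  ultimately show ?thesis using countable_subset by blast
qed

lemma countable_Hom:
  assumes "n \<le> 2" shows "countable (semiring_Hom span (trunc_nat n))"
proof (rule countable_image_inj_on[OF _ val_inj])
  show "countable (val ` semiring_Hom span (trunc_nat n))"
    using val_in_vals countable_vals[OF assms] by (meson countable_subset image_subsetI)
qed

end

section \<open>Coefficients of squarefree monomials\<close>

abbreviation sqf_coeff :: "nat \<Rightarrow> pseries \<Rightarrow> int" where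
  "sqf_coeff k f \<equiv> pcoeff f (sqf {..<k})"

text \<open>The last condition is symmetry on squarefree monomials; it turns the sum over subsets in
  a product into binomial coefficients. The others make \<open>seq_sum\<close> a finite sum of
  natural numbers without loss.\<close>

definition flat :: "pseries \<Rightarrow> bool" where
  "flat f \<longleftrightarrow> (\<forall>\<alpha>. 0 \<le> pcoeff f \<alpha>) \<and> (\<exists>K. \<forall>k\<ge>K. sqf_coeff k f = 0) \<and>
     (\<forall>S. finite S \<longrightarrow> pcoeff f (sqf S) = sqf_coeff (card S) f)"

lemma flat_nonneg: "flat f \<Longrightarrow> 0 \<le> pcoeff f \<alpha>"
  and flat_bound: "flat f \<Longrightarrow> \<exists>K. \<forall>k\<ge>K. sqf_coeff k f = 0"
  and flat_sqf: "flat f \<Longrightarrow> finite S \<Longrightarrow> pcoeff f (sqf S) = sqf_coeff (card S) f"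
  unfolding flat_def by blast+

lemma total_degree_sqf: "finite S \<Longrightarrow> total_degree (sqf S) = card S"
  by (subst total_degree_superset[of S]) (auto simp: in_keys_iff lookup_sqf split: if_splits)

lemma flat_zero: "flat 0"
  by (simp add: flat_def zero_pseries.rep_eq)

lemma flat_add: "flat f \<Longrightarrow> flat g \<Longrightarrow> flat (f + g)"
proof -
  assume fg: "flat f" "flat g"
  then obtain K L where "\<forall>k\<ge>K. sqf_coeff k f = 0" "\<forall>k\<ge>L. sqf_coeff k g = 0" using flat_bound by metis
  then have "\<forall>k\<ge>max K L. sqf_coeff k (f + g) = 0" by (simp add: plus_pseries.rep_eq)
  moreover have "pcoeff (f + g) (sqf S) = sqf_coeff (card S) (f + g)" if "finite S" for S
    using flat_sqf[OF fg(1) that] flat_sqf[OF fg(2) that] by (simp only: plus_pseries.rep_eq)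
  moreover have "0 \<le> pcoeff (f + g) \<alpha>" for \<alpha>
    using fg by (simp add: plus_pseries.rep_eq flat_nonneg)
  ultimately show ?thesis unfolding flat_def by blast
qed

lemma sqf_splittings:
  assumes "finite U"
  shows "bij_betw (\<lambda>S. (sqf S, sqf (U - S))) (Pow U) {(\<beta>, \<gamma>). \<beta> + \<gamma> = sqf U}"
proof (rule bij_betw_byWitness[where f' = "\<lambda>(\<beta>, \<gamma>). Poly_Mapping.keys \<beta>"])
  have fin: "finite S" if "S \<in> Pow U" for S using that assms finite_subset by blast
  have keys: "Poly_Mapping.keys (sqf S) = S" if "finite S" for S
    using that by (auto simp: in_keys_iff lookup_sqf split: if_splits)
  show "\<forall>S\<in>Pow U. (\<lambda>(\<beta>, \<gamma>). Poly_Mapping.keys \<beta>) (sqf S, sqf (U - S)) = S"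
    using fin keys by simp
  show "(\<lambda>S. (sqf S, sqf (U - S))) ` Pow U \<subseteq> {(\<beta>, \<gamma>). \<beta> + \<gamma> = sqf U}"
    using fin assms by (auto intro!: poly_mapping_eqI simp: lookup_add lookup_sqf)
  have lk: "Poly_Mapping.lookup \<beta> i + Poly_Mapping.lookup \<gamma> i = (if i \<in> U then 1 else 0)"
    if "\<beta> + \<gamma> = sqf U" for \<beta> \<gamma> i
    using arg_cong[OF that, of "\<lambda>x. Poly_Mapping.lookup x i"] assms by (simp add: lookup_add lookup_sqf)
  show "(\<lambda>(\<beta>, \<gamma>). Poly_Mapping.keys \<beta>) ` {(\<beta>, \<gamma>). \<beta> + \<gamma> = sqf U} \<subseteq> Pow U"
  proof clarsimp
    fix \<beta> \<gamma> i assume "\<beta> + \<gamma> = sqf U" "i \<in> Poly_Mapping.keys \<beta>"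
    with lk[of \<beta> \<gamma> i] show "i \<in> U" by (auto simp: in_keys_iff split: if_splits)
  qed
  show "\<forall>z\<in>{(\<beta>, \<gamma>). \<beta> + \<gamma> = sqf U}.
    (\<lambda>S. (sqf S, sqf (U - S))) ((\<lambda>(\<beta>, \<gamma>). Poly_Mapping.keys \<beta>) z) = z"
  proof clarsimp
    fix \<beta> \<gamma> :: monom assume e: "\<beta> + \<gamma> = sqf U"
    have "Poly_Mapping.lookup (sqf (Poly_Mapping.keys \<beta>)) i = Poly_Mapping.lookup \<beta> i"
      "Poly_Mapping.lookup (sqf (U - Poly_Mapping.keys \<beta>)) i = Poly_Mapping.lookup \<gamma> i" for i
      using lk[OF e, of i] assms by (auto simp: lookup_sqf in_keys_iff split: if_splits)
    then show "sqf (Poly_Mapping.keys \<beta>) = \<beta> \<and> sqf (U - Poly_Mapping.keys \<beta>) = \<gamma>"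
      by (auto intro: poly_mapping_eqI)
  qed
qed

text \<open>A factorisation of a squarefree monomial distributes its variables among the factors.
  Equivalently, f \<mapsto> (\<Sum>k. c k f * t^k / k!) is multiplicative: this is the exponential
  specialization of symmetric functions.\<close>

lemma sqf_coeff_mult:
  assumes "flat f" "flat g"
  shows "sqf_coeff k (f * g) = (\<Sum>i\<le>k. of_nat (k choose i) * (sqf_coeff i f * sqf_coeff (k - i) g))"
proof -
  have fin: "finite S" if "S \<subseteq> {..<k}" for S using that finite_subset by blast
  have "sqf_coeff k (f * g) = (\<Sum>S\<in>Pow {..<k}. pcoeff f (sqf S) * pcoeff g (sqf ({..<k} - S)))"
    unfolding times_pseries.rep_eq using sum.reindex_bij_betw[OF sqf_splittings[of "{..<k}"]]
    by (simp flip: sum.reindex_bij_betw[OF sqf_splittings[of "{..<k}"]])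
  also have "\<dots> = (\<Sum>S\<in>Pow {..<k}. sqf_coeff (card S) f * sqf_coeff (k - card S) g)"
  proof (rule sum.cong[OF refl])
    fix S assume "S \<in> Pow {..<k}"
    then have S: "finite S" "card ({..<k} - S) = k - card S" using fin by (auto simp: card_Diff_subset)
    show "pcoeff f (sqf S) * pcoeff g (sqf ({..<k} - S)) = sqf_coeff (card S) f * sqf_coeff (k - card S) g"
      using flat_sqf[OF assms(1) S(1)] flat_sqf[OF assms(2), of "{..<k} - S"] S(2) by simp
  qed
  also have "\<dots> = (\<Sum>i\<le>k. \<Sum>S\<in>{S \<in> Pow {..<k}. card S = i}. sqf_coeff (card S) f * sqf_coeff (k - card S) g)"
    by (rule sum.group[symmetric]) (auto intro: card_mono[of "{..<k}", simplified])
  also have "\<dots> = (\<Sum>i\<le>k. of_nat (k choose i) * (sqf_coeff i f * sqf_coeff (k - i) g))"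
    by (intro sum.cong) (auto simp: n_subsets[of "{..<k}", simplified])
  finally show ?thesis .
qed

section \<open>Homomorphisms from divided power sequences\<close>

text \<open>The value at k is the image of the divided power t^k / k!. Products are respected if u i
  * u j = (i + j choose i) * u (i + j); for n \<ge> 3 truncation makes this true for every X, which
  is the free parameter.\<close>

definition trunc_seq :: "nat \<Rightarrow> nat set \<Rightarrow> nat \<Rightarrow> nat" where
  "trunc_seq n X k = (if k = 0 then 1 else if k \<in> X then n - 1 else n)"

definition seq_sum :: "(nat \<Rightarrow> nat) \<Rightarrow> pseries \<Rightarrow> nat" where
  "seq_sum u f = (\<Sum>k | sqf_coeff k f \<noteq> 0. nat (sqf_coeff k f) * u k)"

lemma seq_sum_eq:
  assumes "\<And>k. K \<le> k \<Longrightarrow> sqf_coeff k f = 0"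
  shows "seq_sum u f = (\<Sum>k<K. nat (sqf_coeff k f) * u k)"
  unfolding seq_sum_def
  by (rule sum.mono_neutral_left) (use assms in \<open>auto intro: ccontr\<close>)

lemma seq_sum_add:
  assumes "flat f" "flat g"
  shows "seq_sum u (f + g) = seq_sum u f + seq_sum u g"
proof -
  obtain K L where K: "\<forall>k\<ge>K. sqf_coeff k f = 0" and L: "\<forall>k\<ge>L. sqf_coeff k g = 0"
    using flat_bound[OF assms(1)] flat_bound[OF assms(2)] by blast
  have nn: "0 \<le> sqf_coeff k f" "0 \<le> sqf_coeff k g" for k using assms flat_nonneg by blast+
  show ?thesis
    using K L by (simp add: seq_sum_eq[of "max K L"] plus_pseries.rep_eq nat_add_distrib nn
        sum.distrib distrib_right)
qed

text \<open>For positive i and j both sides are at least 2 * (n - 1) \<ge> n: on the left because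
  the binomial coefficient is at least 2, on the right because n - 1 \<ge> 2. For n = 2 the right
  side can be 1 * 1.\<close>

lemma trunc_seq_mult:
  assumes "3 \<le> n"
  shows "min ((i + j choose i) * trunc_seq n X (i + j)) n = min (trunc_seq n X i * trunc_seq n X j) n"
proof (cases "i = 0 \<or> j = 0")
  case False
  have u: "n - 1 \<le> trunc_seq n X k" if "k > 0" for k using that by (auto simp: trunc_seq_def)
  have "i + j choose i \<ge> 2"
  proof -
    obtain m where m: "i = Suc m" using False by (cases i) auto
    have "i + j choose i = (m + j choose m) + (m + j choose Suc m)" by (simp add: m)
    moreover have "0 < (m + j choose m)" "0 < (m + j choose Suc m)"
      using False by (auto intro!: zero_less_binomial)
    ultimately show ?thesis by linarith
  qed
  then have "2 * (n - 1) \<le> (i + j choose i) * trunc_seq n X (i + j)"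
    using u[of "i + j"] False by (intro mult_le_mono) auto
  moreover have "2 * (n - 1) \<le> trunc_seq n X i * trunc_seq n X j"
    using u[of i] u[of j] False assms by (intro mult_le_mono) auto
  ultimately show ?thesis using assms by simp
qed (auto simp: trunc_seq_def)

lemma cls_sum_cong: "(\<And>x. x \<in> A \<Longrightarrow> cls n (f x) = cls n (g x)) \<Longrightarrow> cls n (sum f A) = cls n (sum g A)"
  by (induction A rule: infinite_finite_induct) (simp_all flip: trunc_nat_add)

lemma cls_mult_cong: "cls n a = cls n c \<Longrightarrow> cls n (d * a) = cls n (d * c)"
  by (simp flip: trunc_nat_mult)

text \<open>Both sides expand over pairs (i, j) with the same multiplicity
  \<open>?a i * ?c j\<close>. The remaining factors differ in \<nat> but are congruent by
  \<open>trunc_seq_mult\<close>, so the classes agree term by term.\<close>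

lemma seq_sum_mult:
  assumes fg: "flat f" "flat g" and n: "3 \<le> n"
  shows "cls n (seq_sum (trunc_seq n X) (f * g)) = cls n (seq_sum (trunc_seq n X) f * seq_sum (trunc_seq n X) g)"
proof -
  let ?u = "trunc_seq n X"
  obtain K0 L0 where "\<forall>k\<ge>K0. sqf_coeff k f = 0" "\<forall>k\<ge>L0. sqf_coeff k g = 0"
    using flat_bound[OF fg(1)] flat_bound[OF fg(2)] by blast
  then obtain K where Kf: "\<And>k. K \<le> k \<Longrightarrow> sqf_coeff k f = 0" and Kg: "\<And>k. K \<le> k \<Longrightarrow> sqf_coeff k g = 0"
    by (metis max.bounded_iff)
  have nn: "0 \<le> sqf_coeff k f" "0 \<le> sqf_coeff k g" for k using fg flat_nonneg by blast+
  let ?a = "\<lambda>k. nat (sqf_coeff k f)" and ?c = "\<lambda>k. nat (sqf_coeff k g)"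
  have nat_mult: "nat (sqf_coeff k (f * g)) = (\<Sum>i\<le>k. (k choose i) * (?a i * ?c (k - i)))" for k
  proof -
    have "sqf_coeff k (f * g) = int (\<Sum>i\<le>k. (k choose i) * (?a i * ?c (k - i)))"
      by (simp add: sqf_coeff_mult[OF fg] nn)
    then show ?thesis by (metis nat_int)
  qed
  have zero: "?a i * ?c j = 0" if "\<not> (i < K \<and> j < K)" for i j
    using that Kf[of i] Kg[of j] by (auto simp: not_less)
  have z2: "sqf_coeff k (f * g) = 0" if "2 * K \<le> k" for k
  proof -
    have "(k choose i) * (?a i * ?c (k - i)) = 0" if "i \<le> k" for i
      using zero[of i "k - i"] that \<open>2 * K \<le> k\<close> by fastforce
    then have "nat (sqf_coeff k (f * g)) = 0" unfolding nat_mult by (intro sum.neutral) simp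
    moreover have "0 \<le> sqf_coeff k (f * g)" unfolding sqf_coeff_mult[OF fg]
      by (intro sum_nonneg mult_nonneg_nonneg nn) auto
    ultimately show ?thesis by simp
  qed
  have "seq_sum ?u (f * g) = (\<Sum>k<2 * K. \<Sum>i\<le>k. (k choose i) * (?a i * ?c (k - i)) * ?u k)"
    using z2 by (subst seq_sum_eq[of "2 * K"]) (auto simp: nat_mult sum_distrib_right)
  also have "\<dots> = (\<Sum>k<2 * K. \<Sum>i\<le>k. (i + (k - i) choose i) * (?a i * ?c (k - i)) * ?u (i + (k - i)))"
    by (intro sum.cong) auto
  also have "\<dots> = (\<Sum>(i, j)\<in>{(i, j). i + j < 2 * K}. (i + j choose i) * (?a i * ?c j) * ?u (i + j))"
    by (rule sum.triangle_reindex[symmetric])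
  also have "\<dots> = (\<Sum>(i, j)\<in>{..<K} \<times> {..<K}. (i + j choose i) * (?a i * ?c j) * ?u (i + j))"
  proof (rule sum.mono_neutral_right)
    show "finite {(i, j). i + j < 2 * K}"
      by (rule finite_subset[of _ "{..<2 * K} \<times> {..<2 * K}"]) auto
    show "\<forall>x\<in>{(i, j). i + j < 2 * K} - {..<K} \<times> {..<K}.
      (case x of (i, j) \<Rightarrow> (i + j choose i) * (?a i * ?c j) * ?u (i + j)) = 0"
    proof
      fix z assume z: "z \<in> {(i, j). i + j < 2 * K} - {..<K} \<times> {..<K}"
      obtain i j where ij: "z = (i, j)" by (cases z)
      have "?a i * ?c j = 0" by (rule zero) (use z ij in auto)
      then show "(case z of (i, j) \<Rightarrow> (i + j choose i) * (?a i * ?c j) * ?u (i + j)) = 0"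
        unfolding ij by simp
    qed
  qed auto
  finally have 1: "seq_sum ?u (f * g) =
    (\<Sum>(i, j)\<in>{..<K} \<times> {..<K}. (?a i * ?c j) * ((i + j choose i) * ?u (i + j)))"
    by (simp add: mult_ac)
  have "seq_sum ?u f * seq_sum ?u g = (\<Sum>(i, j)\<in>{..<K} \<times> {..<K}. (?a i * ?u i) * (?c j * ?u j))"
    using Kf Kg by (simp add: seq_sum_eq[of K] sum_product sum.cartesian_product)
  then have 2: "seq_sum ?u f * seq_sum ?u g = (\<Sum>(i, j)\<in>{..<K} \<times> {..<K}. (?a i * ?c j) * (?u i * ?u j))"
    by (simp add: mult_ac)
  show ?thesis unfolding 1 2
  proof (rule cls_sum_cong)
    fix z assume "z \<in> {..<K} \<times> {..<K}"
    obtain i j where z: "z = (i, j)" by (cases z)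
    show "cls n (case z of (i, j) \<Rightarrow> (?a i * ?c j) * ((i + j choose i) * ?u (i + j))) =
      cls n (case z of (i, j) \<Rightarrow> (?a i * ?c j) * (?u i * ?u j))"
      unfolding z prod.case by (rule cls_mult_cong) (simp only: cls_eq_iff trunc_seq_mult[OF n])
  qed
qed

context product_basis
begin

lemma span_flat: "X \<in> nat_span b \<Longrightarrow> flat X"
proof -
  have b: "flat (b (lst p))" if p: "ptn p" for p
  proof -
    obtain d where d: "\<And>\<alpha>. pcoeff (b (lst p)) \<alpha> \<noteq> 0 \<Longrightarrow> total_degree \<alpha> \<le> d"
      using b_bounded[OF p] by (auto simp: bounded_degree_def)
    have "sqf_coeff k (b (lst p)) = 0" if "k \<ge> Suc d" for k
      using d[of "sqf {..<k}"] that total_degree_sqf[of "{..<k}"] by fastforce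
    then show ?thesis using b_nonneg[OF p] b_sqf[OF p] unfolding flat_def by blast
  qed
  have "\<forall>p\<in>#N. ptn p \<Longrightarrow> flat (\<Sum>p\<in>#N. b (lst p))" for N
    by (induction N) (simp_all add: flat_zero flat_add b)
  then show "X \<in> nat_span b \<Longrightarrow> flat X" unfolding span_mset by blast
qed

definition seq_hom :: "nat \<Rightarrow> nat set \<Rightarrow> pseries \<Rightarrow> nat set" where
  "seq_hom n X = restrict (\<lambda>f. cls n (seq_sum (trunc_seq n X) f)) (nat_span b)"

lemma seq_hom_in_Hom:
  assumes "3 \<le> n" shows "seq_hom n X \<in> semiring_Hom span (trunc_nat n)"
proof -
  have z: "0 \<in> nat_span b" using span_sum[of "{#}"] by simp
  have o: "1 \<in> nat_span b" using span_b[OF ptn_zero] by (simp add: lst_zero b_Nil)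
  have a: "f + g \<in> nat_span b" if fg: "f \<in> nat_span b" "g \<in> nat_span b" for f g
  proof -
    obtain N L where "\<forall>p\<in>#N. ptn p" "f = (\<Sum>p\<in>#N. b (lst p))" "\<forall>p\<in>#L. ptn p" "g = (\<Sum>p\<in>#L. b (lst p))"
      using fg unfolding span_mset by blast
    then show ?thesis using span_sum[of "N + L"] by auto
  qed
  have "sqf_coeff k 1 = (if k = 0 then 1 else 0)" for k
  proof -
    have "sqf {..<k} = 0 \<longleftrightarrow> k = 0"
      using total_degree_sqf[of "{..<k}"] by (auto simp: total_degree_def intro!: poly_mapping_eqI simp: lookup_sqf)
    then show ?thesis by (simp add: one_pseries.rep_eq)
  qed
  then have "seq_sum (trunc_seq n X) 1 = 1" unfolding seq_sum_def by (simp add: trunc_seq_def)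
  moreover have "seq_sum (trunc_seq n X) 0 = 0" by (simp add: seq_sum_def zero_pseries.rep_eq)
  ultimately show ?thesis
    unfolding semiring_Hom_def ring_hom_def seq_hom_def
    using z o a span_mult span_flat assms
    by (auto simp: Lambda_Z_def trunc_carrier_iff trunc_zero trunc_one seq_sum_add trunc_nat_add
        trunc_nat_mult seq_sum_mult)
qed

text \<open>A column of length k stands for the elementary symmetric function of degree k, whose
  only nonzero \<open>sqf_coeff\<close> is the k-th. The whole sequence can thus be recovered from
  the homomorphism.\<close>

lemma seq_hom_column: "seq_hom n X (b (replicate k 1)) = cls n (trunc_seq n X k)"
proof -
  have p: "ptn (\<lambda>i. if i < k then 1 else 0)" by (rule ptnI[of _ k]) auto
  have "{i. (if i < k then 1 else 0 :: nat) \<noteq> 0} = {..<k}" by auto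
  then have "lst (\<lambda>i. if i < k then 1 else 0) = map (\<lambda>i. if i < k then 1 else 0) [0..<k]"
    by (simp only: lst_def card_lessThan)
  also have "\<dots> = replicate k 1" by (rule nth_equalityI) simp_all
  finally have "lst (\<lambda>i. if i < k then 1 else 0) = replicate k 1" .
  then have "b (replicate k 1) \<in> nat_span b" using span_b[OF p] by simp
  moreover have "seq_sum (trunc_seq n X) (b (replicate k 1)) = trunc_seq n X k"
    unfolding seq_sum_def b_column by simp
  ultimately show ?thesis by (simp add: seq_hom_def)
qed

lemma uncountable_Hom:
  assumes n: "3 \<le> n" shows "uncountable (semiring_Hom span (trunc_nat n))"
proof
  assume "countable (semiring_Hom span (trunc_nat n))"
  then have "countable (range (seq_hom n))"
    by (rule countable_subset[rotated]) (use seq_hom_in_Hom[OF n] in auto)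
  \<comment> \<open>The value at 0 is always 1, so sets are coded at positive indices, by the shift
    \<open>Suc\<close>. The classes of n - 1 and n differ.\<close>
  define dec where "dec h = {k. h (b (replicate (Suc k) 1)) = cls n (n - 1)}" for h :: "pseries \<Rightarrow> nat set"
  have "dec (seq_hom n (Suc ` X)) = X" for X
    using n unfolding dec_def seq_hom_column cls_eq_iff by (auto simp: trunc_seq_def)
  then have "dec ` range (seq_hom n) = UNIV" by (metis (no_types, lifting) UNIV_eq_I rangeI image_eqI)
  with \<open>countable (range (seq_hom n))\<close> have "countable (UNIV :: nat set set)"
    by (metis countable_image)
  then obtain f :: "nat set \<Rightarrow> nat" where "inj f" by (auto simp: countable_def)
  then show False using Cantors_theorem[of "UNIV :: nat set"]
    by (metis Pow_UNIV inj_imp_surj_inv)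
qed

lemma countable_Hom_iff: "countable (semiring_Hom span (trunc_nat n)) \<longleftrightarrow> n \<le> 2"
  using countable_Hom[of n] uncountable_Hom[of n] by linarith

end

section \<open>Monomial symmetric functions\<close>

abbreviation mono_mset :: "monom \<Rightarrow> nat multiset" where
  "mono_mset \<alpha> \<equiv> image_mset (Poly_Mapping.lookup \<alpha>) (mset_set (Poly_Mapping.keys \<alpha>))"

definition expvec :: "(nat \<Rightarrow> nat) \<Rightarrow> monom" where
  "expvec f = Abs_poly_mapping f"

lemma lookup_expvec: "finite {i. f i \<noteq> 0} \<Longrightarrow> Poly_Mapping.lookup (expvec f) = f"
  unfolding expvec_def by (rule lookup_Abs_poly_mapping)

lemma lookup_expvec_ptn: "ptn f \<Longrightarrow> Poly_Mapping.lookup (expvec f) = f"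
  by (rule lookup_expvec) (simp add: ptn_def)

lemma finite_zero_outside:
  fixes f :: "nat \<Rightarrow> nat"
  assumes "\<And>i. N \<le> i \<Longrightarrow> f i = 0" shows "finite {i. f i \<noteq> 0}"
proof (rule finite_subset)
  show "{i. f i \<noteq> 0} \<subseteq> {..<N}" using assms by (auto intro: ccontr)
qed simp

lemma mset_map_upt: "mset (map g [0..<N]) = image_mset g (mset_set {..<N})"
  by (simp add: mset_map atLeast0LessThan)

lemma nonzero_mset:
  fixes g :: "nat \<Rightarrow> nat"
  assumes "\<And>i. N \<le> i \<Longrightarrow> g i = (0::nat)"
  shows "image_mset g (mset_set {i. g i \<noteq> 0}) = filter_mset (\<lambda>x. x \<noteq> 0) (mset (map g [0..<N]))"
proof -
  have "{i. g i \<noteq> 0} = {i \<in> {..<N}. g i \<noteq> 0}" using assms by (auto intro: ccontr)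
  then show ?thesis
    by (simp only: mset_map_upt filter_mset_image_mset filter_mset_mset_set[OF finite_lessThan])
qed

lemma mset_eq_by_nonzero:
  fixes A B :: "nat multiset"
  assumes "filter_mset (\<lambda>x. x \<noteq> 0) A = filter_mset (\<lambda>x. x \<noteq> 0) B" "size A = size B"
  shows "A = B"
proof (rule multiset_eqI)
  have c: "size D = count D 0 + size (filter_mset (\<lambda>x. x \<noteq> 0) D)" for D :: "nat multiset"
    by (induction D) auto
  have z: "count A 0 = count B 0" using c[of A] c[of B] assms by simp
  fix x show "count A x = count B x"
  proof (cases "x = 0")
    case False
    then show ?thesis using arg_cong[OF assms(1), of "\<lambda>D. count D x"] by simp
  qed (simp add: z)
qed

text \<open>Padded with zeros to the common length N, families with equal nonzero parts also have
  equally many zeros, hence are equal as multisets of N values.\<close>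

lemma mset_eq_iff_permutation:
  fixes f g :: "nat \<Rightarrow> nat"
  assumes "\<And>i. N \<le> i \<Longrightarrow> g i = (0::nat)" "\<And>i. N \<le> i \<Longrightarrow> f i = (0::nat)"
  shows "image_mset g (mset_set {i. g i \<noteq> 0}) = image_mset f (mset_set {i. f i \<noteq> 0}) \<longleftrightarrow>
    (\<exists>w. w permutes {..<N} \<and> g = f \<circ> w)" (is "?L \<longleftrightarrow> ?R")
proof
  assume ?L
  then have "filter_mset (\<lambda>x. x \<noteq> 0) (mset (map g [0..<N])) = filter_mset (\<lambda>x. x \<noteq> 0) (mset (map f [0..<N]))"
    by (simp only: nonzero_mset[of N, OF assms(1)] nonzero_mset[of N, OF assms(2)])
  then have "mset (map g [0..<N]) = mset (map f [0..<N])"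
    by (rule mset_eq_by_nonzero) (simp only: size_mset length_map)
  then obtain w where w: "w permutes {..<length (map f [0..<N])}"
    "permute_list w (map f [0..<N]) = map g [0..<N]" by (rule mset_eq_permutation)
  have "g i = f (w i)" for i
  proof (cases "i < N")
    case True
    then have "w i < N" using permutes_in_image[OF w(1), of i] by simp
    with True show ?thesis using permute_list_nth[OF w(1), of i] unfolding w(2) by simp
  next
    case False
    then show ?thesis using assms permutes_not_in[OF w(1), of i] by simp
  qed
  then show ?R using w(1) by (intro exI[of _ w]) auto
next
  assume ?R
  then obtain w where w: "w permutes {..<N}" "g = f \<circ> w" by blast
  have "map g [0..<N] = permute_list w (map f [0..<N])"
  proof (rule nth_equalityI)
    fix i assume i: "i < length (map g [0..<N])"
    then have "w i < N" using permutes_in_image[OF w(1), of i] by simp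
    then show "map g [0..<N] ! i = permute_list w (map f [0..<N]) ! i"
      using i w by (simp add: permute_list_nth)
  qed simp
  then have "mset (map g [0..<N]) = mset (map f [0..<N])"
    using w(1) by (simp only: mset_permute_list length_map length_upt diff_zero)
  then show ?L by (simp only: nonzero_mset[of N, OF assms(1)] nonzero_mset[of N, OF assms(2)])
qed

lemma mono_mset_eq: "mono_mset \<alpha> = image_mset (Poly_Mapping.lookup \<alpha>) (mset_set {i. Poly_Mapping.lookup \<alpha> i \<noteq> 0})"
  by (simp add: keys.rep_eq)

lemma mset_lst: "ptn f \<Longrightarrow> mset (lst f) = image_mset f (mset_set {i. f i \<noteq> 0})"
proof -
  assume f: "ptn f"
  then have "{i. f i \<noteq> 0} = {..<card {i. f i \<noteq> 0}}" using ptn_nz_iff by blast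
  then show ?thesis unfolding lst_def mset_map_upt by simp
qed

lemma lookup_eventually_zero: "\<exists>N. \<forall>i\<ge>N. Poly_Mapping.lookup (\<alpha> :: monom) i = 0"
proof -
  have "i \<le> Max (Poly_Mapping.keys \<alpha>)" if "Poly_Mapping.lookup \<alpha> i \<noteq> 0" for i
    using that by (intro Max_ge) (auto simp: in_keys_iff)
  then show ?thesis by (metis not_less_eq_eq)
qed

definition of_shape :: "(nat \<Rightarrow> nat) \<Rightarrow> monom \<Rightarrow> bool" where
  "of_shape f \<alpha> \<longleftrightarrow> mono_mset \<alpha> = mset (lst f)"

lemma of_shape_iff:
  assumes "ptn f" "\<And>i. N \<le> i \<Longrightarrow> f i = 0" "\<And>i. N \<le> i \<Longrightarrow> Poly_Mapping.lookup \<alpha> i = 0"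
  shows "of_shape f \<alpha> \<longleftrightarrow> (\<exists>w. w permutes {..<N} \<and> Poly_Mapping.lookup \<alpha> = f \<circ> w)"
  unfolding of_shape_def mono_mset_eq mset_lst[OF assms(1)]
  by (rule mset_eq_iff_permutation) (use assms in auto)

lemma of_shape_ex: "\<exists>p. ptn p \<and> of_shape p \<alpha>"
proof -
  define L where "L = rev (sorted_list_of_multiset (mono_mset \<alpha>))"
  have "sorted_wrt (\<ge>) L" unfolding L_def sorted_wrt_rev by simp
  moreover have "0 \<notin> set L" by (auto simp: L_def in_keys_iff)
  ultimately have "L \<in> partitions" by (simp add: partitions_def)
  then have "ptn (row L)" "of_shape (row L) \<alpha>"
    by (simp_all add: row_ptn of_shape_def lst_row) (simp add: L_def)
  then show ?thesis by blast
qed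

lemma of_shape_unique: "ptn p \<Longrightarrow> ptn q \<Longrightarrow> of_shape p \<alpha> \<Longrightarrow> of_shape q \<alpha> \<Longrightarrow> p = q"
proof -
  assume p: "ptn p" and q: "ptn q" and "of_shape p \<alpha>" "of_shape q \<alpha>"
  then have "mset (rev (lst p)) = mset (rev (lst q))" by (simp add: of_shape_def)
  moreover have "sorted (rev (lst p))" "sorted (rev (lst q))"
    using lst_partition[OF p] lst_partition[OF q] by (simp_all add: partitions_def sorted_wrt_rev)
  ultimately have "rev (lst p) = rev (lst q)" by (metis properties_for_sort)
  then show "p = q" using row_lst[OF p] row_lst[OF q] by (metis rev_rev_ident)
qed

lemma of_shape_expvec: "ptn p \<Longrightarrow> of_shape p (expvec p)"
  unfolding of_shape_def mono_mset_eq by (simp only: lookup_expvec_ptn mset_lst)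

lemma pcoeff_monomial: "pcoeff (monomial_fun (lst f)) \<alpha> = (if of_shape f \<alpha> then 1 else 0)"
  by (simp add: pcoeff_monomial_fun of_shape_def)

lemma symmetric_of_shape:
  assumes "symmetric F" "of_shape p \<alpha>" "ptn p"
  shows "pcoeff F \<alpha> = pcoeff F (expvec p)"
proof -
  obtain N1 N2 where "\<forall>i\<ge>N1. p i = 0" "\<forall>i\<ge>N2. Poly_Mapping.lookup \<alpha> i = 0"
    using ptn_eventually_zero[OF assms(3)] lookup_eventually_zero[of \<alpha>] by blast
  then obtain w where w: "w permutes {..<max N1 N2}" "Poly_Mapping.lookup \<alpha> = p \<circ> w"
    using of_shape_iff[OF assms(3), of "max N1 N2" \<alpha>] assms(2) by auto
  then have "\<alpha> = Poly_Mapping.map_key w (expvec p)"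
    by (intro poly_mapping_eqI) (simp add: map_key.rep_eq permutes_inj lookup_expvec_ptn[OF assms(3)])
  then show ?thesis using assms(1) permutes_bij[OF w(1)] by (simp add: symmetric_def)
qed

section \<open>Structure constants of the monomial basis\<close>

definition monom_prod :: "(nat \<Rightarrow> nat) \<Rightarrow> (nat \<Rightarrow> nat) \<Rightarrow> pseries" where
  "monom_prod f g = monomial_fun (lst f) * monomial_fun (lst g)"

lemma monom_prod_symmetric: "symmetric (monom_prod f g)"
  and monom_prod_bounded: "bounded_degree (monom_prod f g)"
  using monomial_fun_in_Lambda_Z[of "lst f"] monomial_fun_in_Lambda_Z[of "lst g"]
  by (auto simp: monom_prod_def Lambda_Z_def symmetric_mult bounded_degree_mult)

lemma pcoeff_monom_prod:
  "pcoeff (monom_prod f g) \<alpha> = int (card {(\<beta>, \<gamma>). \<beta> + \<gamma> = \<alpha> \<and> of_shape f \<beta> \<and> of_shape g \<gamma>})"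
proof -
  have "pcoeff (monom_prod f g) \<alpha> = (\<Sum>z | fst z + snd z = \<alpha>. if of_shape f (fst z) \<and> of_shape g (snd z) then 1 else 0)"
    unfolding monom_prod_def times_pseries.rep_eq by (intro sum.cong) (auto simp: pcoeff_monomial)
  also have "\<dots> = int (card {z. fst z + snd z = \<alpha> \<and> of_shape f (fst z) \<and> of_shape g (snd z)})"
    using finite_splittings[of \<alpha>, unfolded case_prod_beta]
    by (subst sum.inter_filter[symmetric]) simp_all
  also have "{z. fst z + snd z = \<alpha> \<and> of_shape f (fst z) \<and> of_shape g (snd z)} =
    {(\<beta>, \<gamma>). \<beta> + \<gamma> = \<alpha> \<and> of_shape f \<beta> \<and> of_shape g \<gamma>}" by auto
  finally show ?thesis .
qed

definition monom_support :: "(nat \<Rightarrow> nat) \<Rightarrow> (nat \<Rightarrow> nat) \<Rightarrow> (nat \<Rightarrow> nat) set" where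
  "monom_support f g = {p. ptn p \<and> pcoeff (monom_prod f g) (expvec p) \<noteq> 0}"

text \<open>For a partition p the monomial x^p occurs in the monomial function of p and of no other
  partition, so its coefficient is the multiplicity of p.\<close>

definition monom_terms :: "(nat \<Rightarrow> nat) \<Rightarrow> (nat \<Rightarrow> nat) \<Rightarrow> (nat \<Rightarrow> nat) multiset" where
  "monom_terms f g = (\<Sum>p\<in>monom_support f g. replicate_mset (nat (pcoeff (monom_prod f g) (expvec p))) p)"

lemma finite_ptn_degree: "finite {p. ptn p \<and> total_degree (expvec p) \<le> d}"
proof -
  have "{p. ptn p \<and> total_degree (expvec p) \<le> d} \<subseteq>
    {p. \<forall>i. (i \<in> {..<d} \<longrightarrow> p i \<in> {..d}) \<and> (i \<notin> {..<d} \<longrightarrow> p i = 0)}"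
  proof clarify
    fix p i assume p: "ptn p" and d: "total_degree (expvec p) \<le> d"
    have le: "sum p K \<le> d" if "finite K" for K
    proof -
      have "sum p K = sum p (K \<inter> Poly_Mapping.keys (expvec p))"
        using that by (intro sum.mono_neutral_right) (auto simp: in_keys_iff lookup_expvec_ptn[OF p])
      also have "\<dots> \<le> sum p (Poly_Mapping.keys (expvec p))" by (intro sum_mono2) auto
      also have "\<dots> = total_degree (expvec p)" by (simp add: total_degree_def lookup_expvec_ptn[OF p])
      finally show ?thesis using d by simp
    qed
    have "p i = 0" if "i \<notin> {..<d}"
    proof (rule ccontr)
      assume "p i \<noteq> 0"
      then have "1 \<le> p k" if "k \<in> {..i}" for k using ptn_antimono[OF p, of k i] that by simp
      then have "of_nat (card {..i}) * 1 \<le> sum p {..i}" by (rule sum_bounded_below)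
      then show False using le[of "{..i}"] that by simp
    qed
    then show "(i \<in> {..<d} \<longrightarrow> p i \<in> {..d}) \<and> (i \<notin> {..<d} \<longrightarrow> p i = 0)" using le[of "{i}"] by simp
  qed
  then show ?thesis by (rule finite_subset) (rule finite_set_of_finite_funs, auto)
qed

lemma finite_monom_support: "finite (monom_support f g)"
proof -
  obtain d where "\<And>\<alpha>. pcoeff (monom_prod f g) \<alpha> \<noteq> 0 \<Longrightarrow> total_degree \<alpha> \<le> d"
    using monom_prod_bounded[of f g] by (auto simp: bounded_degree_def)
  then show ?thesis
    by (intro finite_subset[OF _ finite_ptn_degree[of d]]) (auto simp: monom_support_def)
qed

lemma count_monom_terms:
  assumes "ptn p"
  shows "int (count (monom_terms f g) p) = pcoeff (monom_prod f g) (expvec p)"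
proof -
  have nn: "0 \<le> pcoeff (monom_prod f g) \<alpha>" for \<alpha> by (simp add: pcoeff_monom_prod)
  have "count (monom_terms f g) p = (\<Sum>q\<in>monom_support f g. if p = q then nat (pcoeff (monom_prod f g) (expvec q)) else 0)"
    unfolding monom_terms_def count_sum by (intro sum.cong) auto
  also have "\<dots> = nat (pcoeff (monom_prod f g) (expvec p))"
    using assms finite_monom_support[of f g] by (simp add: monom_support_def)
  finally show ?thesis using nn by simp
qed

lemma monom_terms_ptn: "p \<in># monom_terms f g \<Longrightarrow> ptn p"
  using finite_monom_support[of f g]
  by (auto simp: monom_terms_def set_mset_sum monom_support_def split: if_splits)

lemma monom_terms_mult:
  "monomial_fun (lst f) * monomial_fun (lst g) = (\<Sum>p\<in>#monom_terms f g. monomial_fun (lst p))"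
proof (rule pseries_eqI)
  fix \<alpha>
  obtain q where q: "ptn q" "of_shape q \<alpha>" using of_shape_ex by blast
  have "pcoeff (\<Sum>p\<in>#D. monomial_fun (lst p)) \<alpha> = int (count D q)" if "\<forall>p\<in>#D. ptn p" for D
    using that
  proof (induction D)
    case (add p D)
    have "of_shape p \<alpha> \<longleftrightarrow> p = q" using of_shape_unique q add.prems by auto
    with add show ?case by (simp add: plus_pseries.rep_eq pcoeff_monomial)
  qed (simp add: zero_pseries.rep_eq)
  then have "pcoeff (\<Sum>p\<in>#monom_terms f g. monomial_fun (lst p)) \<alpha> = int (count (monom_terms f g) q)"
    using monom_terms_ptn by blast
  then show "pcoeff (monomial_fun (lst f) * monomial_fun (lst g)) \<alpha> =
    pcoeff (\<Sum>p\<in>#monom_terms f g. monomial_fun (lst p)) \<alpha>"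
    using symmetric_of_shape[OF monom_prod_symmetric q(2,1)] count_monom_terms[OF q(1)]
    by (simp add: monom_prod_def)
qed

lemma monom_terms_iff:
  "p \<in># monom_terms f g \<longleftrightarrow> ptn p \<and> (\<exists>\<beta> \<gamma>. \<beta> + \<gamma> = expvec p \<and> of_shape f \<beta> \<and> of_shape g \<gamma>)"
proof -
  have "p \<in># monom_terms f g \<longleftrightarrow> ptn p \<and> 0 < int (count (monom_terms f g) p)"
    using monom_terms_ptn by (auto simp: count_greater_zero_iff)
  also have "\<dots> \<longleftrightarrow> ptn p \<and> {(\<beta>, \<gamma>). \<beta> + \<gamma> = expvec p \<and> of_shape f \<beta> \<and> of_shape g \<gamma>} \<noteq> {}"
  proof (cases "ptn p")
    case True
    have "finite {(\<beta>, \<gamma>). \<beta> + \<gamma> = expvec p \<and> of_shape f \<beta> \<and> of_shape g \<gamma>}"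
      by (rule finite_subset[OF _ finite_splittings[of "expvec p"]]) auto
    then show ?thesis
      unfolding count_monom_terms[OF True] pcoeff_monom_prod of_nat_0_less_iff card_gt_0_iff by blast
  qed simp
  finally show ?thesis by auto
qed

text \<open>The monomial x^(f + f \<circ> w) splits as x^f times x^(f \<circ> w) and in the opposite
  order. These splittings differ as f \<circ> w \<noteq> f, so its shape p occurs at least twice in
  the square. The exponents are the rows of p in another order; row x of p is at most y once no more
  than x of them exceed y.\<close>

lemma monom_square:
  assumes f: "ptn f" and w: "w permutes {..<N}" "\<And>i. N \<le> i \<Longrightarrow> f i = 0" "f \<circ> w \<noteq> f"
    and few: "card {i. y < f i + f (w i)} \<le> x"
  shows "2 \<le> size {#p \<in># monom_terms f f. p x \<le> y#}"
proof -
  have w0: "f (w i) = 0" if "N \<le> i" for i using that w(2) permutes_not_in[OF w(1), of i] by simp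
  define \<gamma> where "\<gamma> = expvec (f \<circ> w)"
  have \<gamma>: "Poly_Mapping.lookup \<gamma> = f \<circ> w"
    unfolding \<gamma>_def by (rule lookup_expvec, rule finite_zero_outside[of N]) (simp add: w0)
  have sg: "of_shape f \<gamma>" using w w0 \<gamma> by (subst of_shape_iff[OF f, of N]) auto
  have neq: "expvec f \<noteq> \<gamma>" using \<gamma> w(3) lookup_expvec_ptn[OF f] by metis
  obtain p where p: "ptn p" "of_shape p (expvec f + \<gamma>)" using of_shape_ex by blast
  have lk: "Poly_Mapping.lookup (expvec f + \<gamma>) i = f i + f (w i)" for i
    by (simp add: lookup_add lookup_expvec_ptn[OF f] \<gamma>)
  obtain K where K: "\<forall>i\<ge>K. p i = 0" using ptn_eventually_zero[OF p(1)] by blast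
  obtain u where u: "u permutes {..<max N K}" "Poly_Mapping.lookup (expvec f + \<gamma>) = p \<circ> u"
    using p of_shape_iff[OF p(1), of "max N K" "expvec f + \<gamma>"] K w(2) w0 lk by auto
  have "{i. y < f i + f (w i)} = u -` {i. y < p i}" using u(2) lk by (auto simp: fun_eq_iff)
  then have "card {i. y < f i + f (w i)} = card {i. y < p i}"
    using card_vimage_inj[OF permutes_inj[OF u(1)], of "{i. y < p i}"] permutes_surj[OF u(1)] by simp
  then have px: "p x \<le> y" using few ptn_less_card_iff[OF p(1), of x y] by linarith
  have "int (count (monom_terms f f) p) = pcoeff (monom_prod f f) (expvec f + \<gamma>)"
    using count_monom_terms[OF p(1)] symmetric_of_shape[OF monom_prod_symmetric p(2,1)] by simp
  also have "\<dots> \<ge> int (card {(expvec f, \<gamma>), (\<gamma>, expvec f)})"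
    unfolding pcoeff_monom_prod of_nat_le_iff
    by (rule card_mono, rule finite_subset[OF _ finite_splittings[of "expvec f + \<gamma>"]])
      (auto simp: sg of_shape_expvec[OF f] add.commute)
  finally have "2 \<le> count (monom_terms f f) p" using neq by simp
  also have "\<dots> = count {#p \<in># monom_terms f f. p x \<le> y#} p" using px by simp
  also have "\<dots> \<le> size {#p \<in># monom_terms f f. p x \<le> y#}" by (rule count_le_size)
  finally show ?thesis .
qed

text \<open>A decreasing h has its least sum on the tail {x..<N}. Positions in the tail but not in
  the image have values at most h x, those in the image but not in the tail at least h x, and both
  kinds are equally many.\<close>

lemma sum_antimono_rearrange:
  fixes h :: "nat \<Rightarrow> nat"
  assumes h: "antimono h" and w: "w permutes {..<N}"
  shows "(\<Sum>i\<in>{x..<N}. h i) \<le> (\<Sum>i\<in>{x..<N}. h (w i))"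
proof -
  let ?B = "{x..<N}" and ?A = "w ` {x..<N}"
  have inj: "inj_on w ?B" using permutes_inj_on[OF w] .
  have fin: "finite ?A" "finite ?B" by auto
  have A: "?A \<subseteq> {..<N}" using permutes_image[OF w] image_mono[of ?B "{..<N}" w] by auto
  have "card ?A = card ?B" by (rule card_image[OF inj])
  then have c: "card (?A - ?B) = card (?B - ?A)"
    using fin card_Int_Diff[of ?A ?B] card_Int_Diff[of ?B ?A] by (simp add: Int_commute)
  have "(\<Sum>i\<in>?B - ?A. h i) \<le> card (?B - ?A) * h x"
    using antimonoD[OF h] by (intro sum_bounded_above[of _ h "h x", simplified]) auto
  also have "\<dots> \<le> (\<Sum>i\<in>?A - ?B. h i)"
    unfolding c[symmetric] using antimonoD[OF h] A by (intro sum_bounded_below[of _ "h x" h, simplified]) auto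
  finally have "(\<Sum>i\<in>?B. h i) \<le> (\<Sum>i\<in>?A. h i)"
    using sum.Int_Diff[OF fin(1), of h ?B] sum.Int_Diff[OF fin(2), of h ?A] by (simp add: Int_commute)
  then show ?thesis by (simp add: sum.reindex[OF inj])
qed

text \<open>A term has the form p = f \<circ> w + g \<circ> u. Rearranging does not decrease the
  excess over y in the rows from x on, and (a - y) + (c - y) \<le> (a + c) - y for truncated
  subtraction.\<close>

lemma monom_terms_out:
  assumes f: "ptn f" and g: "ptn g" and p: "p \<in># monom_terms f g"
  shows "out x y f + out x y g \<le> out x y p"
proof -
  obtain \<beta> \<gamma> where bg: "ptn p" "\<beta> + \<gamma> = expvec p" "of_shape f \<beta>" "of_shape g \<gamma>"
    using p by (auto simp: monom_terms_iff)
  obtain N1 N2 N3 where "\<forall>i\<ge>N1. f i = 0" "\<forall>i\<ge>N2. g i = 0" "\<forall>i\<ge>N3. p i = 0"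
    using ptn_eventually_zero f g bg(1) by metis
  then obtain N where N: "\<And>i. N \<le> i \<Longrightarrow> f i = 0" "\<And>i. N \<le> i \<Longrightarrow> g i = 0" "\<And>i. N \<le> i \<Longrightarrow> p i = 0"
    by (metis max.bounded_iff)
  have lk: "p i = Poly_Mapping.lookup \<beta> i + Poly_Mapping.lookup \<gamma> i" for i
    using arg_cong[OF bg(2), of "\<lambda>x. Poly_Mapping.lookup x i"] by (simp add: lookup_add lookup_expvec_ptn[OF bg(1)])
  obtain w where w: "w permutes {..<N}" "Poly_Mapping.lookup \<beta> = f \<circ> w"
    using of_shape_iff[OF f, of N \<beta>] bg(3) N lk by auto
  obtain u where u: "u permutes {..<N}" "Poly_Mapping.lookup \<gamma> = g \<circ> u"
    using of_shape_iff[OF g, of N \<gamma>] bg(4) N lk by auto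
  have am: "antimono (\<lambda>i. q i - y)" if "ptn q" for q
    using ptn_antimono[OF that] by (intro antimonoI diff_le_mono)
  have "out x y f + out x y g = (\<Sum>i\<in>{x..<N}. f i - y) + (\<Sum>i\<in>{x..<N}. g i - y)"
    using N by (simp add: out_eq[of N])
  also have "\<dots> \<le> (\<Sum>i\<in>{x..<N}. f (w i) - y) + (\<Sum>i\<in>{x..<N}. g (u i) - y)"
    by (intro add_mono sum_antimono_rearrange[OF am[OF f] w(1)] sum_antimono_rearrange[OF am[OF g] u(1)])
  also have "\<dots> \<le> (\<Sum>i\<in>{x..<N}. p i - y)"
    unfolding sum.distrib[symmetric] by (rule sum_mono) (simp add: lk w u)
  also have "\<dots> = out x y p" using N by (simp add: out_eq[of N])
  finally show ?thesis .
qed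

text \<open>The shapes within the first x rows that no permutation of these rows changes.\<close>

definition rect_rows :: "nat \<Rightarrow> nat \<Rightarrow> nat \<Rightarrow> nat \<Rightarrow> nat" where
  "rect_rows x y a i = (if i < x then a else 0)"

lemma rect_rows_ptn: "ptn (rect_rows x y a)"
  by (rule ptnI[of _ x]) (auto simp: rect_rows_def)

lemma monom_square_all:
  assumes f: "ptn f" "f \<noteq> (\<lambda>_. 0)"
  shows "2 \<le> size (monom_terms f f)"
proof -
  obtain N where N: "\<forall>i\<ge>N. f i = 0" using ptn_eventually_zero[OF f(1)] by blast
  have f0: "f 0 \<noteq> 0" using f ptn_antimono[OF f(1), of 0] by (metis le_zero_eq zero_le)
  \<comment> \<open>Row 0 is swapped with an empty row. The bound f 0 + f 0 is never exceeded, so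
    the hook condition excludes nothing that matters.\<close>
  have "2 \<le> size {#p \<in># monom_terms f f. p (Suc N) \<le> f 0 + f 0#}"
  proof (rule monom_square[OF f(1), where w = "Transposition.transpose 0 N" and N = "Suc N"])
    show "Transposition.transpose 0 N permutes {..<Suc N}" by (rule permutes_swap_id) auto
    have "f (Transposition.transpose 0 N 0) \<noteq> f 0" using N f0 by simp
    then show "f \<circ> Transposition.transpose 0 N \<noteq> f" by (metis comp_apply)
    have "{i. f 0 + f 0 < f i + f (Transposition.transpose 0 N i)} = {}"
      using ptn_antimono[OF f(1), of 0] by (auto simp: not_less add_mono)
    then show "card {i. f 0 + f 0 < f i + f (Transposition.transpose 0 N i)} \<le> Suc N" by simp
  qed (use N in auto)
  also have "\<dots> \<le> size (monom_terms f f)" by (simp add: size_mset_mono)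
  finally show ?thesis .
qed

text \<open>If row x is empty, two unequal rows among the first x are swapped and the rows below
  stay empty. Otherwise the rows from x on are copied to empty rows further down; no two nonempty
  ones are added, so all stay at most y.\<close>

lemma monom_square_hook:
  assumes f: "ptn f" "f x \<le> y" "f \<notin> range (rect_rows x y)"
  shows "2 \<le> size {#p \<in># monom_terms f f. p x \<le> y#}"
proof -
  obtain N0 where "\<forall>i\<ge>N0. f i = 0" using ptn_eventually_zero[OF f(1)] by blast
  then obtain N where N: "\<And>i. N \<le> i \<Longrightarrow> f i = 0" "x < N" using that[of "max N0 (Suc x)"] by auto
  show ?thesis
  proof (cases "f x = 0")
    case True
    have fx: "f i = 0" if "x \<le> i" for i using True ptn_antimono[OF f(1) that] by simp
    have "\<exists>i j. i < x \<and> j < x \<and> f i \<noteq> f j"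
    proof (rule ccontr)
      assume const: "\<not> (\<exists>i j. i < x \<and> j < x \<and> f i \<noteq> f j)"
      have e: "f = rect_rows x y (f 0)"
      proof (intro ext)
        fix k show "f k = rect_rows x y (f 0) k"
        proof (cases "k < x")
          case True
          then have "0 < x" by simp
          with True const have "f k = f 0" by blast
          with True show ?thesis by (simp only: rect_rows_def if_True)
        qed (simp add: rect_rows_def fx)
      qed
      have "f \<in> range (rect_rows x y)" by (rule range_eqI[where x = "f 0"]) (rule e)
      then show False using f(3) by blast
    qed
    then obtain i j where ij: "i < x" "j < x" "f i \<noteq> f j" by blast
    let ?w = "Transposition.transpose i j"
    show ?thesis
    proof (rule monom_square[OF f(1), where w = ?w and N = N])
      show "?w permutes {..<N}" using ij N(2) by (intro permutes_swap_id) auto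
      have "f (?w i) \<noteq> f i" using ij by simp
      then show "f \<circ> ?w \<noteq> f" by (metis comp_apply)
      have "{k. y < f k + f (?w k)} \<subseteq> {..<x}"
      proof (rule subsetI, rule ccontr)
        fix k assume k: "k \<in> {k. y < f k + f (?w k)}" "k \<notin> {..<x}"
        then have "?w k = k" using ij by (intro transpose_apply_other) auto
        with k fx show False by auto
      qed
      then show "card {k. y < f k + f (?w k)} \<le> x" by (metis card_lessThan card_mono finite_lessThan)
    qed (use N in auto)
  next
    case False
    define d where "d = N - x"
    have d: "N = x + d" "0 < d" using N(2) by (simp_all add: d_def)
    \<comment> \<open>Interchanges the blocks [x, x + d) and [x + d, x + d + d); f vanishes on the
      second because x + d = N.\<close>
    define w where "w i = (if i < x then i else if i < x + d then i + d else if i < x + d + d then i - d else i)" for i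
    have ww: "w (w i) = i" for i unfolding w_def by auto
    show ?thesis
    proof (rule monom_square[OF f(1), where w = w and N = "x + d + d"])
      show "w permutes {..<x + d + d}"
        unfolding permutes_def
      proof (intro conjI allI impI)
        fix i assume "i \<notin> {..<x + d + d}"
        then show "w i = i" by (simp add: w_def)
      next
        fix i show "\<exists>!k. w k = i"
        proof (rule ex1I[of _ "w i"])
          fix k assume "w k = i"
          then show "k = w i" using ww[of k] by simp
        qed (rule ww)
      qed
      have "f (w x) = 0" using N d by (simp add: w_def)
      then show "f \<circ> w \<noteq> f" using False by (metis comp_apply)
      have "f i + f (w i) \<le> y" if "x \<le> i" for i
      proof -
        have "f i \<le> y" using ptn_antimono[OF f(1) that] f(2) by simp
        moreover have "f (i - d) \<le> y" if "\<not> i < x + d"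
        proof -
          have "x \<le> i - d" using that by linarith
          then show ?thesis using ptn_antimono[OF f(1)] f(2) le_trans by blast
        qed
        moreover have "f i = 0 \<or> i < x + d" "f (i + d) = 0" using that N(1)[of i] N(1)[of "i + d"] d by auto
        ultimately show ?thesis using that unfolding w_def by (cases "i < x + d") simp_all
      qed
      then have "{i. y < f i + f (w i)} \<subseteq> {..<x}" by (metis (mono_tags, lifting) lessThan_iff linorder_not_less mem_Collect_eq subsetI)
      then show "card {i. y < f i + f (w i)} \<le> x" by (metis card_lessThan card_mono finite_lessThan)
      show "f i = 0" if "x + d + d \<le> i" for i using N(1)[of i] d(1) that by simp
    qed
  qed
qed

interpretation monomial: product_basis monomial_fun monom_terms rect_rows
proof
  show "monomial_fun [] = 1"
    by (rule pseries_eqI) (auto simp: pcoeff_monomial_fun one_pseries.rep_eq mset_set_empty_iff)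
next
  fix f g p x y assume "ptn f" "ptn g" "p \<in># monom_terms f g"
  then show "out x y f + out x y g \<le> out x y p" by (rule monom_terms_out)
next
  fix f :: "nat \<Rightarrow> nat" and i assume f: "ptn f" and f': "ptn (f(i := Suc (f i)))"
  let ?e = "\<lambda>k. if k = 0 then 1 else 0 :: nat"
  have e: "ptn ?e" by (rule ptnI[of _ 1]) auto
  have fe: "{k. ?e (Transposition.transpose 0 i k) \<noteq> 0} = {i}" by (auto simp: Transposition.transpose_def)
  have \<gamma>: "Poly_Mapping.lookup (expvec (?e \<circ> Transposition.transpose 0 i)) = ?e \<circ> Transposition.transpose 0 i"
    using fe by (intro lookup_expvec) (simp add: comp_def)
  have "of_shape ?e (expvec (?e \<circ> Transposition.transpose 0 i))"
    using \<gamma> by (subst of_shape_iff[OF e, of "Suc i"])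
      (auto intro!: exI[of _ "Transposition.transpose 0 i"] permutes_swap_id simp: Transposition.transpose_def)
  moreover have "expvec f + expvec (?e \<circ> Transposition.transpose 0 i) = expvec (f(i := Suc (f i)))"
    by (rule poly_mapping_eqI)
      (auto simp: lookup_add lookup_expvec_ptn f f' \<gamma> Transposition.transpose_def)
  ultimately show "f(i := Suc (f i)) \<in># monom_terms f ?e"
    unfolding monom_terms_iff using f' of_shape_expvec[OF f] by blast
next
  fix x y a c
  have "expvec (rect_rows x y a) + expvec (rect_rows x y c) = expvec (rect_rows x y (a + c))"
    by (rule poly_mapping_eqI) (simp add: lookup_add lookup_expvec_ptn rect_rows_ptn, simp add: rect_rows_def)
  then show "rect_rows x y (a + c) \<in># monom_terms (rect_rows x y a) (rect_rows x y c)"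
    unfolding monom_terms_iff using rect_rows_ptn of_shape_expvec by blast
next
  have s: "mono_mset (sqf S) = replicate_mset (card S) 1" if "finite S" for S
  proof -
    have "{i. Poly_Mapping.lookup (sqf S) i \<noteq> 0} = S" using that by (auto simp: lookup_sqf)
    then have "mono_mset (sqf S) = image_mset (Poly_Mapping.lookup (sqf S)) (mset_set S)"
      by (simp only: mono_mset_eq)
    also have "\<dots> = image_mset (\<lambda>_. 1) (mset_set S)"
      using that by (intro image_mset_cong) (simp add: lookup_sqf)
    finally show ?thesis by (simp add: image_mset_const_eq)
  qed
  show "pcoeff (monomial_fun (lst f)) (sqf S) = sqf_coeff (card S) (monomial_fun (lst f))" if "finite S" for f S
    using that by (simp only: pcoeff_monomial_fun s finite_lessThan card_lessThan)
  show "sqf_coeff j (monomial_fun (replicate k 1)) = (if j = k then 1 else 0)" for j k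
    by (simp only: pcoeff_monomial_fun s finite_lessThan card_lessThan mset_replicate) (simp add: replicate_mset_eq_iff)
next
  show "bounded_degree (monomial_fun (lst f))" for f
    using monomial_fun_in_Lambda_Z[of "lst f"] by (simp add: Lambda_Z_def)
qed (auto simp: monom_terms_ptn monom_terms_mult monom_square_all monom_square_hook rect_rows_ptn
    pcoeff_monomial, simp add: rect_rows_def)

lemma countable_Witt_iff: "countable (Witt (trunc_nat n)) \<longleftrightarrow> n \<le> 2"
  using monomial.countable_Hom_iff unfolding Witt_def Lambda_N_def .

section \<open>Gelfand--Tsetlin patterns\<close>

text \<open>\<open>g k\<close> is the shape formed by the entries below k of a tableau with entries
  below N; the inequalities say that each level adds a horizontal strip. Keeping the levels constant
  from N on makes the sets \<open>gt N f\<close> increase with N.\<close>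

definition gt :: "nat \<Rightarrow> (nat \<Rightarrow> nat) \<Rightarrow> (nat \<Rightarrow> nat \<Rightarrow> nat) set" where
  "gt N f = {g. (\<forall>i. g 0 i = 0) \<and> (\<forall>k\<ge>N. g k = f) \<and>
     (\<forall>k i. g k i \<le> g (Suc k) i \<and> g (Suc k) (Suc i) \<le> g k i)}"

abbreviation sz :: "nat \<Rightarrow> (nat \<Rightarrow> nat) \<Rightarrow> nat" where
  "sz j f \<equiv> out 0 j f"

text \<open>The number of letters k in the columns from j on; for j = 0 this is the content.\<close>

definition wt :: "nat \<Rightarrow> (nat \<Rightarrow> nat \<Rightarrow> nat) \<Rightarrow> nat \<Rightarrow> nat" where
  "wt j g k = sz j (g (Suc k)) - sz j (g k)"

lemma sz_eq: "(\<And>i. N \<le> i \<Longrightarrow> f i = 0) \<Longrightarrow> sz j f = (\<Sum>i<N. f i - j)"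
  using out_eq[of N f 0 j] by (simp add: atLeast0LessThan)

lemma sz_Suc:
  assumes "ptn f" shows "sz j f = sz (Suc j) f + card {i. j < f i}"
proof -
  obtain N where N: "\<And>i. N \<le> i \<Longrightarrow> f i = 0" using ptn_eventually_zero[OF assms] by blast
  have "{i. j < f i} = {i \<in> {..<N}. j < f i}" using N by (auto intro: ccontr)
  then have "card {i. j < f i} = (\<Sum>i<N. if j < f i then 1 else 0)"
    by (simp add: sum.inter_filter[symmetric])
  moreover have "(\<Sum>i<N. f i - j) = (\<Sum>i<N. (f i - Suc j) + (if j < f i then 1 else 0))"
    by (intro sum.cong) auto
  ultimately show ?thesis using N by (simp add: sz_eq[of N] sum.distrib)
qed

context
  fixes N f g
  assumes g: "g \<in> gt N f"
begin

lemma gt_0: "g 0 i = 0"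
  and gt_top: "N \<le> k \<Longrightarrow> g k = f"
  and gt_up: "g k i \<le> g (Suc k) i"
  and gt_diag: "g (Suc k) (Suc i) \<le> g k i"
  using g by (auto simp: gt_def)

lemma gt_mono: "k \<le> l \<Longrightarrow> g k i \<le> g l i"
  by (rule lift_Suc_mono_le[of "\<lambda>k. g k i"]) (rule gt_up)

lemma gt_le: "g k i \<le> f i"
  using gt_mono[of k "max k N" i] gt_top[of "max k N"] by simp

lemma gt_row: "g k (Suc i) \<le> g k i"
  using gt_up[of k "Suc i"] gt_diag[of k i] by simp

lemma gt_zero: "k \<le> i \<Longrightarrow> g k i = 0"
proof (induction k arbitrary: i)
  case (Suc k)
  then obtain i' where "i = Suc i'" "k \<le> i'" by (cases i) auto
  then show ?case using Suc.IH[of i'] gt_diag[of k i'] by simp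
qed (rule gt_0)

lemma gt_zero': "N \<le> i \<Longrightarrow> g k i = 0"
  using gt_le[of k i] gt_zero[of N i] gt_top[of N] by simp

lemma gt_ptn: "ptn (g k)"
  by (rule ptnI[of _ k]) (auto simp: gt_row gt_zero)

lemma gt_shape: "ptn f"
  using gt_ptn[of N] gt_top[of N] by simp

lemma gt_sz: "sz j (g k) = (\<Sum>i<N. g k i - j)"
  by (rule sz_eq) (rule gt_zero')

lemma sz_gt_mono: "sz j (g k) \<le> sz j (g (Suc k))"
  unfolding gt_sz by (intro sum_mono diff_le_mono gt_up)

lemma wt_add: "wt j g k + sz j (g k) = sz j (g (Suc k))"
  unfolding wt_def using sz_gt_mono[of j k] by simp

lemma wt_zero: "N \<le> k \<Longrightarrow> wt j g k = 0"
  unfolding wt_def by (simp add: gt_top)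

lemma sum_wt: "(\<Sum>k<K. wt j g k) = sz j (g K)"
proof (induction K)
  case 0
  have "sz j (g 0) = 0" by (subst gt_sz) (simp add: gt_0)
  then show ?case by simp
next
  case (Suc K)
  then show ?case using wt_add[of j K] by simp
qed

lemma card_column_up: "card {i. j < g k i} \<le> card {i. j < g (Suc k) i}"
  by (rule card_mono) (auto simp: ptn_finite gt_ptn intro: less_le_trans[OF _ gt_up])

lemma card_column_diag: "card {i. j < g (Suc k) i} \<le> Suc (card {i. j < g k i})"
proof -
  let ?c = "card {i. j < g k i}"
  have "\<not> j < g k ?c" using ptn_less_card_iff[OF gt_ptn, of ?c j k] by simp
  then have "\<not> j < g (Suc k) (Suc ?c)" using gt_diag[of k ?c] by simp
  then show ?thesis using ptn_less_card_iff[OF gt_ptn, of "Suc ?c" j "Suc k"] by simp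
qed

text \<open>The growth of column j from level k to level \<open>Suc k\<close> is the number of
  letters k in it, and this is the difference of the two weights.\<close>

lemma wt_Suc: "wt j g k + card {i. j < g k i} = wt (Suc j) g k + card {i. j < g (Suc k) i}"
  using wt_add[of j k] wt_add[of "Suc j" k] sz_Suc[OF gt_ptn, of j k] sz_Suc[OF gt_ptn, of j "Suc k"] by simp

end

lemma finite_gt: "finite (gt N f)"
proof -
  let ?F = "{h. \<forall>i. (i \<in> {..<N} \<longrightarrow> h i \<in> {..f 0}) \<and> (i \<notin> {..<N} \<longrightarrow> h i = 0)}"
  have "gt N f \<subseteq> {g. \<forall>k. (k \<in> {..<N} \<longrightarrow> g k \<in> ?F) \<and> (k \<notin> {..<N} \<longrightarrow> g k = f)}"
  proof (clarsimp simp: not_less, intro conjI impI allI)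
    fix g k assume g: "g \<in> gt N f"
    show "g k i \<le> f 0" for i
      using gt_le[OF g, of k i] ptn_antimono[OF gt_shape[OF g], of 0 i] by simp
    show "g k i = 0" if "N \<le> i" for i using gt_zero'[OF g that] .
    show "g k = f" if "N \<le> k" using gt_top[OF g that] .
  qed
  moreover have "finite ?F" by (rule finite_set_of_finite_funs) auto
  then have "finite {g. \<forall>k. (k \<in> {..<N} \<longrightarrow> g k \<in> ?F) \<and> (k \<notin> {..<N} \<longrightarrow> g k = f)}"
    by (rule finite_set_of_finite_funs[rotated]) simp
  ultimately show ?thesis by (rule finite_subset)
qed

section \<open>Bender--Knuth involutions\<close>

text \<open>
  Row \<open>i\<close> of level \<open>Suc k\<close> is confined by its neighbours to an interval, in which it is reflected.
  Only rows \<open>i \<ge> q\<close> are touched, and the upper end of the interval of row \<open>q\<close> is lowered to \<open>j\<close>;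
  for the columns below \<open>j\<close> this is the usual involution on the tableau cut off at column \<open>j\<close>.
\<close>

definition bk :: "nat \<Rightarrow> nat \<Rightarrow> nat \<Rightarrow> (nat \<Rightarrow> nat \<Rightarrow> nat) \<Rightarrow> nat \<Rightarrow> nat \<Rightarrow> nat" where
  "bk k q j g = g(Suc k := (\<lambda>i. if i < q then g (Suc k) i else
     (if i = q then j else min (g (Suc (Suc k)) i) (g k (i - 1))) +
     max (g (Suc (Suc k)) (Suc i)) (g k i) - g (Suc k) i))"

text \<open>The end j lies between the present entry of row q and its true upper end. Row 0 has no
  upper left neighbour; it is touched only for q = 0, and then j stands in place of the value at
  \<open>i - 1\<close>.\<close>

definition bk_ok :: "nat \<Rightarrow> nat \<Rightarrow> nat \<Rightarrow> (nat \<Rightarrow> nat \<Rightarrow> nat) \<Rightarrow> bool" where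
  "bk_ok k q j g \<longleftrightarrow> g (Suc k) q \<le> j \<and> j \<le> g (Suc (Suc k)) q \<and> (q = 0 \<or> j \<le> g k (q - 1))"

lemma bk_other: "l \<noteq> Suc k \<Longrightarrow> bk k q j g l = g l"
  by (simp add: bk_def)

context
  fixes N f g k q j
  assumes g: "g \<in> gt N f" and ok: "bk_ok k q j g"
begin

lemma bk_low: "max (g (Suc (Suc k)) (Suc i)) (g k i) \<le> g (Suc k) i"
  using gt_up[OF g, of k i] gt_diag[OF g, of "Suc k" i] by simp

lemma bk_high: "q \<le> i \<Longrightarrow> g (Suc k) i \<le> (if i = q then j else min (g (Suc (Suc k)) i) (g k (i - 1)))"
  using gt_up[OF g, of "Suc k" i] gt_diag[OF g, of k "i - 1"] ok by (auto simp: bk_ok_def)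

lemma bk_ge: "max (g (Suc (Suc k)) (Suc i)) (g k i) \<le> bk k q j g (Suc k) i"
  using bk_low[of i] bk_high[of i] by (cases "i < q") (auto simp: bk_def)

lemma bk_le: "q \<le> i \<Longrightarrow> bk k q j g (Suc k) i \<le> (if i = q then j else min (g (Suc (Suc k)) i) (g k (i - 1)))"
  using bk_low[of i] bk_high[of i] by (auto simp: bk_def)

lemma bk_in_gt:
  assumes "Suc k < N" shows "bk k q j g \<in> gt N f"
proof -
  have up: "bk k q j g (Suc k) i \<le> g (Suc (Suc k)) i" for i
  proof (cases "i < q")
    case True
    then show ?thesis using gt_up[OF g, of "Suc k" i] by (simp add: bk_def)
  next
    case False
    then show ?thesis using bk_le[of i] ok by (auto simp: bk_ok_def split: if_splits)
  qed
  have diag: "bk k q j g (Suc k) (Suc i) \<le> g k i" for i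
  proof (cases "Suc i < q")
    case True
    then show ?thesis using gt_diag[OF g, of k i] by (simp add: bk_def)
  next
    case False
    then show ?thesis using bk_le[of "Suc i"] ok by (auto simp: bk_ok_def split: if_splits)
  qed
  have "bk k q j g l i \<le> bk k q j g (Suc l) i \<and> bk k q j g (Suc l) (Suc i) \<le> bk k q j g l i" for l i
  proof (cases "l = k")
    case True
    then show ?thesis using bk_ge[of i] diag[of i] by (simp add: bk_other)
  next
    case False
    show ?thesis
    proof (cases "l = Suc k")
      case True
      then show ?thesis using bk_ge[of i] up[of i] by (simp add: bk_other)
    next
      case F: False
      then show ?thesis using False gt_up[OF g, of l i] gt_diag[OF g, of l i] by (simp add: bk_other)
    qed
  qed
  then show ?thesis using g assms by (auto simp: gt_def bk_other)
qed

lemma bk_bk: "bk k q j (bk k q j g) = g"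
proof -
  have "bk k q j (bk k q j g) (Suc k) i = g (Suc k) i" for i
    using bk_low[of i] bk_high[of i] by (auto simp: bk_def)
  then show ?thesis by (intro ext) (metis bk_other)
qed

text \<open>In every touched row old and new entry add up to the two ends of the interval. The lower
  end of row i and the upper end of row i + 1 are maximum and minimum of the same two numbers, so
  the ends sum up to tails of the neighbouring levels.\<close>

lemma bk_sum:
  assumes k: "Suc k < N" and q: "q < N"
  shows "sz 0 (bk k q j g (Suc k)) + (\<Sum>i\<in>{q..<N}. g (Suc k) i) =
    (\<Sum>i<q. g (Suc k) i) + j + (\<Sum>i\<in>{Suc q..<N}. g (Suc (Suc k)) i) + (\<Sum>i\<in>{q..<N}. g k i)"
proof -
  let ?h = "bk k q j g (Suc k)" and ?u = "g (Suc (Suc k))" and ?l = "g k"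
  have z: "?u N = 0" "?l (N - 1) = 0"
    using gt_zero[OF g, of "Suc (Suc k)" N] gt_zero[OF g, of k "N - 1"] k by auto
  have split: "{..<N} = {..<q} \<union> {q..<N}" using q by auto
  have split': "{q..<N} = insert q {Suc q..<N}" using q by auto
  have "sz 0 ?h = (\<Sum>i<N. ?h i)" using gt_sz[OF bk_in_gt[OF k], of 0] by simp
  also have "\<dots> = (\<Sum>i<q. ?h i) + (\<Sum>i\<in>{q..<N}. ?h i)"
    unfolding split by (rule sum.union_disjoint) auto
  also have "(\<Sum>i<q. ?h i) = (\<Sum>i<q. g (Suc k) i)" by (intro sum.cong) (auto simp: bk_def)
  finally have 1: "sz 0 ?h = (\<Sum>i<q. g (Suc k) i) + (\<Sum>i\<in>{q..<N}. ?h i)" .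
  have "(\<Sum>i\<in>{q..<N}. ?h i) + (\<Sum>i\<in>{q..<N}. g (Suc k) i) = (\<Sum>i\<in>{q..<N}. ?h i + g (Suc k) i)"
    by (simp add: sum.distrib)
  also have "\<dots> = (\<Sum>i\<in>{q..<N}. (if i = q then j else min (?u i) (?l (i - 1))) + max (?u (Suc i)) (?l i))"
    using bk_low bk_high by (intro sum.cong refl) (auto simp: bk_def add_increasing2 trans_le_add1)
  also have "\<dots> = (\<Sum>i\<in>{q..<N}. if i = q then j else min (?u i) (?l (i - 1))) + (\<Sum>i\<in>{q..<N}. max (?u (Suc i)) (?l i))"
    by (rule sum.distrib)
  also have "(\<Sum>i\<in>{q..<N}. if i = q then j else min (?u i) (?l (i - 1))) = j + (\<Sum>i\<in>{Suc q..<N}. min (?u i) (?l (i - 1)))"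
    unfolding split' by (subst sum.insert) (auto intro: sum.cong)
  also have "(\<Sum>i\<in>{q..<N}. max (?u (Suc i)) (?l i)) = (\<Sum>i\<in>{Suc q..<Suc N}. max (?u i) (?l (i - 1)))"
    by (subst sum.shift_bounds_Suc_ivl) simp
  also have "\<dots> = (\<Sum>i\<in>{Suc q..<N}. max (?u i) (?l (i - 1)))"
    using q z by simp
  also have "j + (\<Sum>i\<in>{Suc q..<N}. min (?u i) (?l (i - 1))) + \<dots> =
    j + (\<Sum>i\<in>{Suc q..<N}. ?u i) + (\<Sum>i\<in>{Suc q..<N}. ?l (i - 1))"
    by (simp add: sum.distrib[symmetric] min_def max_def if_distrib cong: if_cong) (intro sum.cong, auto)
  also have "(\<Sum>i\<in>{Suc q..<N}. ?l (i - 1)) = (\<Sum>i\<in>{q..<N - 1}. ?l i)"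
    using q sum.shift_bounds_Suc_ivl[of "\<lambda>i. ?l (i - 1)" q "N - 1"] by simp
  also have "\<dots> = (\<Sum>i\<in>{q..<N}. ?l i)"
    using q z by (cases N) auto
  finally show ?thesis using 1 by simp
qed

end

text \<open>With q = 0 and the true upper end this is the Bender--Knuth involution. A level of size
  b between sizes a and c acquires size a + c - b, so the increments b - a and c - b change
  places.\<close>

lemma bk_full:
  assumes g: "g \<in> gt N f" and k: "Suc k < N"
  defines "h \<equiv> bk k 0 (g (Suc (Suc k)) 0) g"
  shows "h \<in> gt N f" "wt 0 h = wt 0 g \<circ> Transposition.transpose k (Suc k)"
    "bk k 0 (h (Suc (Suc k)) 0) h = g"
proof -
  have ok: "bk_ok k 0 (g (Suc (Suc k)) 0) g"
    using gt_up[OF g] by (simp add: bk_ok_def)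
  show h: "h \<in> gt N f" unfolding h_def by (rule bk_in_gt[OF g ok k])
  have e: "h (Suc (Suc k)) 0 = g (Suc (Suc k)) 0" by (simp add: h_def bk_other)
  show "bk k 0 (h (Suc (Suc k)) 0) h = g" unfolding e unfolding h_def by (rule bk_bk[OF g ok])
  have "sz 0 (h (Suc k)) + (\<Sum>i\<in>{0..<N}. g (Suc k) i) =
    g (Suc (Suc k)) 0 + (\<Sum>i\<in>{Suc 0..<N}. g (Suc (Suc k)) i) + (\<Sum>i\<in>{0..<N}. g k i)"
    using bk_sum[OF g ok k] k unfolding h_def by simp
  also have "g (Suc (Suc k)) 0 + (\<Sum>i\<in>{Suc 0..<N}. g (Suc (Suc k)) i) = (\<Sum>i\<in>{0..<N}. g (Suc (Suc k)) i)"
    using k by (subst (2) sum.atLeast_Suc_lessThan) auto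
  finally have sum: "sz 0 (h (Suc k)) + sz 0 (g (Suc k)) = sz 0 (g (Suc (Suc k))) + sz 0 (g k)"
    by (simp add: gt_sz[OF g] atLeast0LessThan)
  have other: "l \<noteq> Suc k \<Longrightarrow> h l = g l" for l by (simp add: h_def bk_other)
  show "wt 0 h = wt 0 g \<circ> Transposition.transpose k (Suc k)"
  proof
    fix l
    consider "l = k" | "l = Suc k" | "l \<noteq> k" "l \<noteq> Suc k" by blast
    then show "wt 0 h l = (wt 0 g \<circ> Transposition.transpose k (Suc k)) l"
    proof cases
      case 1
      then show ?thesis using sum wt_add[OF g, of 0 "Suc k"] wt_add[OF g, of 0 k] wt_add[OF h, of 0 k] other[of k] by simp
    next
      case 2
      then show ?thesis using sum wt_add[OF g, of 0 "Suc k"] wt_add[OF g, of 0 k] wt_add[OF h, of 0 "Suc k"] other[of "Suc (Suc k)"] by simp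
    next
      case 3
      then show ?thesis by (simp add: wt_def other)
    qed
  qed
qed

section \<open>Good patterns\<close>

text \<open>The Littlewood--Richardson condition relative to f: with columns read from the right, f
  plus the content read so far remains a partition after every column.\<close>

definition good :: "(nat \<Rightarrow> nat) \<Rightarrow> (nat \<Rightarrow> nat \<Rightarrow> nat) \<Rightarrow> bool" where
  "good f g \<longleftrightarrow> (\<forall>j k. f (Suc k) + wt j g (Suc k) \<le> f k + wt j g k)"

definition bad_at :: "(nat \<Rightarrow> nat) \<Rightarrow> (nat \<Rightarrow> nat \<Rightarrow> nat) \<Rightarrow> nat \<Rightarrow> nat \<Rightarrow> bool" where
  "bad_at f g j k \<longleftrightarrow> f k + wt j g k < f (Suc k) + wt j g (Suc k)"

text \<open>
  The tableau read column by column from the right first fails to keep \<open>f + wt j g\<close> a partition at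
  column \<open>bad_col\<close>, where the letter \<open>bad_letter\<close> is missing.
\<close>

definition bad_col :: "(nat \<Rightarrow> nat) \<Rightarrow> (nat \<Rightarrow> nat \<Rightarrow> nat) \<Rightarrow> nat" where
  "bad_col f g = (GREATEST j. \<exists>k. bad_at f g j k)"

definition bad_letter :: "(nat \<Rightarrow> nat) \<Rightarrow> (nat \<Rightarrow> nat \<Rightarrow> nat) \<Rightarrow> nat" where
  "bad_letter f g = (LEAST k. bad_at f g (bad_col f g) k)"

text \<open>Rows before q pass column j in all three levels involved, so nothing can be reflected
  there once the tableau is cut before column j. Row q has the letter \<open>Suc k\<close> in column
  j; its upper end is cut to j.\<close>

definition swap_bad :: "(nat \<Rightarrow> nat) \<Rightarrow> (nat \<Rightarrow> nat \<Rightarrow> nat) \<Rightarrow> nat \<Rightarrow> nat \<Rightarrow> nat" where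
  "swap_bad f g = (let j = bad_col f g; k = bad_letter f g in bk k (card {i. j < g (Suc k) i}) j g)"

context
  fixes N f h g
  assumes f: "ptn f" "\<And>i. N \<le> i \<Longrightarrow> f i = 0" and g: "g \<in> gt N h" and bad: "\<not> good f g"
begin

lemma wt_large: "h 0 \<le> j \<Longrightarrow> wt j g k = 0"
proof -
  assume "h 0 \<le> j"
  then have "g l i - j = 0" for l i
    using gt_le[OF g, of l i] ptn_antimono[OF gt_shape[OF g], of 0 i] by simp
  then show ?thesis by (simp add: wt_def gt_sz[OF g])
qed

lemma bad_col: "\<exists>k. bad_at f g (bad_col f g) k" and bad_col_ge: "bad_at f g j k \<Longrightarrow> j \<le> bad_col f g"
proof -
  have bnd: "j \<le> h 0" if ex: "\<exists>k. bad_at f g j k" for j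
  proof (rule ccontr)
    assume "\<not> j \<le> h 0"
    then have w: "wt j g k = 0" for k by (intro wt_large) simp
    obtain k where "bad_at f g j k" using ex by blast
    with w ptn_antimono[OF f(1), of k "Suc k"] show False by (simp add: bad_at_def)
  qed
  have ex: "\<exists>j. \<exists>k. bad_at f g j k" using bad by (auto simp: good_def bad_at_def not_le)
  show "\<exists>k. bad_at f g (bad_col f g) k"
    unfolding bad_col_def using ex bnd by (rule GreatestI_ex_nat)
  show "j \<le> bad_col f g" if "bad_at f g j k"
    unfolding bad_col_def using that bnd by (intro Greatest_le_nat) auto
qed

lemma bad_letter: "bad_at f g (bad_col f g) (bad_letter f g)"
  unfolding bad_letter_def by (rule LeastI_ex) (rule bad_col)

lemma bad_letter_less: "Suc (bad_letter f g) < N"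
proof (rule ccontr)
  assume "\<not> ?thesis"
  then have "f (Suc (bad_letter f g)) = 0" "wt (bad_col f g) g (Suc (bad_letter f g)) = 0"
    using f(2) wt_zero[OF g] by auto
  then show False using bad_letter by (simp add: bad_at_def)
qed

text \<open>The inequality holds at column j + 1 and fails at column j, while one column changes
  each weight by at most 1. So column j contains the letter k + 1 but not k, and the failure is by
  exactly 1.\<close>

lemma bad_columns:
  defines "j \<equiv> bad_col f g" and "k \<equiv> bad_letter f g"
  defines "q \<equiv> card {i. j < g (Suc k) i}"
  shows "card {i. j < g k i} = q" "card {i. j < g (Suc (Suc k)) i} = Suc q"
    "f (Suc k) + wt j g (Suc k) = Suc (f k + wt j g k)"
proof -
  have b: "f k + wt j g k < f (Suc k) + wt j g (Suc k)"
    using bad_letter unfolding bad_at_def j_def k_def .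
  have nb: "f (Suc k) + wt (Suc j) g (Suc k) \<le> f k + wt (Suc j) g k"
  proof (rule ccontr)
    assume "\<not> ?thesis"
    then have "bad_at f g (Suc j) k" by (simp add: bad_at_def)
    from bad_col_ge[OF this] show False by (simp add: j_def)
  qed
  note w = wt_Suc[OF g, of j k] wt_Suc[OF g, of j "Suc k"]
    card_column_up[OF g, of j k] card_column_up[OF g, of j "Suc k"]
    card_column_diag[OF g, of j k] card_column_diag[OF g, of j "Suc k"]
  show "card {i. j < g k i} = q" using b nb w unfolding q_def by linarith
  show "card {i. j < g (Suc (Suc k)) i} = Suc q" using b nb w unfolding q_def by linarith
  show "f (Suc k) + wt j g (Suc k) = Suc (f k + wt j g k)" using b nb w by linarith
qed

lemma bad_bk_ok:
  defines "j \<equiv> bad_col f g" and "k \<equiv> bad_letter f g"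
  defines "q \<equiv> card {i. j < g (Suc k) i}"
  shows "bk_ok k q j g"
proof -
  note c = ptn_less_card_iff[OF gt_ptn[OF g], of _ j]
  note b = bad_columns[folded j_def k_def, folded q_def]
  have "\<not> j < g (Suc k) q" using c[of q "Suc k"] unfolding q_def by simp
  moreover have "j < g (Suc (Suc k)) q" using c[of q "Suc (Suc k)"] b(2) by simp
  moreover have "q = 0 \<or> j < g k (q - 1)" using c[of "q - 1" k] b(1) by auto
  ultimately show ?thesis by (auto simp: bk_ok_def)
qed

lemma swap_bad_in_gt: "swap_bad f g \<in> gt N h"
  unfolding swap_bad_def Let_def by (rule bk_in_gt[OF g bad_bk_ok bad_letter_less])

lemma swap_bad_right:
  assumes "bad_col f g \<le> j'"
  shows "wt j' (swap_bad f g) = wt j' g"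
proof -
  define j k where jk: "j = bad_col f g" "k = bad_letter f g"
  define q where "q = card {i. j < g (Suc k) i}"
  note ok = bad_bk_ok[folded jk, folded q_def]
  have s: "swap_bad f g = bk k q j g" by (simp add: swap_bad_def Let_def jk q_def)
  have "sz j' (bk k q j g l) = sz j' (g l)" for l
  proof (cases "l = Suc k")
    case True
    have "bk k q j g (Suc k) i - j' = g (Suc k) i - j'" for i
    proof (cases "i < q")
      case False
      then have "\<not> j < g (Suc k) i"
        using ptn_less_card_iff[OF gt_ptn[OF g], of i j "Suc k"] unfolding q_def by simp
      moreover have "bk k q j g (Suc k) i \<le> j"
      proof -
        have "bk k q j g (Suc k) i \<le> bk k q j g (Suc k) q"
          using ptn_antimono[OF gt_ptn[OF bk_in_gt[OF g ok]], of q i "Suc k"] False bad_letter_less[folded jk] by simp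
        also have "\<dots> \<le> j" using bk_le[OF g ok, of q] by simp
        finally show ?thesis .
      qed
      ultimately show ?thesis using assms jk by simp
    qed (simp add: bk_def)
    then show ?thesis unfolding True
      using gt_sz[OF g] gt_sz[OF bk_in_gt[OF g ok]] bad_letter_less[folded jk] by simp
  qed (simp add: bk_other)
  then show ?thesis unfolding s wt_def by simp
qed

text \<open>The column, the letter and q are determined by the columns from \<open>bad_col\<close>
  on, which the swap keeps. A second swap therefore uses the same data and undoes the first.\<close>

lemma swap_bad_same:
  "bad_col f (swap_bad f g) = bad_col f g" "bad_letter f (swap_bad f g) = bad_letter f g"
  "\<not> good f (swap_bad f g)" "swap_bad f (swap_bad f g) = g"
proof -
  define j k where jk: "j = bad_col f g" "k = bad_letter f g"
  define q where "q = card {i. j < g (Suc k) i}"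
  note ok = bad_bk_ok[folded jk, folded q_def]
  have s: "swap_bad f g = bk k q j g" by (simp add: swap_bad_def Let_def jk q_def)
  have e: "bad_at f (swap_bad f g) j' = bad_at f g j'" if "j \<le> j'" for j'
    using swap_bad_right[of j'] that by (intro ext) (simp add: bad_at_def jk)
  have "\<exists>k. bad_at f (swap_bad f g) j k" using e[of j] bad_col jk by auto
  moreover have "j' \<le> j" if "\<exists>k. bad_at f (swap_bad f g) j' k" for j'
    using that e[of j'] bad_col_ge[of j'] jk by (cases "j \<le> j'") auto
  ultimately show 1: "bad_col f (swap_bad f g) = bad_col f g"
    unfolding jk[symmetric] by (subst bad_col_def) (rule Greatest_equality)
  show 2: "bad_letter f (swap_bad f g) = bad_letter f g"
    unfolding bad_letter_def 1 using e[of j] jk by simp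
  have "bad_at f (swap_bad f g) j k" using e[of j] bad_letter jk by simp
  then show "\<not> good f (swap_bad f g)" by (auto simp: good_def bad_at_def not_le)
  have "card {i. j < swap_bad f g (Suc k) i} = q"
  proof -
    note h = swap_bad_in_gt
    have "bk k q j g (Suc k) q \<le> j" using bk_le[OF g ok, of q] by simp
    then have "card {i. j < swap_bad f g (Suc k) i} \<le> q"
      using ptn_less_card_iff[OF gt_ptn[OF h], of q j "Suc k"] s by simp
    moreover have "card {i. j < g k i} \<le> card {i. j < swap_bad f g (Suc k) i}"
      using card_column_up[OF h, of j k] by (simp add: s bk_other)
    ultimately show ?thesis using bad_columns(1)[folded jk, folded q_def] by simp
  qed
  then have "swap_bad f (swap_bad f g) = bk k q j (swap_bad f g)"
    using swap_bad_def[of f "swap_bad f g", unfolded Let_def 1 2, folded jk] by simp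
  then show "swap_bad f (swap_bad f g) = g"
    using bk_bk[OF g ok] s by simp
qed

text \<open>Before column j the counts of the two letters are exchanged; from j on, f plus weight at
  k + 1 exceeds that at k by 1. The extra \<open>Suc\<close> is the difference of \<rho> at k and k
  + 1: altogether f + wt + \<rho> has these two entries exchanged.\<close>

lemma swap_bad_wt:
  defines "k \<equiv> bad_letter f g"
  shows "Suc (f k + wt 0 (swap_bad f g) k) = f (Suc k) + wt 0 g (Suc k)"
    "f (Suc k) + wt 0 (swap_bad f g) (Suc k) = Suc (f k + wt 0 g k)"
    "l \<noteq> k \<Longrightarrow> l \<noteq> Suc k \<Longrightarrow> wt 0 (swap_bad f g) l = wt 0 g l"
proof -
  define j where "j = bad_col f g"
  define q where "q = card {i. j < g (Suc k) i}"
  let ?a = "g k" and ?b = "g (Suc k)" and ?c = "g (Suc (Suc k))"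
  note ok = bad_bk_ok[folded j_def, folded k_def, folded q_def]
  note h = swap_bad_in_gt
  have s: "swap_bad f g = bk k q j g" by (simp add: swap_bad_def Let_def j_def k_def q_def)
  note b = bad_columns[folded j_def, folded k_def, folded q_def]
  have kN: "Suc k < N" using bad_letter_less k_def by simp
  note c = ptn_less_card_iff[OF gt_ptn[OF g], of _ j]
  have ca: "j < ?a i \<longleftrightarrow> i < q" for i using c[of i k] b(1) by simp
  have cb: "j < ?b i \<longleftrightarrow> i < q" for i using c[of i "Suc k"] q_def by simp
  have cc: "j < ?c i \<longleftrightarrow> i < Suc q" for i using c[of i "Suc (Suc k)"] b(2) by simp
  have qN: "q < N" using cc[of q] gt_zero'[OF g, of q "Suc (Suc k)"] by (cases "q < N") auto
  have split: "{..<N} = {..<q} \<union> {q..<N}" and split': "{q..<N} = insert q {Suc q..<N}" using qN by auto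
  have sp: "(\<Sum>i<N. F i) = (\<Sum>i<q. F i) + (\<Sum>i\<in>{q..<N}. F i)" for F :: "nat \<Rightarrow> nat"
    unfolding split by (rule sum.union_disjoint) auto
  have sp': "(\<Sum>i\<in>{q..<N}. F i) = F q + (\<Sum>i\<in>{Suc q..<N}. F i)" for F :: "nat \<Rightarrow> nat"
    unfolding split' by (subst sum.insert) auto
  have above: "(\<Sum>i<q. F i - j) + q * j = (\<Sum>i<q. F i)" if "\<And>i. i < q \<Longrightarrow> j < F i" for F :: "nat \<Rightarrow> nat"
  proof -
    have "(\<Sum>i<q. F i - j) + q * j = (\<Sum>i<q. (F i - j) + j)" by (simp add: sum.distrib)
    also have "\<dots> = (\<Sum>i<q. F i)" using that by (intro sum.cong) (auto simp: less_imp_le)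
    finally show ?thesis .
  qed
  have below: "(\<Sum>i\<in>{x..<N}. F i - j) = 0" if "\<And>i. x \<le> i \<Longrightarrow> \<not> j < F i" for F :: "nat \<Rightarrow> nat" and x
    using that by (intro sum.neutral) (auto simp: not_less)
  have ja: "sz j ?a + q * j = (\<Sum>i<q. ?a i)"
    using above[of ?a] below[of q ?a] ca by (simp add: gt_sz[OF g] sp)
  have jb: "sz j ?b + q * j = (\<Sum>i<q. ?b i)"
    using above[of ?b] below[of q ?b] cb by (simp add: gt_sz[OF g] sp)
  have jc: "sz j ?c + q * j + j = (\<Sum>i<q. ?c i) + ?c q"
  proof -
    have "sz j ?c = (\<Sum>i<q. ?c i - j) + (?c q - j)"
      using below[of "Suc q" ?c] cc by (simp add: gt_sz[OF g] sp sp')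
    moreover have "j < ?c q" using cc by simp
    moreover have "(\<Sum>i<q. ?c i - j) + q * j = (\<Sum>i<q. ?c i)" using above[of ?c] cc by simp
    ultimately show ?thesis by linarith
  qed
  have ga: "sz 0 ?a = (\<Sum>i<q. ?a i) + (\<Sum>i\<in>{q..<N}. ?a i)" by (simp add: gt_sz[OF g] sp)
  have gb: "sz 0 ?b = (\<Sum>i<q. ?b i) + (\<Sum>i\<in>{q..<N}. ?b i)" by (simp add: gt_sz[OF g] sp)
  have gc: "sz 0 ?c = (\<Sum>i<q. ?c i) + ?c q + (\<Sum>i\<in>{Suc q..<N}. ?c i)" by (simp add: gt_sz[OF g] sp sp')
  note sum = bk_sum[OF g ok kN qN, folded s]
  have o: "swap_bad f g k = ?a" "swap_bad f g (Suc (Suc k)) = ?c" by (simp_all add: s bk_other)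
  note w = wt_add[OF g, of 0 k] wt_add[OF g, of 0 "Suc k"] wt_add[OF h, of 0 k, unfolded o]
    wt_add[OF h, of 0 "Suc k", unfolded o] wt_add[OF g, of j k] wt_add[OF g, of j "Suc k"]
  show "Suc (f k + wt 0 (swap_bad f g) k) = f (Suc k) + wt 0 g (Suc k)"
    using w sum ja jb jc ga gb gc b(3) by linarith
  show "f (Suc k) + wt 0 (swap_bad f g) (Suc k) = Suc (f k + wt 0 g k)"
    using w sum ja jb jc ga gb gc b(3) by linarith
  show "wt 0 (swap_bad f g) l = wt 0 g l" if "l \<noteq> k" "l \<noteq> Suc k" for l
    using that by (simp add: wt_def s bk_other)
qed

end

text \<open>The tableau whose row i is filled with the letter i.\<close>

definition canonical :: "(nat \<Rightarrow> nat) \<Rightarrow> nat \<Rightarrow> nat \<Rightarrow> nat" where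
  "canonical f k i = (if i < k then f i else 0)"

lemma canonical_in_gt: "ptn f \<Longrightarrow> (\<And>i. N \<le> i \<Longrightarrow> f i = 0) \<Longrightarrow> canonical f \<in> gt N f"
  by (auto simp: gt_def canonical_def ptn_antimono)

lemma sz_canonical: "sz j (canonical f k) = (\<Sum>i<k. f i - j)"
  by (subst sz_eq[of k]) (auto simp: canonical_def)

lemma wt_canonical: "wt j (canonical f) k = f k - j"
  by (simp add: wt_def sz_canonical)

text \<open>Suppose row i is not full at some level above i. Choose the column j of failure as far
  right as possible, then i as high as possible, then k as the last level where row i does not pass
  column j. The letter k stands in box (i, j), but k - 1 does not occur from column j on: rows above
  i are already full, and those from i on do not reach that far. This contradicts goodness.\<close>

lemma good_zero_canonical:
  assumes g: "g \<in> gt N f" and gd: "good (\<lambda>_. 0) g"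
  shows "g = canonical f"
proof -
  have full: "f i \<le> g k i" if "i < k" for k i
  proof (rule ccontr)
    assume "\<not> f i \<le> g k i"
    define P where "P j = (\<exists>i k. i < k \<and> g k i \<le> j \<and> j < f i)" for j
    have "P (g k i)" using that \<open>\<not> f i \<le> g k i\<close> by (auto simp: P_def not_le)
    have bnd: "j \<le> f 0" if "P j" for j
      using that ptn_antimono[OF gt_shape[OF g], of 0] by (auto simp: P_def) (meson le_trans less_imp_le zero_le)
    define j where "j = (GREATEST j. P j)"
    have Pj: "P j" unfolding j_def using \<open>P (g k i)\<close> bnd by (rule GreatestI_nat)
    have nP: "\<not> P j'" if "j < j'" for j'
      using Greatest_le_nat[of P j' "f 0"] bnd that unfolding j_def by auto
    define i where "i = (LEAST i. \<exists>k. i < k \<and> g k i \<le> j \<and> j < f i)"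
    have ex: "\<exists>i k. i < k \<and> g k i \<le> j \<and> j < f i" using Pj by (simp add: P_def)
    have Pi: "\<exists>k. i < k \<and> g k i \<le> j \<and> j < f i" unfolding i_def by (rule LeastI_ex) (rule ex)
    have ni: "j < g k i'" if "i' < i" "i' < k" "j < f i'" for i' k
      using not_less_Least[of i' "\<lambda>i. \<exists>k. i < k \<and> g k i \<le> j \<and> j < f i"] that unfolding i_def by (auto simp: not_le)
    have fi: "j < f i" using Pi by blast
    have above: "g l i' = f i'" if "i' < i" "i' < l" for i' l
    proof (rule ccontr)
      assume ne: "g l i' \<noteq> f i'"
      then have lt: "g l i' < f i'" using gt_le[OF g, of l i'] by simp
      have "j < f i'" using fi ptn_antimono[OF gt_shape[OF g], of i' i] that by simp
      then have "j < g l i'" using ni that by blast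
      then show False using nP[of "g l i'"] lt that by (auto simp: P_def)
    qed
    define k where "k = (GREATEST k. g k i \<le> j)"
    obtain k0 where k0: "i < k0" "g k0 i \<le> j" using Pi by blast
    have bk: "k \<le> N" if "g k i \<le> j" for k
      using that fi gt_top[OF g, of k] by (cases "N \<le> k") auto
    have k: "g k i \<le> j" unfolding k_def using k0(2) bk by (rule GreatestI_nat)
    have "k0 \<le> k" unfolding k_def using k0(2) bk by (rule Greatest_le_nat)
    then have ik: "i < k" using k0 by simp
    have Sk: "j < g (Suc k) i"
      using Greatest_le_nat[of "\<lambda>k. g k i \<le> j" "Suc k" N] bk unfolding k_def by (auto simp: not_le[symmetric])
    obtain m where m: "k = Suc m" using ik by (cases k) auto
    have lowz: "g l i' - j = 0" if "i \<le> i'" "l \<le> k" for l i'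
      using that k ptn_antimono[OF gt_ptn[OF g, of l], of i i'] gt_mono[OF g, of l k i] by simp
    have "sz j (g k) = sz j (g m)"
      unfolding gt_sz[OF g]
    proof (rule sum.cong[OF refl])
      fix i' show "g k i' - j = g m i' - j"
      proof (cases "i' < i")
        case True
        then have "i' < m" using ik m by simp
        then show ?thesis using above[OF True, of k] above[OF True, of m] ik True m by simp
      next
        case False
        then show ?thesis using lowz[of i' k] lowz[of i' m] m by simp
      qed
    qed
    then have "wt j g m = 0" using m by (simp add: wt_def)
    moreover have "sz j (g k) < sz j (g (Suc k))"
      unfolding gt_sz[OF g]
    proof (rule sum_strict_mono_ex1)
      have "i < N" using gt_zero'[OF g, of i "Suc k"] Sk by (cases "i < N") auto
      then show "\<exists>a\<in>{..<N}. g k a - j < g (Suc k) a - j" using k Sk by (intro bexI[of _ i]) auto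
    qed (auto intro: diff_le_mono gt_up[OF g])
    then have "0 < wt j g (Suc m)" using m by (simp add: wt_def)
    ultimately show False using gd[unfolded good_def, THEN spec[of _ j], THEN spec[of _ m]] by simp
  qed
  show ?thesis
  proof (intro ext)
    fix k i show "g k i = canonical f k i"
      using full[of i k] gt_le[OF g, of k i] gt_zero[OF g, of k i] by (auto simp: canonical_def)
  qed
qed

lemma good_canonical: "ptn f \<Longrightarrow> ptn h \<Longrightarrow> good f (canonical h)"
  unfolding good_def wt_canonical
  using ptn_antimono[of f _ "Suc _"] ptn_antimono[of h _ "Suc _"]
  by (intro allI add_mono diff_le_mono) simp_all

section \<open>Monomials and alternants\<close>

definition xpow :: "(nat \<Rightarrow> nat) \<Rightarrow> pseries" where
  "xpow a = Abs_pseries (\<lambda>\<alpha>. if Poly_Mapping.lookup \<alpha> = a then 1 else 0)"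

lemma pcoeff_X: "pcoeff (xpow a) \<alpha> = (if Poly_Mapping.lookup \<alpha> = a then 1 else 0)"
  by (simp add: xpow_def Abs_pseries_inverse)

lemma X_mult:
  assumes "\<And>i. N \<le> i \<Longrightarrow> a i = 0" "\<And>i. N \<le> i \<Longrightarrow> c i = 0"
  shows "xpow a * xpow c = xpow (\<lambda>i. a i + c i)"
proof (rule pseries_eqI)
  fix \<alpha>
  have la: "Poly_Mapping.lookup (expvec a) = a" "Poly_Mapping.lookup (expvec c) = c"
    using assms by (intro lookup_expvec finite_zero_outside[of N]; simp)+
  have key: "Poly_Mapping.lookup \<beta> = a \<longleftrightarrow> \<beta> = expvec a" "Poly_Mapping.lookup \<beta> = c \<longleftrightarrow> \<beta> = expvec c" for \<beta>
    using la by (metis lookup_inject)+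
  have "pcoeff (xpow a * xpow c) \<alpha> = (\<Sum>z | fst z + snd z = \<alpha>. if z = (expvec a, expvec c) then 1 else 0)"
    unfolding times_pseries.rep_eq
    by (intro sum.cong) (auto simp: pcoeff_X key split: if_splits)
  also have "\<dots> = (if expvec a + expvec c = \<alpha> then 1 else 0)"
    by (subst sum.delta) (auto intro: finite_subset[OF _ finite_splittings[of \<alpha>]])
  also have "expvec a + expvec c = \<alpha> \<longleftrightarrow> Poly_Mapping.lookup \<alpha> = (\<lambda>i. a i + c i)"
    by (auto simp: fun_eq_iff lookup_add la intro!: poly_mapping_eqI)
  finally show "pcoeff (xpow a * xpow c) \<alpha> = pcoeff (xpow (\<lambda>i. a i + c i)) \<alpha>" by (simp add: pcoeff_X)
qed

lemma pcoeff_sum: "pcoeff (\<Sum>x\<in>A. F x) \<alpha> = (\<Sum>x\<in>A. pcoeff (F x) \<alpha>)"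
  by (induction A rule: infinite_finite_induct) (simp_all add: zero_pseries.rep_eq plus_pseries.rep_eq)

lemma pcoeff_of_int_mult: "pcoeff (of_int z * F) \<alpha> = z * pcoeff F \<alpha>"
proof -
  have n: "pcoeff (of_nat n * F) \<alpha> = int n * pcoeff F \<alpha>" for n
    by (induction n) (simp_all add: zero_pseries.rep_eq plus_pseries.rep_eq distrib_right)
  show ?thesis
  proof (cases z rule: int_cases2)
    case (nonneg n)
    then show ?thesis using n by simp
  next
    case (nonpos n)
    then show ?thesis using n by (simp add: uminus_pseries.rep_eq)
  qed
qed

text \<open>The product of the largest monomials in the order on exponent vectors arises in one way
  only, so its coefficient is nonzero. This permits cancelling alternants.\<close>

lemma pseries_mult_nonzero:
  assumes A: "finite {\<alpha>. pcoeff A \<alpha> \<noteq> 0}" "A \<noteq> 0" and F: "finite {\<alpha>. pcoeff F \<alpha> \<noteq> 0}" "F \<noteq> 0"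
  shows "A * F \<noteq> 0"
proof -
  have ne: "{\<alpha>. pcoeff G \<alpha> \<noteq> 0} \<noteq> {}" if "G \<noteq> 0" for G
    using that pseries_eqI[of G 0] by (auto simp: zero_pseries.rep_eq)
  define a where "a = Max {\<alpha>. pcoeff A \<alpha> \<noteq> 0}"
  define c where "c = Max {\<alpha>. pcoeff F \<alpha> \<noteq> 0}"
  have a: "pcoeff A a \<noteq> 0" and c: "pcoeff F c \<noteq> 0"
    using Max_in[OF A(1) ne[OF A(2)]] Max_in[OF F(1) ne[OF F(2)]] by (auto simp: a_def c_def)
  have am: "\<alpha> \<le> a" if "pcoeff A \<alpha> \<noteq> 0" for \<alpha> unfolding a_def using that A(1) by (intro Max_ge) auto
  have cm: "\<alpha> \<le> c" if "pcoeff F \<alpha> \<noteq> 0" for \<alpha> unfolding c_def using that F(1) by (intro Max_ge) auto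
  have "pcoeff (A * F) (a + c) = (\<Sum>z\<in>{(a, c)}. pcoeff A (fst z) * pcoeff F (snd z))"
    unfolding times_pseries.rep_eq case_prod_beta
  proof (rule sum.mono_neutral_right)
    show "finite {z. fst z + snd z = a + c}"
      by (rule finite_subset[OF _ finite_splittings[of "a + c"]]) auto
    show "\<forall>z\<in>{z. fst z + snd z = a + c} - {(a, c)}. pcoeff A (fst z) * pcoeff F (snd z) = 0"
    proof (rule ballI, rule ccontr)
      fix z assume z: "z \<in> {z. fst z + snd z = a + c} - {(a, c)}" "pcoeff A (fst z) * pcoeff F (snd z) \<noteq> 0"
      then have le: "fst z \<le> a" "snd z \<le> c" using am cm by auto
      have "\<not> fst z < a"
      proof
        assume "fst z < a"
        from add_less_le_mono[OF this le(2)] show False using z(1) by simp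
      qed
      then have "fst z = a" using leD[OF le(1)] by (cases "fst z" a rule: linorder_cases) simp_all
      then show False using z(1) by (cases z) auto
    qed
  qed auto
  then show ?thesis using a c by (auto simp: zero_pseries.rep_eq)
qed

definition alt :: "nat \<Rightarrow> (nat \<Rightarrow> nat) \<Rightarrow> pseries" where
  "alt N a = (\<Sum>w | w permutes {..<N}. of_int (sign w) * xpow (a \<circ> w))"

definition schur_poly :: "nat \<Rightarrow> (nat \<Rightarrow> nat) \<Rightarrow> pseries" where
  "schur_poly N f = (\<Sum>g\<in>gt N f. xpow (wt 0 g))"

text \<open>The staircase N - 1, ..., 1, 0; truncated subtraction extends it by 0.\<close>

definition \<rho> :: "nat \<Rightarrow> nat \<Rightarrow> nat" where
  "\<rho> N i = N - 1 - i"

lemma alt_transpose: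
  assumes "k < N" "l < N" "k \<noteq> l"
  shows "alt N (a \<circ> Transposition.transpose k l) = - alt N a"
proof -
  let ?t = "Transposition.transpose k l"
  have t: "?t permutes {..<N}" using assms by (intro permutes_swap_id) auto
  have s: "sign (?t \<circ> w) = - sign w" if "w permutes {..<N}" for w
    using that t assms(3) sign_compose[OF permutes_imp_permutation[OF _ t] permutes_imp_permutation[OF _ that]]
    by (simp add: sign_swap_id)
  have "alt N (a \<circ> ?t) = (\<Sum>w | w permutes {..<N}. - (of_int (sign w) * xpow (a \<circ> w)))"
    unfolding alt_def
    by (rule sum.reindex_bij_witness[where i = "\<lambda>w. ?t \<circ> w" and j = "\<lambda>w. ?t \<circ> w"])
      (auto simp: permutes_compose[OF _ t] s comp_assoc simp flip: comp_assoc)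
  then show ?thesis by (simp add: alt_def sum_negf)
qed

lemma transpose_Suc:
  "k < l \<Longrightarrow> Transposition.transpose k (Suc l) =
    Transposition.transpose l (Suc l) \<circ> Transposition.transpose k l \<circ> Transposition.transpose l (Suc l)"
  by (rule ext) (auto simp: Transposition.transpose_def)

text \<open>The symmetry of Schur polynomials, for any function of the content.
  \<open>bk_full\<close> gives it for adjacent transpositions, which generate all
  permutations.\<close>

lemma sum_gt_permute:
  fixes F :: "(nat \<Rightarrow> nat) \<Rightarrow> pseries"
  assumes "w permutes {..<N}"
  shows "(\<Sum>g\<in>gt N f. F (wt 0 g \<circ> w)) = (\<Sum>g\<in>gt N f. F (wt 0 g))"
proof -
  \<comment> \<open>Quantifying over F makes Q closed under composition: one permutation is absorbed
    into F.\<close>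
  define Q where "Q w \<longleftrightarrow> (\<forall>F :: (nat \<Rightarrow> nat) \<Rightarrow> pseries. (\<Sum>g\<in>gt N f. F (wt 0 g \<circ> w)) = (\<Sum>g\<in>gt N f. F (wt 0 g)))"
    for w :: "nat \<Rightarrow> nat"
  have comp: "Q (u \<circ> w)" if "Q u" "Q w" for u w
    unfolding Q_def
  proof
    fix F :: "(nat \<Rightarrow> nat) \<Rightarrow> pseries"
    have "(\<Sum>g\<in>gt N f. F (wt 0 g \<circ> (u \<circ> w))) = (\<Sum>g\<in>gt N f. (\<lambda>c. F (c \<circ> w)) (wt 0 g \<circ> u))"
      by (simp add: comp_assoc)
    also have "\<dots> = (\<Sum>g\<in>gt N f. F (wt 0 g \<circ> w))"
      using \<open>Q u\<close>[unfolded Q_def, THEN spec, of "\<lambda>c. F (c \<circ> w)"] .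
    also have "\<dots> = (\<Sum>g\<in>gt N f. F (wt 0 g))" using \<open>Q w\<close> by (simp add: Q_def)
    finally show "(\<Sum>g\<in>gt N f. F (wt 0 g \<circ> (u \<circ> w))) = (\<Sum>g\<in>gt N f. F (wt 0 g))" .
  qed
  have adj: "Q (Transposition.transpose k (Suc k))" if "Suc k < N" for k
    unfolding Q_def
    by (intro allI sum.reindex_bij_witness[where i = "\<lambda>g. bk k 0 (g (Suc (Suc k)) 0) g" and j = "\<lambda>g. bk k 0 (g (Suc (Suc k)) 0) g"])
      (use that in \<open>simp_all add: bk_full\<close>)
  have lt: "Q (Transposition.transpose k l)" if "k < l" "l < N" for k l
    using that
  proof (induction l)
    case (Suc l)
    show ?case
    proof (cases "k = l")
      case False
      then have "k < l" using Suc by simp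
      then show ?thesis unfolding transpose_Suc[OF \<open>k < l\<close>] using Suc adj by (intro comp) simp_all
    qed (use adj Suc in simp)
  qed simp
  have "Q w"
    using assms finite_lessThan[of N]
  proof (induction rule: permutes_induct)
    case id
    then show ?case by (simp add: Q_def comp_def)
  next
    case (swap k l p)
    then have "Q (Transposition.transpose k l)"
      using lt[of k l] lt[of l k] by (cases k l rule: linorder_cases) (auto simp: transpose_commute)
    with swap comp show ?case by blast
  qed
  then show ?thesis by (simp add: Q_def)
qed

text \<open>By symmetry, the Schur polynomial in the summand for w may be replaced by its copy
  permuted by w; the monomials then combine.\<close>

lemma alt_mult_schur_poly:
  assumes "\<And>i. N \<le> i \<Longrightarrow> a i = 0"
  shows "alt N a * schur_poly N f = (\<Sum>g\<in>gt N f. alt N (\<lambda>i. a i + wt 0 g i))"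
proof -
  have "alt N a * schur_poly N f = (\<Sum>w | w permutes {..<N}. of_int (sign w) * (xpow (a \<circ> w) * schur_poly N f))"
    by (simp add: alt_def sum_distrib_right mult.assoc)
  also have "\<dots> = (\<Sum>w | w permutes {..<N}. \<Sum>g\<in>gt N f. of_int (sign w) * xpow ((\<lambda>i. a i + wt 0 g i) \<circ> w))"
  proof (rule sum.cong[OF refl])
    fix w assume "w \<in> {w. w permutes {..<N}}"
    then have w: "w permutes {..<N}" by simp
    have aw: "(a \<circ> w) i = 0" if "N \<le> i" for i using assms[OF that] permutes_not_in[OF w, of i] that by simp
    have gw: "(wt 0 g \<circ> w) i = 0" if "N \<le> i" "g \<in> gt N f" for g i
      using wt_zero[OF that(2,1)] permutes_not_in[OF w, of i] that by simp
    have "schur_poly N f = (\<Sum>g\<in>gt N f. xpow (wt 0 g \<circ> w))"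
      unfolding schur_poly_def by (rule sum_gt_permute[OF w, symmetric])
    then have "xpow (a \<circ> w) * schur_poly N f = (\<Sum>g\<in>gt N f. xpow (a \<circ> w) * xpow (wt 0 g \<circ> w))"
      by (simp add: sum_distrib_left)
    also have "\<dots> = (\<Sum>g\<in>gt N f. xpow ((\<lambda>i. a i + wt 0 g i) \<circ> w))"
      using X_mult[of N "a \<circ> w"] aw gw by (intro sum.cong) (auto simp: comp_def)
    finally show "of_int (sign w) * (xpow (a \<circ> w) * schur_poly N f) =
      (\<Sum>g\<in>gt N f. of_int (sign w) * xpow ((\<lambda>i. a i + wt 0 g i) \<circ> w))" by (simp add: sum_distrib_left)
  qed
  also have "\<dots> = (\<Sum>g\<in>gt N f. alt N (\<lambda>i. a i + wt 0 g i))"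
    unfolding alt_def by (rule sum.swap)
  finally show ?thesis .
qed

text \<open>Patterns that are not good cancel: \<open>swap_bad\<close> exchanges two entries of f +
  wt + \<rho>, which changes the sign of the alternant.\<close>

lemma alt_mult_schur_poly_good:
  assumes f: "ptn f" "\<And>i. N \<le> i \<Longrightarrow> f i = 0"
  shows "alt N (\<lambda>i. f i + \<rho> N i) * schur_poly N h =
    (\<Sum>g | g \<in> gt N h \<and> good f g. alt N (\<lambda>i. f i + wt 0 g i + \<rho> N i))"
proof -
  let ?A = "\<lambda>g. alt N (\<lambda>i. f i + wt 0 g i + \<rho> N i)"
  let ?B = "{g \<in> gt N h. \<not> good f g}"
  have swap: "?A (swap_bad f g) = - ?A g" if g: "g \<in> gt N h" and bad: "\<not> good f g" for g
  proof -
    let ?k = "bad_letter f g"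
    note k = bad_letter_less[OF f g bad]
    note w = swap_bad_wt[OF f g bad]
    have r: "\<rho> N ?k = Suc (\<rho> N (Suc ?k))" using k by (simp add: \<rho>_def)
    have "(\<lambda>i. f i + wt 0 (swap_bad f g) i + \<rho> N i) =
      (\<lambda>i. f i + wt 0 g i + \<rho> N i) \<circ> Transposition.transpose ?k (Suc ?k)"
    proof
      fix i
      consider "i = ?k" | "i = Suc ?k" | "i \<noteq> ?k" "i \<noteq> Suc ?k" by blast
      then show "f i + wt 0 (swap_bad f g) i + \<rho> N i =
        ((\<lambda>i. f i + wt 0 g i + \<rho> N i) \<circ> Transposition.transpose ?k (Suc ?k)) i"
      proof cases
        case 1
        then show ?thesis using w(1) r by simp
      next
        case 2
        then show ?thesis using w(2) r by simp
      next
        case 3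
        then show ?thesis using w(3) by simp
      qed
    qed
    then show ?thesis using alt_transpose[of ?k N "Suc ?k"] k by simp
  qed
  have "(\<Sum>g\<in>?B. ?A g) = (\<Sum>g\<in>?B. - ?A g)"
    by (rule sum.reindex_bij_witness[where i = "swap_bad f" and j = "swap_bad f"])
      (auto simp: swap swap_bad_in_gt[OF f] swap_bad_same[OF f])
  then have neg: "(\<Sum>g\<in>?B. ?A g) = - (\<Sum>g\<in>?B. ?A g)" by (simp add: sum_negf)
  \<comment> \<open>A sum equal to its own negative vanishes, since the coefficients are integers;
    fixed points of the swap need no separate care.\<close>
  have zero: "(\<Sum>g\<in>?B. ?A g) = 0"
  proof (rule pseries_eqI)
    fix \<alpha>
    have "pcoeff (\<Sum>g\<in>?B. ?A g) \<alpha> = - pcoeff (\<Sum>g\<in>?B. ?A g) \<alpha>"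
      using arg_cong[OF neg, of "\<lambda>F. pcoeff F \<alpha>"] by (simp only: uminus_pseries.rep_eq)
    then show "pcoeff (\<Sum>g\<in>?B. ?A g) \<alpha> = pcoeff 0 \<alpha>" by (simp add: zero_pseries.rep_eq)
  qed
  have "alt N (\<lambda>i. f i + \<rho> N i) * schur_poly N h = (\<Sum>g\<in>gt N h. alt N (\<lambda>i. f i + \<rho> N i + wt 0 g i))"
    by (rule alt_mult_schur_poly) (simp add: f \<rho>_def)
  also have "\<dots> = (\<Sum>g\<in>gt N h. ?A g)" by (simp add: ac_simps)
  also have "\<dots> = (\<Sum>g | g \<in> gt N h \<and> good f g. ?A g) + (\<Sum>g\<in>?B. ?A g)"
  proof -
    have "gt N h = {g. g \<in> gt N h \<and> good f g} \<union> ?B" by auto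
    moreover have "finite {g. g \<in> gt N h \<and> good f g}" "finite ?B"
      using finite_gt[of N h] by (simp_all add: finite_subset)
    ultimately show ?thesis
      using sum.union_disjoint[of "{g. g \<in> gt N h \<and> good f g}" ?B ?A] by auto
  qed
  finally show ?thesis using zero by simp
qed

text \<open>The bialternant formula, obtained from the empty partition: only the canonical pattern
  is good.\<close>

lemma alt_schur_poly:
  assumes "ptn h" "\<And>i. N \<le> i \<Longrightarrow> h i = 0"
  shows "alt N (\<rho> N) * schur_poly N h = alt N (\<lambda>i. h i + \<rho> N i)"
proof -
  have "{g. g \<in> gt N h \<and> good (\<lambda>_. 0) g} = {canonical h}"
    using good_zero_canonical canonical_in_gt[OF assms] good_canonical[OF ptn_zero assms(1)] by blast
  then show ?thesis
    using alt_mult_schur_poly_good[OF ptn_zero, of N h] by (simp add: wt_canonical)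
qed

lemma alt_rho_nonzero: "alt N (\<rho> N) \<noteq> 0"
proof -
  have l: "Poly_Mapping.lookup (expvec (\<rho> N)) = \<rho> N"
    by (intro lookup_expvec finite_zero_outside[of N]) (simp add: \<rho>_def)
  have id: "w = id" if w: "w permutes {..<N}" and e: "\<rho> N = \<rho> N \<circ> w" for w
  proof
    fix i show "w i = id i"
    proof (cases "i < N")
      case True
      then have "w i < N" using permutes_in_image[OF w, of i] by simp
      then show ?thesis using True fun_cong[OF e, of i] by (simp add: \<rho>_def)
    next
      case False
      then show ?thesis using permutes_not_in[OF w, of i] by simp
    qed
  qed
  have "pcoeff (alt N (\<rho> N)) (expvec (\<rho> N)) =
    (\<Sum>w | w permutes {..<N}. sign w * (if \<rho> N = \<rho> N \<circ> w then 1 else 0))"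
    by (simp add: alt_def pcoeff_sum pcoeff_of_int_mult pcoeff_X l)
  also have "\<dots> = (\<Sum>w\<in>{id}. sign w * (if \<rho> N = \<rho> N \<circ> w then 1 else 0))"
    by (rule sum.mono_neutral_right) (use id in \<open>auto simp: finite_permutations permutes_id\<close>)
  finally show ?thesis by (auto simp: zero_pseries.rep_eq)
qed

lemma finite_support_X: "finite {\<alpha>. pcoeff (xpow a) \<alpha> \<noteq> 0}"
proof -
  have "{\<alpha>. pcoeff (xpow a) \<alpha> \<noteq> 0} \<subseteq> {\<alpha>. Poly_Mapping.lookup \<alpha> = a}" by (auto simp: pcoeff_X)
  moreover have "\<exists>\<beta>. {\<alpha>. Poly_Mapping.lookup \<alpha> = a} \<subseteq> {\<beta>}"
    by (cases "\<exists>\<beta>. Poly_Mapping.lookup \<beta> = a") (auto simp: lookup_inject)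
  ultimately show ?thesis by (meson finite.emptyI finite.insertI finite_subset)
qed

lemma finite_support_sum:
  assumes "finite A" "\<And>x. x \<in> A \<Longrightarrow> finite {\<alpha>. pcoeff (F x) \<alpha> \<noteq> 0}"
  shows "finite {\<alpha>. pcoeff (\<Sum>x\<in>A. F x) \<alpha> \<noteq> 0}"
proof (rule finite_subset)
  show "{\<alpha>. pcoeff (\<Sum>x\<in>A. F x) \<alpha> \<noteq> 0} \<subseteq> (\<Union>x\<in>A. {\<alpha>. pcoeff (F x) \<alpha> \<noteq> 0})"
    by (auto simp: pcoeff_sum dest: sum.not_neutral_contains_not_neutral)
qed (use assms in auto)

lemma finite_support_mult:
  assumes "finite {\<alpha>. pcoeff F \<alpha> \<noteq> 0}" "finite {\<alpha>. pcoeff G \<alpha> \<noteq> 0}"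
  shows "finite {\<alpha>. pcoeff (F * G) \<alpha> \<noteq> 0}"
proof (rule finite_subset)
  show "{\<alpha>. pcoeff (F * G) \<alpha> \<noteq> 0} \<subseteq>
    (\<lambda>(\<beta>, \<gamma>). \<beta> + \<gamma>) ` ({\<alpha>. pcoeff F \<alpha> \<noteq> 0} \<times> {\<alpha>. pcoeff G \<alpha> \<noteq> 0})"
  proof
    fix \<alpha> assume "\<alpha> \<in> {\<alpha>. pcoeff (F * G) \<alpha> \<noteq> 0}"
    then have "(\<Sum>(\<beta>, \<gamma>) | \<beta> + \<gamma> = \<alpha>. pcoeff F \<beta> * pcoeff G \<gamma>) \<noteq> 0" by (simp add: times_pseries.rep_eq)
    then obtain z where "z \<in> {(\<beta>, \<gamma>). \<beta> + \<gamma> = \<alpha>}" "(case z of (\<beta>, \<gamma>) \<Rightarrow> pcoeff F \<beta> * pcoeff G \<gamma>) \<noteq> 0"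
      by (rule sum.not_neutral_contains_not_neutral)
    then show "\<alpha> \<in> (\<lambda>(\<beta>, \<gamma>). \<beta> + \<gamma>) ` ({\<alpha>. pcoeff F \<alpha> \<noteq> 0} \<times> {\<alpha>. pcoeff G \<alpha> \<noteq> 0})" by force
  qed
qed (use assms in auto)

lemma finite_support_schur_poly: "finite {\<alpha>. pcoeff (schur_poly N f) \<alpha> \<noteq> 0}"
  unfolding schur_poly_def by (intro finite_support_sum finite_gt finite_support_X)

lemma good_ptn:
  assumes "ptn f" "\<And>i. N \<le> i \<Longrightarrow> f i = 0" "g \<in> gt N h" "good f g"
  shows "ptn (\<lambda>i. f i + wt 0 g i)"
  by (rule ptnI[of _ N]) (use assms wt_zero[OF assms(3)] in \<open>auto simp: good_def\<close>)

text \<open>After multiplication by the alternant of \<rho> the bialternant formula applies on both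
  sides; the nonzero factor is then cancelled.\<close>

lemma schur_poly_mult:
  assumes f: "ptn f" "\<And>i. N \<le> i \<Longrightarrow> f i = 0" and h: "ptn h" "\<And>i. N \<le> i \<Longrightarrow> h i = 0"
  shows "schur_poly N f * schur_poly N h = (\<Sum>g | g \<in> gt N h \<and> good f g. schur_poly N (\<lambda>i. f i + wt 0 g i))"
proof -
  let ?G = "{g. g \<in> gt N h \<and> good f g}"
  let ?S = "\<Sum>g\<in>?G. schur_poly N (\<lambda>i. f i + wt 0 g i)"
  have fin: "finite ?G" using finite_gt[of N h] by (simp add: finite_subset)
  have "alt N (\<rho> N) * (schur_poly N f * schur_poly N h) = alt N (\<lambda>i. f i + \<rho> N i) * schur_poly N h"
    by (simp add: alt_schur_poly[OF f, symmetric] mult.assoc)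
  also have "\<dots> = (\<Sum>g\<in>?G. alt N (\<lambda>i. f i + wt 0 g i + \<rho> N i))" by (rule alt_mult_schur_poly_good[OF f])
  also have "\<dots> = (\<Sum>g\<in>?G. alt N (\<rho> N) * schur_poly N (\<lambda>i. f i + wt 0 g i))"
    by (intro sum.cong refl alt_schur_poly[symmetric] good_ptn[OF f])
      (auto simp: f wt_zero)
  also have "\<dots> = alt N (\<rho> N) * ?S" by (simp add: sum_distrib_left)
  finally have z: "alt N (\<rho> N) * (schur_poly N f * schur_poly N h - ?S) = 0" by (simp add: right_diff_distrib)
  have "finite {\<alpha>. pcoeff (schur_poly N f * schur_poly N h - ?S) \<alpha> \<noteq> 0}"
  proof (rule finite_subset)
    show "{\<alpha>. pcoeff (schur_poly N f * schur_poly N h - ?S) \<alpha> \<noteq> 0} \<subseteq>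
      {\<alpha>. pcoeff (schur_poly N f * schur_poly N h) \<alpha> \<noteq> 0} \<union> {\<alpha>. pcoeff ?S \<alpha> \<noteq> 0}"
      by (auto simp: minus_pseries.rep_eq)
  qed (intro finite_UnI finite_support_mult finite_support_sum finite_support_schur_poly fin)
  moreover have "finite {\<alpha>. pcoeff (alt N (\<rho> N)) \<alpha> \<noteq> 0}"
    unfolding alt_def
  proof (rule finite_support_sum)
    show "finite {\<alpha>. pcoeff (of_int (sign w) * xpow (\<rho> N \<circ> w)) \<alpha> \<noteq> 0}" for w
      by (rule finite_subset[OF _ finite_support_X[of "\<rho> N \<circ> w"]]) (auto simp: pcoeff_of_int_mult)
  qed (simp add: finite_permutations)
  ultimately have "schur_poly N f * schur_poly N h - ?S = 0"
    using pseries_mult_nonzero[OF _ alt_rho_nonzero] z by blast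
  then show ?thesis by simp
qed

section \<open>Semistandard tableaux and patterns\<close>

definition pattern_of :: "(nat \<Rightarrow> nat) \<Rightarrow> (nat \<times> nat \<Rightarrow> nat) \<Rightarrow> nat \<Rightarrow> nat \<Rightarrow> nat" where
  "pattern_of f T k i = card {c. c < f i \<and> T (i, c) < k}"

definition tableau_of :: "(nat \<Rightarrow> nat) \<Rightarrow> (nat \<Rightarrow> nat \<Rightarrow> nat) \<Rightarrow> nat \<times> nat \<Rightarrow> nat" where
  "tableau_of f g = restrict (\<lambda>(i, c). LEAST m. c < g (Suc m) i) {(i, c). c < f i}"

lemma tableau_of_less_iff:
  assumes g: "g \<in> gt N f" and c: "c < f i"
  shows "tableau_of f g (i, c) < k \<longleftrightarrow> c < g k i"
proof -
  have ex: "\<exists>m. c < g (Suc m) i" using c gt_top[OF g, of "Suc N"] by (intro exI[of _ N]) simp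
  have T: "tableau_of f g (i, c) = (LEAST m. c < g (Suc m) i)" using c by (simp add: tableau_of_def)
  show ?thesis
  proof
    assume "tableau_of f g (i, c) < k"
    then have "Suc (LEAST m. c < g (Suc m) i) \<le> k" by (simp add: T)
    from gt_mono[OF g this, of i] show "c < g k i" using LeastI_ex[OF ex] by simp
  next
    assume k: "c < g k i"
    then obtain m where "k = Suc m" using gt_0[OF g, of i] by (cases k) auto
    then show "tableau_of f g (i, c) < k" using Least_le[of "\<lambda>m. c < g (Suc m) i" m] k by (simp add: T)
  qed
qed

context
  fixes N f T
  assumes f: "ptn f" and T: "T \<in> ssyt (lst f)" and N: "\<And>i c. c < f i \<Longrightarrow> T (i, c) < N"
begin

lemma tableau_row: "c \<le> d \<Longrightarrow> d < f i \<Longrightarrow> T (i, c) \<le> T (i, d)"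
  using T by (cases "c = d") (auto simp: ssyt_def diagram_lst[OF f])

lemma tableau_column: "i < i' \<Longrightarrow> c < f i' \<Longrightarrow> T (i, c) < T (i', c)"
  using T ptn_antimono[OF f, of i i'] by (auto simp: ssyt_def diagram_lst[OF f])

lemma pattern_of_iff: "c < f i \<Longrightarrow> c < pattern_of f T k i \<longleftrightarrow> T (i, c) < k"
proof -
  assume c: "c < f i"
  have fin: "finite {c. c < f i \<and> T (i, c) < k}" by simp
  show ?thesis
  proof
    assume "T (i, c) < k"
    then have "{..c} \<subseteq> {c. c < f i \<and> T (i, c) < k}" using c tableau_row[of _ c i] by fastforce
    from card_mono[OF fin this] show "c < pattern_of f T k i" by (simp add: pattern_of_def)
  next
    assume less: "c < pattern_of f T k i"
    show "T (i, c) < k"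
    proof (rule ccontr)
      assume n: "\<not> T (i, c) < k"
      have "{c. c < f i \<and> T (i, c) < k} \<subseteq> {..<c}"
      proof
        fix d assume "d \<in> {c. c < f i \<and> T (i, c) < k}"
        then show "d \<in> {..<c}" using n tableau_row[of c d i] by (cases "d < c") auto
      qed
      from card_mono[OF _ this] show False using less by (simp add: pattern_of_def)
    qed
  qed
qed

lemma pattern_of_in_gt: "pattern_of f T \<in> gt N f"
proof -
  have "pattern_of f T k = f" if "N \<le> k" for k
  proof
    fix i
    have "{c. c < f i \<and> T (i, c) < k} = {..<f i}" using N that by (auto intro: less_le_trans)
    then show "pattern_of f T k i = f i" by (simp add: pattern_of_def)
  qed
  moreover have "pattern_of f T k i \<le> pattern_of f T (Suc k) i" for k i
    unfolding pattern_of_def by (rule card_mono) auto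
  moreover have "pattern_of f T (Suc k) (Suc i) \<le> pattern_of f T k i" for k i
  proof -
    have "{c. c < f (Suc i) \<and> T (Suc i, c) < Suc k} \<subseteq> {c. c < f i \<and> T (i, c) < k}"
      using tableau_column[of i "Suc i"] ptn_antimono[OF f, of i "Suc i"] by fastforce
    then show ?thesis unfolding pattern_of_def by (intro card_mono) auto
  qed
  ultimately show ?thesis by (simp add: gt_def pattern_of_def)
qed

lemma tableau_of_pattern_of: "tableau_of f (pattern_of f T) = T"
proof
  fix z :: "nat \<times> nat"
  obtain i c where z: "z = (i, c)" by (cases z)
  show "tableau_of f (pattern_of f T) z = T z"
  proof (cases "c < f i")
    case True
    have "tableau_of f (pattern_of f T) (i, c) < k \<longleftrightarrow> T (i, c) < k" for k
      using tableau_of_less_iff[OF pattern_of_in_gt True] pattern_of_iff[OF True] by simp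
    then show ?thesis unfolding z by (metis less_irrefl linorder_neqE_nat)
  next
    case False
    then show ?thesis using T unfolding z
      by (auto simp: tableau_of_def ssyt_def diagram_lst[OF f] PiE_def extensional_def)
  qed
qed

end

lemma tableau_of_in_ssyt:
  assumes g: "g \<in> gt N f"
  shows "tableau_of f g \<in> ssyt (lst f)"
proof -
  note f = gt_shape[OF g]
  note iff = tableau_of_less_iff[OF g]
  have "tableau_of f g (i, c) \<le> tableau_of f g (i, d)" if "c < d" "d < f i" for i c d
  proof -
    have "d < g (Suc (tableau_of f g (i, d))) i" using iff[of d i] that by blast
    then have "tableau_of f g (i, c) < Suc (tableau_of f g (i, d))" using iff[of c i] that by simp
    then show ?thesis by simp
  qed
  moreover have col: "tableau_of f g (i, c) < tableau_of f g (i', c)" if "i < i'" "c < f i'" for i i' c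
    using that
  proof (induction i')
    case (Suc i')
    have c: "c < f i'" using Suc.prems ptn_antimono[OF f, of i' "Suc i'"] by simp
    let ?m = "tableau_of f g (Suc i', c)"
    have "c < g (Suc ?m) (Suc i')" using iff[of c "Suc i'"] Suc.prems by blast
    then have "c < g ?m i'" using gt_diag[OF g, of ?m i'] by simp
    then have "tableau_of f g (i', c) < ?m" using iff[OF c] by simp
    then show ?case using Suc.IH c Suc.prems by (cases "i = i'") auto
  qed simp
  moreover have "tableau_of f g \<in> {(i, j). j < f i} \<rightarrow>\<^sub>E UNIV" by (simp add: tableau_of_def)
  ultimately show ?thesis unfolding ssyt_def diagram_lst[OF f] by blast
qed

lemma pattern_of_tableau_of:
  assumes g: "g \<in> gt N f" shows "pattern_of f (tableau_of f g) = g"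
proof (intro ext)
  fix k i
  have "{c. c < f i \<and> tableau_of f g (i, c) < k} = {..<g k i}"
    using tableau_of_less_iff[OF g] gt_le[OF g, of k i] by auto
  then show "pattern_of f (tableau_of f g) k i = g k i" by (simp add: pattern_of_def)
qed

lemma wt_pattern_of:
  assumes f: "ptn f" and g: "pattern_of f T \<in> gt N f"
  shows "wt 0 (pattern_of f T) k = card {z \<in> diagram (lst f). T z = k}"
proof -
  have fin: "finite {i. 0 < f i}" using f by (simp add: ptn_def)
  let ?D = "\<lambda>P. {(i, c). c < f i \<and> P (T (i, c))}"
  have D: "?D P = (SIGMA i:{i. 0 < f i}. {c. c < f i \<and> P (T (i, c))})" for P by auto
  have finD: "finite (?D P)" for P unfolding D using fin by (intro finite_SigmaI) auto
  have s: "sz 0 (pattern_of f T l) = card (?D (\<lambda>t. t < l))" for l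
  proof -
    obtain M where M: "\<And>i. M \<le> i \<Longrightarrow> f i = 0" using ptn_eventually_zero[OF f] by blast
    have "sz 0 (pattern_of f T l) = (\<Sum>i<M. pattern_of f T l i)"
    proof -
      have "pattern_of f T l i = 0" if "M \<le> i" for i using gt_le[OF g, of l i] M[OF that] by simp
      then show ?thesis by (simp add: sz_eq[of M])
    qed
    also have "\<dots> = (\<Sum>i | 0 < f i. pattern_of f T l i)"
    proof (rule sum.mono_neutral_right)
      show "{i. 0 < f i} \<subseteq> {..<M}" using M by (auto intro: ccontr)
    qed (auto simp: pattern_of_def)
    also have "\<dots> = card (?D (\<lambda>t. t < l))"
      unfolding D[of "\<lambda>t. t < l"] using fin by (subst card_SigmaI) (auto simp: pattern_of_def)
    finally show ?thesis .
  qed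
  have "?D (\<lambda>t. t < Suc k) = ?D (\<lambda>t. t < k) \<union> ?D (\<lambda>t. t = k)" by auto
  then have "card (?D (\<lambda>t. t < Suc k)) = card (?D (\<lambda>t. t < k)) + card (?D (\<lambda>t. t = k))"
    using finD by (simp only:) (rule card_Un_disjoint, auto)
  moreover have "{z \<in> diagram (lst f). T z = k} = ?D (\<lambda>t. t = k)" by (auto simp: diagram_lst[OF f])
  ultimately show ?thesis by (simp add: wt_def s)
qed

lemma pcoeff_schur:
  assumes f: "ptn f" and \<alpha>: "\<And>i. N \<le> i \<Longrightarrow> Poly_Mapping.lookup \<alpha> i = 0"
  shows "pcoeff (schur_fun (lst f)) \<alpha> = int (card {g \<in> gt N f. wt 0 g = Poly_Mapping.lookup \<alpha>})"
proof -
  let ?A = "{T \<in> ssyt (lst f). \<forall>k. card {c \<in> diagram (lst f). T c = k} = Poly_Mapping.lookup \<alpha> k}"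
  let ?B = "{g \<in> gt N f. wt 0 g = Poly_Mapping.lookup \<alpha>}"
  have fin: "finite (diagram (lst f))"
    by (rule finite_subset[of _ "SIGMA i:{i. f i \<noteq> 0}. {..<f i}"])
      (use f in \<open>auto simp: diagram_lst ptn_def\<close>)
  have N: "T (i, c) < N" if "T \<in> ?A" "c < f i" for T i c
  proof (rule ccontr)
    assume "\<not> T (i, c) < N"
    then have "card {z \<in> diagram (lst f). T z = T (i, c)} = 0" using that(1) \<alpha> by simp
    moreover have "(i, c) \<in> {z \<in> diagram (lst f). T z = T (i, c)}" using that(2) by (simp add: diagram_lst[OF f])
    ultimately show False using fin by (auto simp: card_eq_0_iff)
  qed
  have "bij_betw (pattern_of f) ?A ?B"
  proof (rule bij_betw_byWitness[where f' = "tableau_of f"])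
    show "\<forall>T\<in>?A. tableau_of f (pattern_of f T) = T"
      using tableau_of_pattern_of[OF f] N by blast
    show "\<forall>g\<in>?B. pattern_of f (tableau_of f g) = g"
      using pattern_of_tableau_of by blast
    show "pattern_of f ` ?A \<subseteq> ?B"
    proof
      fix g assume "g \<in> pattern_of f ` ?A"
      then obtain T where T: "T \<in> ?A" "g = pattern_of f T" by blast
      have g: "g \<in> gt N f" unfolding T(2) by (intro pattern_of_in_gt[OF f]) (use N T in auto)
      moreover have "wt 0 g = Poly_Mapping.lookup \<alpha>"
        using wt_pattern_of[OF f g[unfolded T(2)]] T(1) unfolding T(2) by (intro ext) simp
      ultimately show "g \<in> ?B" by simp
    qed
    show "tableau_of f ` ?B \<subseteq> ?A"
    proof
      fix T assume "T \<in> tableau_of f ` ?B"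
      then obtain g where g: "g \<in> gt N f" "wt 0 g = Poly_Mapping.lookup \<alpha>" "T = tableau_of f g" by blast
      then show "T \<in> ?A"
        using tableau_of_in_ssyt[OF g(1)] wt_pattern_of[OF f, of T N] pattern_of_tableau_of[OF g(1)] by simp
    qed
  qed
  then have "card ?A = card ?B" by (rule bij_betw_same_card)
  then show ?thesis by (simp add: schur_fun_def Abs_pseries_inverse)
qed

lemma pcoeff_schur_poly: "pcoeff (schur_poly N f) \<alpha> = int (card {g \<in> gt N f. wt 0 g = Poly_Mapping.lookup \<alpha>})"
proof -
  have "pcoeff (schur_poly N f) \<alpha> = (\<Sum>g\<in>gt N f. if wt 0 g = Poly_Mapping.lookup \<alpha> then 1 else 0)"
    by (simp add: schur_poly_def pcoeff_sum pcoeff_X eq_commute)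
  also have "\<dots> = int (card {g \<in> gt N f. wt 0 g = Poly_Mapping.lookup \<alpha>})"
    using finite_gt[of N f] by (subst sum.inter_filter[symmetric]) auto
  finally show ?thesis .
qed

section \<open>The Littlewood--Richardson rule\<close>

definition lr_patterns :: "(nat \<Rightarrow> nat) \<Rightarrow> (nat \<Rightarrow> nat) \<Rightarrow> (nat \<Rightarrow> nat \<Rightarrow> nat) set" where
  "lr_patterns f h = {g \<in> gt (sz 0 f + sz 0 h) h. good f g}"

definition schur_terms :: "(nat \<Rightarrow> nat) \<Rightarrow> (nat \<Rightarrow> nat) \<Rightarrow> (nat \<Rightarrow> nat) multiset" where
  "schur_terms f h = image_mset (\<lambda>g i. f i + wt 0 g i) (mset_set (lr_patterns f h))"

lemma ptn_zero_beyond: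
  assumes f: "ptn f" and i: "sz 0 f \<le> i" shows "f i = 0"
proof (rule ccontr)
  assume nz: "f i \<noteq> 0"
  obtain N where N: "\<And>k. N \<le> k \<Longrightarrow> f k = 0" using ptn_eventually_zero[OF f] by blast
  have "i < N" using N nz by (cases "i < N") auto
  have "Suc i \<le> (\<Sum>k\<le>i. f k)"
    using sum_bounded_below[of "{..i}" 1 f] ptn_antimono[OF f, of _ i] nz by fastforce
  also have "\<dots> \<le> (\<Sum>k<N. f k)" using \<open>i < N\<close> by (intro sum_mono2) auto
  also have "\<dots> = sz 0 f" using N by (simp add: sz_eq[of N])
  finally show False using i by simp
qed

lemma sz_add:
  assumes "\<And>i. N \<le> i \<Longrightarrow> f i = 0" "\<And>i. N \<le> i \<Longrightarrow> h i = 0"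
  shows "sz 0 (\<lambda>i. f i + h i) = sz 0 f + sz 0 h"
  using assms by (simp add: sz_eq[of N] sum.distrib)

lemma gt_lower:
  assumes g: "g \<in> gt N h" and K: "\<And>k. K \<le> k \<Longrightarrow> wt 0 g k = 0"
  shows "g \<in> gt K h"
proof -
  have step: "g (Suc k) = g k" if "K \<le> k" for k
  proof -
    have e: "sz 0 (g (Suc k)) = sz 0 (g k)" using K[OF that] wt_add[OF g, of 0 k] by simp
    show ?thesis
    proof (rule ccontr)
      assume "g (Suc k) \<noteq> g k"
      then obtain i where "g (Suc k) i \<noteq> g k i" by auto
      then have i: "g k i < g (Suc k) i" using gt_up[OF g, of k i] by simp
      then have "i < N" using gt_zero'[OF g, of i "Suc k"] by (cases "i < N") auto
      then have "(\<Sum>i<N. g k i) < (\<Sum>i<N. g (Suc k) i)"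
        using i by (intro sum_strict_mono_ex1) (auto simp: gt_up[OF g])
      then show False using e by (simp add: gt_sz[OF g])
    qed
  qed
  have "g (K + d) = g K" for d by (induction d) (simp_all add: step)
  then have "g k = g K" if "K \<le> k" for k using that by (metis le_add_diff_inverse)
  then have "g k = h" if "K \<le> k" for k using that gt_top[OF g, of "max K N"] by (metis max.cobounded1 max.cobounded2)
  then show ?thesis using g by (simp add: gt_def)
qed

text \<open>For good g the shape f + wt 0 g is a partition of size \<open>sz 0 f + sz 0 h\<close>
  and has at most that many rows, so larger letters do not occur. The set is therefore independent
  of the number of variables.\<close>

lemma lr_patterns_eq:
  assumes f: "ptn f" and h: "ptn h" and N: "sz 0 f + sz 0 h \<le> N"
  shows "{g \<in> gt N h. good f g} = lr_patterns f h"
proof (intro subset_antisym subsetI)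
  fix g assume "g \<in> lr_patterns f h"
  then show "g \<in> {g \<in> gt N h. good f g}" using N by (auto simp: lr_patterns_def gt_def)
next
  fix g assume "g \<in> {g \<in> gt N h. good f g}"
  then have g: "g \<in> gt N h" "good f g" by auto
  have f0: "f i = 0" if "N \<le> i" for i using ptn_zero_beyond[OF f] N that by simp
  let ?p = "\<lambda>i. f i + wt 0 g i"
  have p: "ptn ?p" by (rule good_ptn[OF f f0 g])
  have "sz 0 (wt 0 g) = (\<Sum>i<N. wt 0 g i)" using wt_zero[OF g(1)] by (subst sz_eq[of N]) auto
  then have "sz 0 ?p = sz 0 f + sz 0 h"
    using sz_add[of N f "wt 0 g"] f0 wt_zero[OF g(1)] sum_wt[OF g(1), of 0 N] gt_top[OF g(1), of N] by simp
  then have "wt 0 g k = 0" if "sz 0 f + sz 0 h \<le> k" for k using ptn_zero_beyond[OF p, of k] that by simp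
  from gt_lower[OF g(1) this] show "g \<in> lr_patterns f h" using g(2) by (simp add: lr_patterns_def)
qed

lemma lr_patternsI:
  assumes "ptn f" "ptn h" "g \<in> gt N h" "good f g" shows "g \<in> lr_patterns f h"
proof -
  have "g \<in> gt (max N (sz 0 f + sz 0 h)) h" using assms(3) by (auto simp: gt_def)
  then show ?thesis using lr_patterns_eq[OF assms(1,2), of "max N (sz 0 f + sz 0 h)"] assms(4) by auto
qed

lemma finite_lr_patterns: "finite (lr_patterns f h)"
  unfolding lr_patterns_def using finite_gt by (rule rev_finite_subset) auto

lemma lr_patterns_ptn:
  assumes f: "ptn f" and g: "g \<in> lr_patterns f h"
  shows "ptn (\<lambda>i. f i + wt 0 g i)"
proof (rule good_ptn[OF f])
  show "g \<in> gt (sz 0 f + sz 0 h) h" "good f g" using g by (auto simp: lr_patterns_def)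
qed (use ptn_zero_beyond[OF f] in simp)

section \<open>Passage to finitely many variables\<close>

definition restr :: "nat \<Rightarrow> pseries \<Rightarrow> pseries" where
  "restr N F = Abs_pseries (\<lambda>\<alpha>. if Poly_Mapping.keys \<alpha> \<subseteq> {..<N} then pcoeff F \<alpha> else 0)"

lemma pcoeff_restr: "pcoeff (restr N F) \<alpha> = (if Poly_Mapping.keys \<alpha> \<subseteq> {..<N} then pcoeff F \<alpha> else 0)"
  by (simp add: restr_def Abs_pseries_inverse)

lemma pcoeff_mult_restr:
  assumes "Poly_Mapping.keys \<alpha> \<subseteq> {..<N}"
  shows "pcoeff (F * G) \<alpha> = pcoeff (restr N F * restr N G) \<alpha>"
  unfolding times_pseries.rep_eq
proof (rule sum.cong[OF refl], clarify)
  fix \<beta> \<gamma> :: monom assume a: "\<alpha> = \<beta> + \<gamma>"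
  have "Poly_Mapping.keys \<beta> \<subseteq> Poly_Mapping.keys (\<beta> + \<gamma>)" "Poly_Mapping.keys \<gamma> \<subseteq> Poly_Mapping.keys (\<beta> + \<gamma>)"
    by (auto simp: in_keys_iff lookup_add)
  then show "pcoeff F \<beta> * pcoeff G \<gamma> = pcoeff (restr N F) \<beta> * pcoeff (restr N G) \<gamma>"
    using assms by (auto simp: pcoeff_restr a)
qed

lemma keys_subset_iff: "Poly_Mapping.keys \<alpha> \<subseteq> {..<N} \<longleftrightarrow> (\<forall>i\<ge>N. Poly_Mapping.lookup (\<alpha> :: monom) i = 0)"
  by (auto simp: in_keys_iff subset_iff) (metis gr_implies_not0 leI)

lemma restr_schur:
  assumes f: "ptn f" shows "restr N (schur_fun (lst f)) = schur_poly N f"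
proof (rule pseries_eqI)
  fix \<alpha>
  show "pcoeff (restr N (schur_fun (lst f))) \<alpha> = pcoeff (schur_poly N f) \<alpha>"
  proof (cases "Poly_Mapping.keys \<alpha> \<subseteq> {..<N}")
    case True
    then show ?thesis using pcoeff_schur[OF f, of N \<alpha>] by (simp add: pcoeff_restr pcoeff_schur_poly keys_subset_iff)
  next
    case False
    then obtain i where "N \<le> i" "Poly_Mapping.lookup \<alpha> i \<noteq> 0" by (auto simp: keys_subset_iff)
    then have "wt 0 g \<noteq> Poly_Mapping.lookup \<alpha>" if "g \<in> gt N f" for g
      using wt_zero[OF that, of i 0] by auto
    then have e: "{g \<in> gt N f. wt 0 g = Poly_Mapping.lookup \<alpha>} = {}" by blast
    show ?thesis unfolding pcoeff_restr pcoeff_schur_poly e using False by simp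
  qed
qed

lemma pcoeff_sum_mset: "pcoeff (\<Sum>x\<in>#A. F x) \<alpha> = (\<Sum>x\<in>#A. pcoeff (F x) \<alpha>)"
  by (induction A) (simp_all add: zero_pseries.rep_eq plus_pseries.rep_eq)

text \<open>Coefficients are compared at one monomial, with N beyond its variables and beyond all
  letters in \<open>lr_patterns\<close>, so that the product rule in N variables applies.\<close>

lemma schur_mult:
  assumes f: "ptn f" and h: "ptn h"
  shows "schur_fun (lst f) * schur_fun (lst h) = (\<Sum>p\<in>#schur_terms f h. schur_fun (lst p))"
proof (rule pseries_eqI)
  fix \<alpha> :: monom
  obtain N0 where "\<forall>i\<ge>N0. Poly_Mapping.lookup \<alpha> i = 0" using lookup_eventually_zero by blast
  define N where "N = max N0 (sz 0 f + sz 0 h)"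
  have N: "Poly_Mapping.keys \<alpha> \<subseteq> {..<N}" "sz 0 f + sz 0 h \<le> N"
    unfolding keys_subset_iff N_def using \<open>\<forall>i\<ge>N0. _\<close> by auto
  have f0: "f i = 0" and h0: "h i = 0" if "N \<le> i" for i
    using ptn_zero_beyond[OF f, of i] ptn_zero_beyond[OF h, of i] that N(2) by simp_all
  have c: "pcoeff (schur_poly N p) \<alpha> = pcoeff (schur_fun (lst p)) \<alpha>" if "ptn p" for p
    using restr_schur[OF that, of N] N(1) pcoeff_restr[of N _ \<alpha>] by metis
  have "pcoeff (schur_fun (lst f) * schur_fun (lst h)) \<alpha> = pcoeff (schur_poly N f * schur_poly N h) \<alpha>"
    unfolding pcoeff_mult_restr[OF N(1), of "schur_fun (lst f)"] restr_schur[OF f] restr_schur[OF h] ..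
  also have "\<dots> = (\<Sum>g\<in>lr_patterns f h. pcoeff (schur_poly N (\<lambda>i. f i + wt 0 g i)) \<alpha>)"
    using schur_poly_mult[OF f f0 h h0] lr_patterns_eq[OF f h N(2)] by (simp add: pcoeff_sum)
  also have "\<dots> = (\<Sum>g\<in>lr_patterns f h. pcoeff (schur_fun (lst (\<lambda>i. f i + wt 0 g i))) \<alpha>)"
    by (intro sum.cong refl c lr_patterns_ptn[OF f])
  also have "\<dots> = pcoeff (\<Sum>p\<in>#schur_terms f h. schur_fun (lst p)) \<alpha>"
    by (simp add: pcoeff_sum_mset schur_terms_def multiset.map_comp comp_def sum_unfold_sum_mset)
  finally show "pcoeff (schur_fun (lst f) * schur_fun (lst h)) \<alpha> =
    pcoeff (\<Sum>p\<in>#schur_terms f h. schur_fun (lst p)) \<alpha>" .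
qed

lemma schur_terms_iff: "p \<in># schur_terms f h \<longleftrightarrow> (\<exists>g\<in>lr_patterns f h. p = (\<lambda>i. f i + wt 0 g i))"
  using finite_lr_patterns[of f h] by (auto simp: schur_terms_def)

lemma schur_terms_ptn: "ptn f \<Longrightarrow> p \<in># schur_terms f h \<Longrightarrow> ptn p"
  using lr_patterns_ptn by (auto simp: schur_terms_iff)

section \<open>Terms of products of Schur functions\<close>

lemma wt_antimono:
  assumes "g \<in> gt N h" "j \<le> j'" shows "wt j' g k \<le> wt j g k"
proof -
  have "wt (Suc j) g k \<le> wt j g k" for j
    using wt_Suc[OF assms(1), of j k] card_column_up[OF assms(1), of j k] by simp
  then have "antimono (\<lambda>j. wt j g k)" by (simp add: antimono_iff_le_Suc)
  then show ?thesis using assms(2) by (rule antimonoD)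
qed

lemma letter_column:
  assumes g: "g \<in> gt N h" and c: "g m r \<le> c" "c < g (Suc m) r"
  shows "card {i. c < g m i} = r" "wt c g m = Suc (wt (Suc c) g m)" "r \<le> m"
proof -
  have 1: "\<not> r < card {i. c < g m i}" using ptn_less_card_iff[OF gt_ptn[OF g], of r c m] c by simp
  have 2: "r < card {i. c < g (Suc m) i}" using ptn_less_card_iff[OF gt_ptn[OF g], of r c "Suc m"] c by simp
  note 3 = card_column_diag[OF g, of c m]
  show r: "card {i. c < g m i} = r" using 1 2 3 by linarith
  show "wt c g m = Suc (wt (Suc c) g m)" using wt_Suc[OF g, of c m] 2 3 r by linarith
  show "r \<le> m" using gt_zero[OF g, of "Suc m" r] c by (cases "r \<le> m") auto
qed

lemma good_antimono: "good f g \<Longrightarrow> k \<le> l \<Longrightarrow> f l + wt j g l \<le> f k + wt j g k"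
proof -
  assume "good f g"
  then have "antimono (\<lambda>k. f k + wt j g k)" by (simp add: good_def antimono_iff_le_Suc)
  then show "k \<le> l \<Longrightarrow> f l + wt j g l \<le> f k + wt j g k" by (rule antimonoD)
qed

text \<open>
  The box \<open>(r, c)\<close> of the tableau is placed in the row named by its entry, at column
  \<open>f m + wt c g m - 1\<close>; along a row of the tableau these columns strictly decrease.
\<close>

lemma letter_position:
  assumes g: "g \<in> gt N h" "good f g" and c: "c < h r"
  defines "m \<equiv> tableau_of h g (r, c)"
  shows "h r \<le> f m + wt c g m + c"
  using c unfolding m_def
proof (induction "h r - c" arbitrary: c)
  case (Suc d)
  let ?T = "tableau_of h g"
  have letter: "g (?T (r, c)) r \<le> c" "c < g (Suc (?T (r, c))) r" if "c < h r" for c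
    using tableau_of_less_iff[OF g(1) that, of "?T (r, c)"] tableau_of_less_iff[OF g(1) that, of "Suc (?T (r, c))"]
    by auto
  note w = letter_column(2)[OF g(1) letter[OF Suc.prems]]
  show ?case
  proof (cases "Suc c < h r")
    case True
    have "d = h r - Suc c" using Suc.hyps(2) by simp
    from Suc.hyps(1)[OF this True] have ih: "h r \<le> f (?T (r, Suc c)) + wt (Suc c) g (?T (r, Suc c)) + Suc c" .
    have "?T (r, c) < Suc (?T (r, Suc c))"
      using tableau_of_less_iff[OF g(1) Suc.prems] letter(2)[OF True] by simp
    then have "f (?T (r, Suc c)) + wt (Suc c) g (?T (r, Suc c)) \<le> f (?T (r, c)) + wt (Suc c) g (?T (r, c))"
      by (intro good_antimono[OF g(2)]) simp
    then show ?thesis using ih w by simp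
  next
    case False
    then show ?thesis using w Suc.prems by simp
  qed
qed simp

text \<open>Boxes of h, as many as lie outside the hook, are mapped injectively to boxes of p
  outside f and outside the hook. A box of row r goes to the row m \<ge> r \<ge> x named by its
  letter, and \<open>letter_position\<close> gives a column at least y. Equal letters lie in
  different columns c, along which \<open>wt c g m\<close> strictly decreases.\<close>

lemma schur_terms_out:
  assumes f: "ptn f" and h: "ptn h" and p: "p \<in># schur_terms f h"
  shows "out x y f + out x y h \<le> out x y p"
proof -
  obtain g where g: "g \<in> lr_patterns f h" and pg: "p = (\<lambda>i. f i + wt 0 g i)"
    using p by (auto simp: schur_terms_iff)
  define N where "N = sz 0 f + sz 0 h"
  have gN: "g \<in> gt N h" and gd: "good f g" using g by (auto simp: lr_patterns_def N_def)
  have pp: "ptn p" using schur_terms_ptn[OF f p] .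
  let ?T = "tableau_of h g"
  have letter: "g (?T (r, c)) r \<le> c" "c < g (Suc (?T (r, c))) r" if "c < h r" for r c
    using tableau_of_less_iff[OF gN that, of "?T (r, c)"] tableau_of_less_iff[OF gN that, of "Suc (?T (r, c))"]
    by auto
  \<comment> \<open>\<open>letter_position\<close> bounds the new column by the distance to the
    right end of row r. So the first h r - y boxes of the row are used instead of the last; their
    number is the same.\<close>
  define D where "D = (SIGMA r:{r. x \<le> r \<and> y < h r}. {..<h r - y})"
  define E where "E = (SIGMA m:{m. x \<le> m \<and> y < p m}. {max (f m) y..<p m})"
  define \<phi> where "\<phi> = (\<lambda>(r, c). (?T (r, c), f (?T (r, c)) + wt c g (?T (r, c)) - 1))"
  have "finite {m. x \<le> m \<and> y < p m}" by (rule finite_subset[OF _ ptn_finite[OF pp, of y]]) auto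
  then have finE: "finite E" unfolding E_def by (rule finite_SigmaI) simp
  have "inj_on \<phi> D"
  proof (rule inj_onI, clarify)
    fix r c r' c' assume D: "(r, c) \<in> D" "(r', c') \<in> D" and e: "\<phi> (r, c) = \<phi> (r', c')"
    have c: "c < h r" "c' < h r'" using D by (auto simp: D_def)
    define m where "m = ?T (r, c)"
    have m': "?T (r', c') = m" using e by (simp add: \<phi>_def m_def)
    note l = letter_column[OF gN letter[OF c(1)], folded m_def]
    note l' = letter_column[OF gN letter[OF c(2)], unfolded m']
    have w: "wt c g m = wt c' g m" using e l(2) l'(2) by (simp add: \<phi>_def m_def[symmetric] m')
    have "c = c'"
    proof (rule ccontr)
      assume "c \<noteq> c'"
      then consider "Suc c \<le> c'" | "Suc c' \<le> c" by linarith
      then show False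
        using wt_antimono[OF gN, of "Suc c" c' m] wt_antimono[OF gN, of "Suc c'" c m] w l(2) l'(2) by cases simp_all
    qed
    then show "r = r' \<and> c = c'" using l(1) l'(1) by simp
  qed
  moreover have "\<phi> ` D \<subseteq> E"
  proof (rule image_subsetI)
    fix z assume "z \<in> D"
    moreover obtain r c where z: "z = (r, c)" by (cases z)
    ultimately have D: "(r, c) \<in> D" by simp
    then have c: "c < h r" and rc: "x \<le> r" "c < h r - y" by (auto simp: D_def)
    define m where "m = ?T (r, c)"
    note l = letter_column[OF gN letter[OF c], folded m_def]
    have pos: "h r \<le> f m + wt c g m + c" using letter_position[OF gN gd c] by (simp add: m_def)
    have "wt c g m \<le> wt 0 g m" using wt_antimono[OF gN] by simp
    then show "\<phi> z \<in> E" unfolding z using pos l rc by (auto simp: E_def \<phi>_def m_def[symmetric] pg)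
  qed
  ultimately have "card D \<le> card E" using finE by (rule card_inj_on_le)
  moreover have "card D = out x y h"
  proof -
    have "finite {r. x \<le> r \<and> y < h r}" by (rule finite_subset[OF _ ptn_finite[OF h, of y]]) auto
    then show ?thesis unfolding D_def out_def by simp
  qed
  moreover have "card E = (\<Sum>m | x \<le> m \<and> y < p m. p m - max (f m) y)"
  proof -
    have "finite {m. x \<le> m \<and> y < p m}" by (rule finite_subset[OF _ ptn_finite[OF pp, of y]]) auto
    then show ?thesis unfolding E_def by simp
  qed
  moreover have "(\<Sum>m | x \<le> m \<and> y < p m. p m - max (f m) y) + out x y f = out x y p"
  proof -
    have fin: "finite {m. x \<le> m \<and> y < p m}" by (rule finite_subset[OF _ ptn_finite[OF pp, of y]]) auto
    have "out x y f = (\<Sum>m | x \<le> m \<and> y < p m. f m - y)"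
      unfolding out_def by (rule sum.mono_neutral_left[OF fin]) (auto simp: pg)
    then have "(\<Sum>m | x \<le> m \<and> y < p m. p m - max (f m) y) + out x y f =
      (\<Sum>m | x \<le> m \<and> y < p m. (p m - max (f m) y) + (f m - y))" by (simp add: sum.distrib)
    also have "\<dots> = out x y p" unfolding out_def by (intro sum.cong) (auto simp: pg)
    finally show ?thesis .
  qed
  ultimately show ?thesis by simp
qed

lemma schur_termsI:
  assumes "ptn f" "ptn h" "g \<in> gt N h" "good f g" "\<And>i. p i = f i + wt 0 g i"
  shows "p \<in># schur_terms f h"
  using lr_patternsI[OF assms(1-4)] assms(5) unfolding schur_terms_iff by blast

lemma schur_terms_box:
  assumes f: "ptn f" and f': "ptn (f(i := Suc (f i)))"
  shows "f(i := Suc (f i)) \<in># schur_terms f (\<lambda>k. if k = 0 then 1 else 0)"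
proof -
  define g :: "nat \<Rightarrow> nat \<Rightarrow> nat" where "g k r = (if r = 0 \<and> i < k then 1 else 0)" for k r
  have e: "ptn (\<lambda>k. if k = 0 then 1 else 0 :: nat)" by (rule ptnI[of _ 1]) auto
  have g: "g \<in> gt (Suc i) (\<lambda>k. if k = 0 then 1 else 0)" by (auto simp: gt_def g_def)
  have s: "sz j (g k) = (if i < k then 1 - j else 0)" for j k
    by (subst sz_eq[of 1]) (auto simp: g_def)
  have w: "wt j g k = (if k = i then 1 - j else 0)" for j k by (auto simp: wt_def s)
  have "good f g"
    unfolding good_def
  proof (intro allI)
    fix j k
    show "f (Suc k) + wt j g (Suc k) \<le> f k + wt j g k"
      using ptn_antimono[OF f, of k "Suc k"] ptn_antimono[OF f', of k "Suc k"]
      by (auto simp: w split: if_splits)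
  qed
  then show ?thesis by (intro schur_termsI[OF f e g]) (auto simp: w)
qed

section \<open>Explicit terms between row sum and row union\<close>

definition col :: "(nat \<Rightarrow> nat) \<Rightarrow> nat \<Rightarrow> nat" where
  "col f d = card {i. d < f i}"

lemma less_col_iff: "ptn f \<Longrightarrow> i < col f d \<longleftrightarrow> d < f i"
  unfolding col_def by (rule ptn_less_card_iff)

text \<open>Row K of the partition whose columns are sums of columns of A and B, that is, of the
  rows of A and B sorted together.\<close>

definition union_row :: "(nat \<Rightarrow> nat) \<Rightarrow> (nat \<Rightarrow> nat) \<Rightarrow> nat \<Rightarrow> nat" where
  "union_row A B K = card {d. K < col A d + col B d}"

context
  fixes A B :: "nat \<Rightarrow> nat"
  assumes A: "ptn A" and B: "ptn B"
begin

lemma union_support: "{d. K < col A d + col B d} \<subseteq> {..<max (A 0) (B 0)}"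
proof
  fix d assume "d \<in> {d. K < col A d + col B d}"
  then have "0 < col A d \<or> 0 < col B d" by auto
  then show "d \<in> {..<max (A 0) (B 0)}" using less_col_iff[OF A, of 0 d] less_col_iff[OF B, of 0 d] by auto
qed

lemma union_row_le: "union_row A B K \<le> max (A 0) (B 0)"
  unfolding union_row_def using card_mono[OF _ union_support] by (metis card_lessThan finite_lessThan)

lemma union_row_antimono: "K \<le> L \<Longrightarrow> union_row A B L \<le> union_row A B K"
  unfolding union_row_def by (rule card_mono[OF finite_subset[OF union_support]]) auto

text \<open>Counted by columns d, the sum with a < L is (\<Sum>d. min (L - col B d) (col A d)). From
  L = K to K + 1 the column d gains 1 exactly if col B d \<le> K < col A d + col B d, and B K
  supplies the columns with K < col B d.\<close>

lemma union_row_sum: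
  "B K + (\<Sum>a<Suc K. A a - B (K - a)) = (\<Sum>a<K. A a - B (K - 1 - a)) + union_row A B K"
proof -
  define D where "D = max (A 0) (B 0)"
  have card_D: "card {d. P d} = (\<Sum>d<D. if P d then 1 else 0)" if "{d. P d} \<subseteq> {..<D}" for P
  proof -
    have "{d. P d} = {d \<in> {..<D}. P d}" using that by auto
    then show ?thesis by (simp add: sum.inter_filter[symmetric])
  qed
  have leD: "A a \<le> D" "B a \<le> D" for a
    using ptn_antimono[OF A, of 0 a] ptn_antimono[OF B, of 0 a] by (auto simp: D_def)
  have S: "(\<Sum>a<L. A a - B (L - 1 - a)) = (\<Sum>d<D. min (L - col B d) (col A d))" for L
  proof -
    have "(\<Sum>a<L. A a - B (L - 1 - a)) = (\<Sum>a<L. \<Sum>d<D. if a < L - col B d \<and> a < col A d then 1 else 0)"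
    proof (rule sum.cong[OF refl])
      fix a assume "a \<in> {..<L}"
      then have i: "B (L - 1 - a) \<le> d \<longleftrightarrow> a < L - col B d" for d
        using less_col_iff[OF B, of "L - 1 - a" d] by auto
      have "A a - B (L - 1 - a) = card {B (L - 1 - a)..<A a}" by simp
      also have "{B (L - 1 - a)..<A a} = {d. a < L - col B d \<and> a < col A d}"
        using i less_col_iff[OF A, of a] by auto
      also have "card \<dots> = (\<Sum>d<D. if a < L - col B d \<and> a < col A d then 1 else 0)"
        using less_col_iff[OF A, of a] leD[of a] by (intro card_D) (auto intro: less_le_trans)
      finally show "A a - B (L - 1 - a) = (\<Sum>d<D. if a < L - col B d \<and> a < col A d then 1 else 0)" .
    qed
    also have "\<dots> = (\<Sum>d<D. \<Sum>a<L. if a < L - col B d \<and> a < col A d then 1 else 0)" by (rule sum.swap)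
    also have "\<dots> = (\<Sum>d<D. min (L - col B d) (col A d))"
    proof (rule sum.cong[OF refl])
      fix d
      have "{a \<in> {..<L}. a < L - col B d \<and> a < col A d} = {..<min (L - col B d) (col A d)}" by auto
      then show "(\<Sum>a<L. if a < L - col B d \<and> a < col A d then 1 else 0) = min (L - col B d) (col A d)"
        by (simp add: sum.inter_filter[symmetric])
    qed
    finally show ?thesis .
  qed
  have BK: "B K = (\<Sum>d<D. if K < col B d then 1 else 0)"
  proof -
    have "{d. K < col B d} = {..<B K}" using less_col_iff[OF B] by auto
    then have "B K = card {d. K < col B d}" by simp
    also have "\<dots> = (\<Sum>d<D. if K < col B d then 1 else 0)"
      using less_col_iff[OF B, of K] leD[of K] by (intro card_D) (auto intro: less_le_trans)
    finally show ?thesis .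
  qed
  have U: "union_row A B K = (\<Sum>d<D. if K < col A d + col B d then 1 else 0)"
    unfolding union_row_def using union_support by (intro card_D) (simp add: D_def)
  have "(\<Sum>a<Suc K. A a - B (K - a)) = (\<Sum>d<D. min (Suc K - col B d) (col A d))" using S[of "Suc K"] by simp
  then show ?thesis unfolding BK U S sum.distrib[symmetric]
    by (simp only: sum.distrib[symmetric]) (intro sum.cong, auto)
qed

end

lemma union_row_same: "ptn f \<Longrightarrow> union_row f f K = f (K div 2)"
proof -
  assume f: "ptn f"
  have "K < col f d + col f d \<longleftrightarrow> d < f (K div 2)" for d
    using less_col_iff[OF f, of "K div 2" d] by linarith
  then show ?thesis by (simp add: union_row_def)
qed

text \<open>
  The rows above \<open>x\<close> and the columns right of \<open>y\<close> of \<open>h\<close> are added to \<open>f\<close> as rows, the remaining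
  boxes are appended to the columns of \<open>f\<close>.
\<close>

definition mixed_pattern :: "nat \<Rightarrow> nat \<Rightarrow> (nat \<Rightarrow> nat) \<Rightarrow> (nat \<Rightarrow> nat) \<Rightarrow> nat \<Rightarrow> nat \<Rightarrow> nat" where
  "mixed_pattern x y f h k i =
    (if k \<le> i then 0 else if i < x then h i else h i - min y (f (x + k - 1 - i)))"

text \<open>The resulting shape: f + h if x is beyond all rows, the union of the rows if x = 0 and y
  \<ge> f 0.\<close>

definition mixed_sum :: "nat \<Rightarrow> nat \<Rightarrow> (nat \<Rightarrow> nat) \<Rightarrow> (nat \<Rightarrow> nat) \<Rightarrow> nat \<Rightarrow> nat" where
  "mixed_sum x y f h m = (if m < x then f m + h m else
    (f m - y) + union_row (\<lambda>a. h (x + a)) (\<lambda>a. min y (f (x + a))) (m - x))"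

context
  fixes f h :: "nat \<Rightarrow> nat" and x y :: nat
  assumes f: "ptn f" and h: "ptn h"
begin

lemma mixed_pattern_in_gt: "\<exists>N. mixed_pattern x y f h \<in> gt N h"
proof -
  obtain N1 N2 where N1: "\<forall>i\<ge>N1. f i = 0" and N2: "\<forall>i\<ge>N2. h i = 0"
    using ptn_eventually_zero[OF f] ptn_eventually_zero[OF h] by blast
  have "mixed_pattern x y f h k = h" if "N1 + N2 \<le> k" for k
  proof
    fix i
    show "mixed_pattern x y f h k i = h i"
    proof (cases "N2 \<le> i")
      case True
      then show ?thesis using N2 by (simp add: mixed_pattern_def)
    next
      case False
      then have "f (x + k - 1 - i) = 0" using N1 that by simp
      then show ?thesis using False that by (simp add: mixed_pattern_def)
    qed
  qed
  moreover have "mixed_pattern x y f h k i \<le> mixed_pattern x y f h (Suc k) i" for k i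
  proof -
    have "f (x + k - i) \<le> f (x + k - Suc i)" by (rule ptn_antimono[OF f]) simp
    then have "h i - min y (f (x + k - Suc i)) \<le> h i - min y (f (x + k - i))"
      by (intro diff_le_mono2) simp
    then show ?thesis by (simp add: mixed_pattern_def)
  qed
  moreover have "mixed_pattern x y f h (Suc k) (Suc i) \<le> mixed_pattern x y f h k i" for k i
    using ptn_antimono[OF h, of i "Suc i"]
    by (auto simp: mixed_pattern_def intro!: diff_le_mono intro: le_trans[OF diff_le_self])
  ultimately have "mixed_pattern x y f h \<in> gt (N1 + N2) h"
    by (auto simp: gt_def) (simp add: mixed_pattern_def)
  then show ?thesis by blast
qed

lemma ptn_shift: "ptn (\<lambda>a. h (x + a) - j)" "ptn (\<lambda>a. min y (f (x + a)))"
proof -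
  obtain N1 N2 where N: "\<forall>i\<ge>N1. f i = 0" "\<forall>i\<ge>N2. h i = 0"
    using ptn_eventually_zero[OF f] ptn_eventually_zero[OF h] by blast
  show "ptn (\<lambda>a. h (x + a) - j)"
    by (rule ptnI[of _ N2]) (use N ptn_antimono[OF h] in \<open>auto intro: diff_le_mono\<close>)
  show "ptn (\<lambda>a. min y (f (x + a)))"
    by (rule ptnI[of _ N1]) (use N ptn_antimono[OF f] in \<open>auto intro: min.coboundedI2\<close>)
qed

text \<open>From row x on the size of a level is the sum in \<open>union_row_sum\<close>, with A the
  lower rows of h cut at column j and B the first y columns of the lower rows of f. Goodness can be
  read off from the formula for all j.\<close>

lemma mixed_pattern_wt:
  "f m + wt j (mixed_pattern x y f h) m = (if m < x then f m + (h m - j) else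
    (f m - y) + union_row (\<lambda>a. h (x + a) - j) (\<lambda>a. min y (f (x + a))) (m - x))"
proof -
  let ?g = "mixed_pattern x y f h" and ?A = "\<lambda>a. h (x + a) - j" and ?B = "\<lambda>a. min y (f (x + a))"
  obtain N where g: "?g \<in> gt N h" using mixed_pattern_in_gt by blast
  have s: "sz j (?g k) = (\<Sum>i<k. ?g k i - j)" for k
    by (rule sz_eq) (simp add: mixed_pattern_def)
  have low: "sz j (?g k) = (\<Sum>i<k. h i - j)" if "k \<le> x" for k
    unfolding s using that by (intro sum.cong) (auto simp: mixed_pattern_def)
  have high: "sz j (?g (x + K)) = (\<Sum>i<x. h i - j) + (\<Sum>a<K. ?A a - ?B (K - 1 - a))" for K
  proof -
    have "(\<Sum>i<x + L. F i) = (\<Sum>i<x. F i) + (\<Sum>a<L. F (x + a))" for L and F :: "nat \<Rightarrow> nat"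
      by (induction L) simp_all
    then have "sz j (?g (x + K)) = (\<Sum>i<x. ?g (x + K) i - j) + (\<Sum>a<K. ?g (x + K) (x + a) - j)"
      unfolding s .
    also have "(\<Sum>i<x. ?g (x + K) i - j) = (\<Sum>i<x. h i - j)"
      by (intro sum.cong) (auto simp: mixed_pattern_def)
    also have "(\<Sum>a<K. ?g (x + K) (x + a) - j) = (\<Sum>a<K. ?A a - ?B (K - 1 - a))"
      by (intro sum.cong) (auto simp: mixed_pattern_def diff_commute)
    finally show ?thesis .
  qed
  show ?thesis
  proof (cases "m < x")
    case True
    then show ?thesis using low[of m] low[of "Suc m"] by (simp add: wt_def)
  next
    case False
    define K where "K = m - x"
    have m: "m = x + K" using False by (simp add: K_def)
    have "wt j ?g m + sz j (?g m) = sz j (?g (Suc m))" by (rule wt_add[OF g])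
    then have "wt j ?g m + (\<Sum>a<K. ?A a - ?B (K - 1 - a)) = (\<Sum>a<Suc K. ?A a - ?B (K - a))"
      using high[of K] high[of "Suc K"] by (simp add: m)
    then have "?B K + wt j ?g m = union_row ?A ?B K"
      using union_row_sum[OF ptn_shift, of K j] by simp
    moreover have "f m = (f m - y) + ?B K" by (simp add: m)
    ultimately show ?thesis using False by (simp add: K_def)
  qed
qed

lemma mixed_pattern_good: "good f (mixed_pattern x y f h)"
  unfolding good_def
proof (intro allI)
  fix j k
  let ?A = "\<lambda>a. h (x + a) - j" and ?B = "\<lambda>a. min y (f (x + a))"
  note fa = ptn_antimono[OF f, of k "Suc k"] and ha = ptn_antimono[OF h, of k "Suc k"]
  consider "Suc k < x" | "Suc k = x" | "x \<le> k" by linarith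
  then show "f (Suc k) + wt j (mixed_pattern x y f h) (Suc k) \<le> f k + wt j (mixed_pattern x y f h) k"
  proof cases
    case 1
    then show ?thesis unfolding mixed_pattern_wt using fa ha by (simp add: add_mono diff_le_mono)
  next
    case 2
    have "union_row ?A ?B 0 \<le> max (h x - j) (min y (f x))" using union_row_le[OF ptn_shift, of j 0] by simp
    then have "(f x - y) + union_row ?A ?B 0 \<le> f x + (h x - j)" by linarith
    also have "\<dots> \<le> f k + (h k - j)" using fa ha 2 by (intro add_mono diff_le_mono) simp_all
    finally show ?thesis unfolding mixed_pattern_wt using 2 by simp
  next
    case 3
    then show ?thesis unfolding mixed_pattern_wt
      using fa union_row_antimono[OF ptn_shift, of "k - x" "Suc k - x" j] by (simp add: add_mono diff_le_mono)
  qed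
qed

lemma mixed_sum_term: "mixed_sum x y f h \<in># schur_terms f h"
proof -
  obtain N where g: "mixed_pattern x y f h \<in> gt N h" using mixed_pattern_in_gt by blast
  show ?thesis
    by (rule schur_termsI[OF f h g mixed_pattern_good])
      (simp only: mixed_pattern_wt mixed_sum_def diff_zero)
qed

lemma mixed_sum_high: "mixed_sum x y f h x \<le> (f x - y) + max (h x) (min y (f x))"
  using union_row_le[OF ptn_shift(1)[of 0] ptn_shift(2), of 0] by (simp add: mixed_sum_def)

end

section \<open>Squares of Schur functions\<close>

lemma two_le_size:
  assumes "p \<in># D" "q \<in># D" "p \<noteq> q" shows "2 \<le> size D"
proof -
  obtain A where D: "D = add_mset p A" using multi_member_split[OF assms(1)] by blast
  then have "q \<in># A" using assms(2,3) by simp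
  then obtain A' where "A = add_mset q A'" using multi_member_split by metis
  then show ?thesis by (simp add: D)
qed

lemma schur_square_all:
  assumes f: "ptn f" "f \<noteq> (\<lambda>_. 0)"
  shows "2 \<le> size (schur_terms f f)"
proof (rule two_le_size)
  show "mixed_sum 1 0 f f \<in># schur_terms f f" "mixed_sum 0 (f 0) f f \<in># schur_terms f f"
    by (rule mixed_sum_term[OF f(1) f(1)])+
  have f0: "f 0 \<noteq> 0" using f ptn_antimono[OF f(1), of 0] by (metis le_zero_eq zero_le)
  have "mixed_sum 0 (f 0) f f 0 \<le> f 0" using mixed_sum_high[OF f(1) f(1), of 0 "f 0"] by simp
  moreover have "mixed_sum 1 0 f f 0 = f 0 + f 0" by (simp add: mixed_sum_def)
  ultimately show "mixed_sum 1 0 f f \<noteq> mixed_sum 0 (f 0) f f" using f0 by (metis add_le_same_cancel1 le_zero_eq)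
qed

text \<open>Both terms stay in the hook. Their first rows have length 2 * f 0, as x > 0, and at most
  (f 0 - y) + f 0, which is smaller as y > 0. So a proper hook has no exceptional shape except the
  empty one.\<close>

lemma schur_square_corner:
  assumes f: "ptn f" "f x \<le> y" "f \<noteq> (\<lambda>_. 0)" and xy: "0 < x" "0 < y"
  shows "2 \<le> size {#p \<in># schur_terms f f. p x \<le> y#}"
proof (rule two_le_size)
  have f0: "f 0 \<noteq> 0" using f ptn_antimono[OF f(1), of 0] by (metis le_zero_eq zero_le)
  have "mixed_sum x y f f x \<le> y" using mixed_sum_high[OF f(1) f(1), of x y] f(2) by simp
  then show "mixed_sum x y f f \<in># {#p \<in># schur_terms f f. p x \<le> y#}"
    using mixed_sum_term[OF f(1) f(1)] by simp
  have B: "ptn (\<lambda>a. min y (f a))" using ptn_shift(2)[OF f(1) f(1), of y 0] by simp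
  have "{d. x < col f d + col (\<lambda>a. min y (f a)) d} \<subseteq> {..<y}"
  proof (rule subsetI, rule ccontr)
    fix d assume d: "d \<in> {d. x < col f d + col (\<lambda>a. min y (f a)) d}" "d \<notin> {..<y}"
    then have "col (\<lambda>a. min y (f a)) d = 0" by (simp add: col_def)
    moreover have "\<not> x < col f d" using less_col_iff[OF f(1), of x d] d(2) f(2) by simp
    ultimately show False using d(1) by simp
  qed
  then have "union_row f (\<lambda>a. min y (f a)) x \<le> y"
    unfolding union_row_def by (metis card_lessThan card_mono finite_lessThan)
  then have "mixed_sum 0 y f f x \<le> y" using f(2) by (simp add: mixed_sum_def)
  then show "mixed_sum 0 y f f \<in># {#p \<in># schur_terms f f. p x \<le> y#}"
    using mixed_sum_term[OF f(1) f(1)] by simp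
  have "mixed_sum 0 y f f 0 \<le> (f 0 - y) + f 0" using mixed_sum_high[OF f(1) f(1), of 0 y] by simp
  then have "mixed_sum 0 y f f 0 < f 0 + f 0" using f0 xy by linarith
  moreover have "mixed_sum x y f f 0 = f 0 + f 0" using xy by (simp add: mixed_sum_def)
  ultimately show "mixed_sum x y f f \<noteq> mixed_sum 0 y f f" by (metis less_irrefl)
qed

text \<open>One term is f + f. The other uses a step f (r + 1) < f r within the first x rows: in the
  canonical tableau the last letter r of row r becomes r + 1, which moves a box of f + f from row r
  to row r + 1. A rectangle with x rows has no such step.\<close>

lemma schur_square_rows:
  assumes f: "ptn f" "f x = 0" and const: "\<And>a. f \<noteq> (\<lambda>i. if i < x then a else 0)"
  shows "2 \<le> size {#p \<in># schur_terms f f. p x \<le> 0#}"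
proof -
  have fx: "f i = 0" if "x \<le> i" for i using f(2) ptn_antimono[OF f(1) that] by simp
  have "\<exists>i. Suc i < x \<and> f (Suc i) \<noteq> f i"
  proof (rule ccontr)
    assume *: "\<not> ?thesis"
    have f0: "f i = f 0" if "i < x" for i
      using that
    proof (induction i)
      case (Suc i)
      then have "f (Suc i) = f i" using * by blast
      with Suc show ?case by simp
    qed simp
    have "f i = (if i < x then f 0 else 0)" for i
    proof (cases "i < x")
      case True
      then show ?thesis using f0[OF True] by (simp only: if_True)
    qed (simp add: fx)
    then show False using const[of "f 0"] by blast
  qed
  then obtain r where r: "Suc r < x" "f (Suc r) \<noteq> f r" by blast
  then have less: "f (Suc r) < f r" using ptn_antimono[OF f(1), of r "Suc r"] by simp
  define g where "g = (canonical f)(Suc r := (canonical f (Suc r))(r := f r - 1))"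
  have g_other: "g k = canonical f k" if "k \<noteq> Suc r" for k using that by (simp add: g_def)
  have g_r: "g (Suc r) i = (if i = r then f r - 1 else canonical f (Suc r) i)" for i by (simp add: g_def)
  have "g k i \<le> g (Suc k) i \<and> g (Suc k) (Suc i) \<le> g k i" for k i
  proof -
    consider "k = Suc r" | "k = r" | "k \<noteq> r" "k \<noteq> Suc r" by blast
    then show ?thesis
    proof cases
      case 1
      then show ?thesis using less ptn_antimono[OF f(1), of i "Suc i"]
        by (auto simp: g_r g_other canonical_def)
    next
      case 2
      then show ?thesis using ptn_antimono[OF f(1), of i "Suc i"]
        by (auto simp: g_r g_other canonical_def)
    next
      case 3
      then show ?thesis using ptn_antimono[OF f(1), of i "Suc i"]
        by (auto simp: g_other canonical_def)
    qed
  qed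
  moreover have "g k = f" if "x \<le> k" for k
    using that r(1) fx by (auto simp: g_other canonical_def fun_eq_iff)
  ultimately have g: "g \<in> gt x f" by (simp add: gt_def g_other canonical_def)
  have s: "sz j (g k) = (\<Sum>i<k. f i - j)" if "k \<noteq> Suc r" for j k
    using that by (simp add: g_other sz_canonical)
  have s': "sz j (g (Suc r)) = (\<Sum>i<r. f i - j) + (f r - 1 - j)" for j
    by (subst sz_eq[of "Suc r"]) (auto simp: g_r canonical_def)
  have w: "wt j g k = f k - j" if "k \<noteq> r" "k \<noteq> Suc r" for j k
    using that s[of k j] s[of "Suc k" j] by (simp add: wt_def)
  have w1: "wt j g r = f r - 1 - j" for j using s[of r j] s'[of j] by (simp add: wt_def)
  have w2: "wt j g (Suc r) = (f (Suc r) - j) + ((f r - j) - (f r - 1 - j))" for j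
  proof -
    have "f r - 1 - j \<le> f r - j" by simp
    moreover have "sz j (g (Suc (Suc r))) = (\<Sum>i<r. f i - j) + (f r - j) + (f (Suc r) - j)"
      using s[of "Suc (Suc r)" j] by simp
    ultimately show ?thesis unfolding wt_def s' by linarith
  qed
  have gd: "good f g"
    unfolding good_def
  proof (intro allI)
    fix j k
    note a = ptn_antimono[OF f(1), of k "Suc k"]
    consider "k = r" | "k = Suc r" | "Suc k = r" | "k \<noteq> r" "k \<noteq> Suc r" "Suc k \<noteq> r" by blast
    then show "f (Suc k) + wt j g (Suc k) \<le> f k + wt j g k"
    proof cases
      case 1
      then show ?thesis using less by (simp add: w1 w2)
    next
      case 2
      then show ?thesis using a w[of "Suc (Suc r)" j] by (simp add: w2)
    next
      case 3
      then show ?thesis using a w[of k j] by (auto simp: w1)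
    next
      case 4
      then show ?thesis using a w[of k j] w[of "Suc k" j] by simp
    qed
  qed
  define q where "q i = f i + wt 0 g i" for i
  show ?thesis
  proof (rule two_le_size)
    have q: "q \<in># schur_terms f f" by (rule schur_termsI[OF f(1) f(1) g gd]) (simp add: q_def)
    have "q x = 0" using f(2) w[of x 0] r(1) by (simp add: q_def)
    with q show "q \<in># {#p \<in># schur_terms f f. p x \<le> 0#}" by simp
    have "mixed_sum x 0 f f x \<le> 0" using mixed_sum_high[OF f(1) f(1), of x 0] f(2) by simp
    then show "mixed_sum x 0 f f \<in># {#p \<in># schur_terms f f. p x \<le> 0#}"
      using mixed_sum_term[OF f(1) f(1)] by simp
    have "mixed_sum x 0 f f r = f r + f r" using r(1) by (simp add: mixed_sum_def)
    moreover have "q r < f r + f r" using less w1[of 0] by (simp add: q_def)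
    ultimately show "q \<noteq> mixed_sum x 0 f f" by (metis less_irrefl)
  qed
qed

text \<open>One term is the union of f with itself, whose row m is f (m div 2). If [s, e) are the
  rows of f of a length a with 0 < a < y, the union has length a in rows 2 * s to 2 * e - 1. The
  other term lengthens the first of these rows and shortens the last; a < y keeps it within y
  columns.\<close>

lemma schur_square_columns:
  assumes f: "ptn f" "f 0 \<le> y" and const: "\<And>a. f \<noteq> (\<lambda>i. if i < a then y else 0)"
  shows "2 \<le> size {#p \<in># schur_terms f f. p 0 \<le> y#}"
proof -
  let ?b = "mixed_pattern 0 y f f"
  have fy: "f i \<le> y" for i using ptn_antimono[OF f(1), of 0 i] f(2) by simp
  have b: "?b k i = (if k \<le> i then 0 else f i - f (k - 1 - i))" for k i
    using fy by (simp add: mixed_pattern_def min_absorb2)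
  have "\<exists>i. 0 < f i \<and> f i < y"
  proof (rule ccontr)
    assume *: "\<not> ?thesis"
    have "f i = (if i < col f 0 then y else 0)" for i
    proof (cases "0 < f i")
      case True
      then have "y \<le> f i" using * not_le by blast
      then show ?thesis using True fy[of i] less_col_iff[OF f(1), of i 0] by simp
    next
      case False
      then show ?thesis using less_col_iff[OF f(1), of i 0] by simp
    qed
    then show False using const[of "col f 0"] by blast
  qed
  then obtain i0 where i0: "0 < f i0" "f i0 < y" by blast
  define a where "a = f i0"
  define s where "s = col f a"
  define e where "e = col f (a - 1)"
  have s: "i < s \<longleftrightarrow> a < f i" for i unfolding s_def by (rule less_col_iff[OF f(1)])
  have e: "i < e \<longleftrightarrow> a \<le> f i" for i using less_col_iff[OF f(1), of i "a - 1"] i0 unfolding e_def a_def by auto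
  have block: "f i = a" if "s \<le> i" "i < e" for i using s[of i] e[of i] that by simp
  have "i0 < e" "s \<le> i0" using e[of i0] s[of i0] a_def by auto
  then have se: "s < e" by simp
  \<comment> \<open>In \<open>?b\<close> the first boxes of rows s, ..., e - 1 carry the letters e +
    s, ..., 2 * e - 1. \<open>C\<close> marks the levels at which they are present once these
    letters are changed to 2 * s, e + s, ..., 2 * e - 2: the content gains 2 * s and loses 2 * e -
    1.\<close>
  define C where "C k i \<longleftrightarrow> i = s \<and> 2 * s < k \<or> s < i \<and> i < e \<and> e + i \<le> k" for k i
  define g where "g k i = (if C k i then max 1 (?b k i) else ?b k i)" for k i
  obtain N where bN: "?b \<in> gt N f" using mixed_pattern_in_gt[OF f(1) f(1)] by blast
  have Ca: "f i = a" "i < k" if "C k i" for k i using that block[of i] se by (auto simp: C_def)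
  have b0: "?b k i = 0 \<longleftrightarrow> k \<le> e + i" if "C k i" for k i
    using Ca[OF that] e[of "k - 1 - i"] by (auto simp: b)
  have up: "g k i \<le> g (Suc k) i" for k i
  proof -
    have "C k i \<Longrightarrow> C (Suc k) i" by (auto simp: C_def)
    then show ?thesis using gt_up[OF bN, of k i] by (auto simp: g_def)
  qed
  have diag: "g (Suc k) (Suc i) \<le> g k i" for k i
  proof (cases "C (Suc k) (Suc i)")
    case False
    then have "g (Suc k) (Suc i) \<le> ?b k i" using gt_diag[OF bN, of k i] by (simp add: g_def)
    also have "\<dots> \<le> g k i" by (simp add: g_def)
    finally show ?thesis .
  next
    case True
    have "1 \<le> g k i"
    proof (cases "Suc i = s")
      case True
      then have "2 * s \<le> k" using \<open>C (Suc k) (Suc i)\<close> by (simp add: C_def)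
      then have "a < f i" "f (k - 1 - i) \<le> a" using s[of i] s[of "k - 1 - i"] True by auto
      then have "1 \<le> ?b k i" using \<open>2 * s \<le> k\<close> True by (simp add: b)
      then show ?thesis by (simp add: g_def)
    next
      case False
      then have "C k i" using \<open>C (Suc k) (Suc i)\<close> se by (auto simp: C_def)
      then show ?thesis by (simp add: g_def)
    qed
    moreover have "?b k i \<le> g k i" by (simp add: g_def)
    ultimately have "1 \<le> g k i" "?b (Suc k) (Suc i) \<le> g k i" using gt_diag[OF bN, of k i] by linarith+
    moreover have "g (Suc k) (Suc i) = max 1 (?b (Suc k) (Suc i))" using True by (simp add: g_def)
    ultimately show ?thesis by linarith
  qed
  have "g k = f" if "N + 2 * e + 1 \<le> k" for k
  proof
    fix i
    have bk: "?b k i = f i" using gt_top[OF bN, of k] that by simp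
    show "g k i = f i"
    proof (cases "C k i")
      case True
      then have "1 \<le> f i" using Ca[OF True] i0 a_def by simp
      then show ?thesis using bk by (simp add: g_def)
    qed (simp add: g_def bk)
  qed
  moreover have "g 0 i = 0" for i by (simp add: g_def C_def b)
  ultimately have g: "g \<in> gt (N + 2 * e + 1) f" using up diag by (auto simp: gt_def)
  have sz_g: "sz j (g k) = sz j (?b k) + (if j = 0 \<and> 2 * s < k \<and> k < 2 * e then 1 else 0)" for j k
  proof -
    let ?c = "\<lambda>i. if j = 0 \<and> C k i \<and> k \<le> e + i then 1 else 0 :: nat"
    define L where "L = max N e"
    have L: "?b k i = 0" "g k i = 0" if "L \<le> i" for i
      using that gt_zero'[OF bN, of i k] se by (auto simp: L_def g_def C_def)
    have "g k i - j = ?b k i - j + ?c i" for i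
      using b0[of k i] by (auto simp: g_def)
    then have "sz j (g k) = sz j (?b k) + (\<Sum>i<L. ?c i)"
      using L by (simp add: sz_eq[of L] sum.distrib)
    also have "(\<Sum>i<L. ?c i) = card {i \<in> {..<L}. j = 0 \<and> C k i \<and> k \<le> e + i}"
      by (simp add: sum.inter_filter[symmetric])
    also have "{i \<in> {..<L}. j = 0 \<and> C k i \<and> k \<le> e + i} =
      (if j = 0 \<and> 2 * s < k \<and> k < 2 * e then {max s (k - e)} else {})"
      using se by (auto simp: C_def L_def)
    finally show ?thesis by (simp split: if_splits)
  qed
  \<comment> \<open>Only boxes of column 0 have changed, so goodness from column 1 on is inherited
    from \<open>?b\<close>.\<close>
  have wt_pos: "wt j g k = wt j ?b k" if "0 < j" for j k using that by (simp add: wt_def sz_g)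
  have fb: "f m + wt 0 ?b m = f (m div 2)" for m
    using mixed_pattern_wt[OF f(1) f(1), of m 0 0 y] fy by (simp add: min_absorb2 union_row_same[OF f(1)])
  define q where "q i = f i + wt 0 g i" for i
  have q: "q m + (if m = 2 * e - 1 then 1 else 0) = f (m div 2) + (if m = 2 * s then 1 else 0)" for m
  proof -
    have "wt 0 g m + sz 0 (g m) = sz 0 (g (Suc m))" by (rule wt_add[OF g])
    moreover have "wt 0 ?b m + sz 0 (?b m) = sz 0 (?b (Suc m))" by (rule wt_add[OF bN])
    moreover define d where "d k = (if 2 * s < k \<and> k < 2 * e then 1 else 0 :: nat)" for k
    moreover have "sz 0 (g k) = sz 0 (?b k) + d k" for k by (simp add: sz_g d_def)
    ultimately have "wt 0 g m + d m = wt 0 ?b m + d (Suc m)" by simp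
    moreover have "d (Suc m) + (if m = 2 * e - 1 then 1 else 0) = d m + (if m = 2 * s then 1 else 0)"
      using se by (auto simp: d_def)
    ultimately show ?thesis unfolding q_def using fb[of m] by linarith
  qed
  have fs: "f s = a" and fe: "f (e - 1) = a" and fe': "f e < a"
    using block[of s] block[of "e - 1"] e[of e] se by auto
  have qk: "q (Suc k) \<le> q k" for k
  proof -
    have d: "f (Suc k div 2) \<le> f (k div 2)" by (rule ptn_antimono[OF f(1)]) simp
    consider "Suc k = 2 * s" | "k = 2 * e - 1" | "Suc k \<noteq> 2 * s" "k \<noteq> 2 * e - 1" by blast
    then show ?thesis
    proof cases
      case 1
      then have "k div 2 = s - 1" "Suc k div 2 = s" "0 < s" by auto
      then have "f (Suc k div 2) < f (k div 2)" using s[of "s - 1"] fs by simp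
      then show ?thesis using q[of k] q[of "Suc k"] 1 se by (auto split: if_splits)
    next
      case 2
      then have "k div 2 = e - 1" "Suc k div 2 = e" using se by auto
      then have "f (Suc k div 2) < f (k div 2)" using fe fe' by simp
      then show ?thesis using q[of k] q[of "Suc k"] 2 se by (auto split: if_splits)
    next
      case 3
      then show ?thesis using q[of k] q[of "Suc k"] d by (auto split: if_splits)
    qed
  qed
  have gd: "good f g"
    unfolding good_def
  proof (intro allI)
    fix j k
    show "f (Suc k) + wt j g (Suc k) \<le> f k + wt j g k"
    proof (cases "j = 0")
      case True
      then show ?thesis using qk[of k] by (simp add: q_def)
    next
      case False
      then show ?thesis using wt_pos[of j] mixed_pattern_good[OF f(1) f(1), of 0 y] by (simp add: good_def)
    qed
  qed
  show ?thesis
  proof (rule two_le_size)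
    have t: "q \<in># schur_terms f f" by (rule schur_termsI[OF f(1) f(1) g gd]) (simp add: q_def)
    have "q 0 \<le> y" using q[of 0] se fs f(2) i0 a_def by (cases "s = 0") (auto split: if_splits)
    with t show "q \<in># {#p \<in># schur_terms f f. p 0 \<le> y#}" by simp
    have "mixed_sum 0 y f f 0 \<le> y" using mixed_sum_high[OF f(1) f(1), of 0 y] f(2) by simp
    then show "mixed_sum 0 y f f \<in># {#p \<in># schur_terms f f. p 0 \<le> y#}"
      using mixed_sum_term[OF f(1) f(1)] by simp
    have "mixed_sum 0 y f f (2 * s) = f s"
      using fy by (simp add: mixed_sum_def min_absorb2 union_row_same[OF f(1)])
    moreover have "q (2 * s) = Suc (f s)" using q[of "2 * s"] se by (auto split: if_splits)
    ultimately show "q \<noteq> mixed_sum 0 y f f" by (metis n_not_Suc_n)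
  qed
qed

text \<open>For y = 0 the hook consists of x rows and the rectangles with x rows are exceptional;
  for x = 0 it consists of y columns and those with y columns are; a proper hook leaves only the
  empty partition.\<close>

definition schur_rect :: "nat \<Rightarrow> nat \<Rightarrow> nat \<Rightarrow> nat \<Rightarrow> nat" where
  "schur_rect x y a = (if y = 0 then (\<lambda>i. if i < x then a else 0)
     else if x = 0 then (\<lambda>i. if i < a then y else 0) else (\<lambda>_. 0))"

lemma schur_rect_ptn: "ptn (schur_rect x y a)"
  by (rule ptnI[of _ "max x a"]) (auto simp: schur_rect_def)

lemma schur_rect_add: "schur_rect x y (a + c) \<in># schur_terms (schur_rect x y a) (schur_rect x y c)"
proof -
  note t = mixed_sum_term[OF schur_rect_ptn[of x y a] schur_rect_ptn[of x y c]]
  have z: "union_row (\<lambda>_. 0) (\<lambda>_. 0) K = 0" for K by (simp add: union_row_def col_def)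
  consider "y = 0" | "y \<noteq> 0" "x = 0" | "y \<noteq> 0" "x \<noteq> 0" by blast
  then show ?thesis
  proof cases
    case 1
    then have "mixed_sum x 0 (schur_rect x y a) (schur_rect x y c) = schur_rect x y (a + c)"
      by (intro ext) (simp add: mixed_sum_def schur_rect_def z)
    then show ?thesis using t by metis
  next
    case 2
    have cj: "col (\<lambda>i. if i < k then y else 0) d = (if d < y then k else 0)" for k d
    proof -
      have "{i. d < (if i < k then y else 0)} = (if d < y then {..<k} else {})" by auto
      then show ?thesis by (simp add: col_def)
    qed
    have "union_row (\<lambda>i. if i < c then y else 0) (\<lambda>i. if i < a then y else 0) K = (if K < a + c then y else 0)" for K
    proof -
      have "{d. K < (if d < y then c else 0) + (if d < y then a else 0)} = (if K < a + c then {..<y} else {})"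
        by auto
      then show ?thesis by (simp add: union_row_def cj)
    qed
    moreover have "(\<lambda>i. min y (if i < a then y else 0)) = (\<lambda>i. if i < a then y else 0)" by auto
    ultimately have "mixed_sum 0 y (schur_rect x y a) (schur_rect x y c) = schur_rect x y (a + c)"
      using 2 by (intro ext) (simp add: mixed_sum_def schur_rect_def)
    then show ?thesis using t by metis
  next
    case 3
    then have "mixed_sum x 0 (schur_rect x y a) (schur_rect x y c) = schur_rect x y (a + c)"
      by (intro ext) (simp add: mixed_sum_def schur_rect_def z)
    then show ?thesis using t by metis
  qed
qed

lemma schur_square_hook:
  assumes f: "ptn f" "f x \<le> y" "f \<notin> range (schur_rect x y)"
  shows "2 \<le> size {#p \<in># schur_terms f f. p x \<le> y#}"
proof -
  have r: "f \<noteq> schur_rect x y a" for a using f(3) by blast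
  consider "y = 0" | "y \<noteq> 0" "x = 0" | "y \<noteq> 0" "x \<noteq> 0" by blast
  then show ?thesis
  proof cases
    case 1
    then show ?thesis using schur_square_rows[OF f(1), of x] f(2) r by (simp add: schur_rect_def)
  next
    case 2
    then show ?thesis using schur_square_columns[OF f(1), of y] f(2) r by (simp add: schur_rect_def)
  next
    case 3
    then show ?thesis using schur_square_corner[OF f(1,2)] r by (simp add: schur_rect_def)
  qed
qed

section \<open>Squarefree coefficients of Schur functions\<close>

lemma lookup_sqf_fun: "finite S \<Longrightarrow> Poly_Mapping.lookup (sqf S) = (\<lambda>i. if i \<in> S then 1 else 0)"
  by (rule ext) (rule lookup_sqf)

lemma schur_sqf:
  assumes f: "ptn f" and S: "finite S"
  shows "pcoeff (schur_fun (lst f)) (sqf S) = sqf_coeff (card S) (schur_fun (lst f))"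
proof -
  let ?c = "\<lambda>i. if i \<in> S then 1 else 0 :: nat" and ?d = "\<lambda>i. if i \<in> {..<card S} then 1 else 0 :: nat"
  define N where "N = Suc (Max (insert (card S) S))"
  have SN: "i < N" if "i \<in> S" for i using that S by (simp add: N_def less_Suc_eq_le)
  have cN: "card S < N" using S by (simp add: N_def less_Suc_eq_le)
  have im: "image_mset (\<lambda>i. if i \<in> U then 1 else 0 :: nat) (mset_set {i. (if i \<in> U then 1 else 0 :: nat) \<noteq> 0})
    = replicate_mset (card U) 1" if "finite U" for U :: "nat set"
  proof -
    have "{i. (if i \<in> U then 1 else 0 :: nat) \<noteq> 0} = U" by auto
    then have "image_mset (\<lambda>i. if i \<in> U then 1 else 0 :: nat) (mset_set {i. (if i \<in> U then 1 else 0 :: nat) \<noteq> 0})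
      = image_mset (\<lambda>_. 1) (mset_set U)" using that by (auto intro: image_mset_cong)
    then show ?thesis by (simp add: image_mset_const_eq)
  qed
  have "\<exists>w. w permutes {..<N} \<and> ?c = ?d \<circ> w"
  proof (subst mset_eq_iff_permutation[symmetric])
    show "?c i = 0" if "N \<le> i" for i using SN[of i] that by auto
    show "?d i = 0" if "N \<le> i" for i using cN that by auto
  qed (simp only: im[OF S] im[OF finite_lessThan] card_lessThan)
  then obtain w where w: "w permutes {..<N}" "?c = ?d \<circ> w" by blast
  have iff: "c \<circ> w = ?c \<longleftrightarrow> c = ?d" for c
    unfolding w(2) using permutes_surj[OF w(1)] by (metis comp_assoc comp_id surj_iff)
  \<comment> \<open>\<open>sum_gt_permute\<close> is about series, so the indicator takes values 0
    and 1 as series, and the constant coefficient of the sum is the count.\<close>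
  let ?F = "\<lambda>c. if c = ?c then 1 else 0 :: pseries"
  have one: "pcoeff (if P then 1 else 0) 0 = (if P then 1 else 0)" for P
    by (simp add: one_pseries.rep_eq zero_pseries.rep_eq)
  have count: "(\<Sum>g\<in>gt N f. if P g then 1 else 0) = int (card {g \<in> gt N f. P g})" for P
    using finite_gt[of N f] by (subst sum.inter_filter[symmetric]) auto
  have "pcoeff (\<Sum>g\<in>gt N f. ?F (wt 0 g \<circ> w)) 0 = pcoeff (\<Sum>g\<in>gt N f. ?F (wt 0 g)) 0"
    using sum_gt_permute[OF w(1), of ?F f] by simp
  then have "card {g \<in> gt N f. wt 0 g = ?d} = card {g \<in> gt N f. wt 0 g = ?c}"
    unfolding pcoeff_sum one count iff by simp
  moreover have "Poly_Mapping.lookup (sqf S) i = 0" "Poly_Mapping.lookup (sqf {..<card S}) i = 0" if "N \<le> i" for i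
    using SN[of i] cN that S by (auto simp: lookup_sqf)
  ultimately show ?thesis
    using pcoeff_schur[OF f, of N "sqf S"] pcoeff_schur[OF f, of N "sqf {..<card S}"] S
    by (simp add: lookup_sqf_fun)
qed

lemma schur_degree:
  assumes f: "ptn f" and nz: "pcoeff (schur_fun (lst f)) \<alpha> \<noteq> 0"
  shows "total_degree \<alpha> = sz 0 f"
proof -
  obtain N where N: "\<forall>i\<ge>N. Poly_Mapping.lookup \<alpha> i = 0" using lookup_eventually_zero by blast
  then have "card {g \<in> gt N f. wt 0 g = Poly_Mapping.lookup \<alpha>} \<noteq> 0"
    using nz pcoeff_schur[OF f, of N \<alpha>] by simp
  then obtain g where g: "g \<in> gt N f" "wt 0 g = Poly_Mapping.lookup \<alpha>"
    by (auto simp: card_eq_0_iff)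
  have "total_degree \<alpha> = (\<Sum>i<N. Poly_Mapping.lookup \<alpha> i)"
    using N by (intro total_degree_superset) (auto simp: keys_subset_iff)
  also have "\<dots> = sz 0 f" using sum_wt[OF g(1), of 0 N] gt_top[OF g(1), of N] g(2) by simp
  finally show ?thesis .
qed

text \<open>Only one tableau of column shape has content 1, ..., 1: each level of a column is
  determined by its size, and the sizes by the content.\<close>

lemma schur_column: "sqf_coeff j (schur_fun (replicate k 1)) = (if j = k then 1 else 0)"
proof -
  let ?f = "\<lambda>i. if i < k then 1 else 0 :: nat"
  have f: "ptn ?f" by (rule ptnI[of _ k]) auto
  have "{i. ?f i \<noteq> 0} = {..<k}" by auto
  then have "lst ?f = map ?f [0..<k]" by (simp only: lst_def card_lessThan)
  also have "\<dots> = replicate k 1" by (rule nth_equalityI) simp_all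
  finally have l: "lst ?f = replicate k 1" .
  have szf: "sz 0 ?f = k" by (subst sz_eq[of k]) auto
  show ?thesis
  proof (cases "j = k")
    case False
    then show ?thesis using schur_degree[OF f, of "sqf {..<j}"] total_degree_sqf[of "{..<j}"]
      unfolding szf l by auto
  next
    case True
    have "g = canonical ?f" if g: "g \<in> gt k ?f" "wt 0 g = ?f" for g
    proof (intro ext)
      fix m i
      have le1: "g m i \<le> 1" for i using gt_le[OF g(1), of m i] by (simp split: if_splits)
      have "sz 1 (g m) = 0" using le1 by (simp add: gt_sz[OF g(1)])
      then have "card {i. 0 < g m i} = sz 0 (g m)" using sz_Suc[OF gt_ptn[OF g(1)], of 0 m] by simp
      also have "\<dots> = (\<Sum>l<m. ?f l)" using sum_wt[OF g(1), of 0 m] g(2) by simp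
      also have "\<dots> = card {l \<in> {..<m}. l < k}" by (simp add: sum.inter_filter[symmetric])
      also have "{l \<in> {..<m}. l < k} = {..<min m k}" by auto
      finally have "0 < g m i \<longleftrightarrow> i < min m k" using ptn_less_card_iff[OF gt_ptn[OF g(1)], of i 0 m] by simp
      then show "g m i = canonical ?f m i" using le1[of i] by (auto simp: canonical_def)
    qed
    moreover have "wt 0 (canonical ?f) = ?f" by (rule ext) (simp add: wt_canonical)
    moreover have "canonical ?f \<in> gt k ?f" by (rule canonical_in_gt[OF f]) auto
    ultimately have "{g \<in> gt k ?f. wt 0 g = ?f} = {canonical ?f}" by blast
    moreover have "Poly_Mapping.lookup (sqf {..<k}) = ?f" by (simp add: lookup_sqf_fun)
    ultimately show ?thesis using pcoeff_schur[OF f, of k "sqf {..<k}"] True unfolding l by simp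
  qed
qed

lemma schur_Nil: "schur_fun [] = 1"
proof (rule pseries_eqI)
  fix \<alpha> :: monom
  obtain N where N: "\<forall>i\<ge>N. Poly_Mapping.lookup \<alpha> i = 0" using lookup_eventually_zero by blast
  have "gt N (\<lambda>_. 0) = {\<lambda>_ _. 0}"
  proof -
    have "g = (\<lambda>_ _. 0)" if "g \<in> gt N (\<lambda>_. 0)" for g
      using gt_le[OF that] by (intro ext) simp
    moreover have "(\<lambda>_ _. 0) \<in> gt N (\<lambda>_. 0)" by (simp add: gt_def)
    ultimately show ?thesis by blast
  qed
  moreover have "wt 0 (\<lambda>_ _. 0) = (\<lambda>_. 0)" by (simp add: wt_def fun_eq_iff)
  moreover have "(\<lambda>_. 0) = Poly_Mapping.lookup \<alpha> \<longleftrightarrow> \<alpha> = 0"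
    by (auto intro!: poly_mapping_eqI dest: fun_cong)
  ultimately have "{g \<in> gt N (\<lambda>_. 0). wt 0 g = Poly_Mapping.lookup \<alpha>} = (if \<alpha> = 0 then {\<lambda>_ _. 0} else {})"
    by force
  then have "card {g \<in> gt N (\<lambda>_. 0). wt 0 g = Poly_Mapping.lookup \<alpha>} = (if \<alpha> = 0 then 1 else 0)" by simp
  then show "pcoeff (schur_fun []) \<alpha> = pcoeff 1 \<alpha>"
    using pcoeff_schur[OF ptn_zero, of N \<alpha>] N by (simp add: lst_zero one_pseries.rep_eq)
qed

interpretation schur: product_basis schur_fun schur_terms schur_rect
proof
  show "schur_fun [] = 1" by (rule schur_Nil)
next
  show "schur_rect x y a x \<le> y" for x y a by (simp add: schur_rect_def)
next
  show "0 \<le> pcoeff (schur_fun (lst f)) \<alpha>" for f \<alpha> by (simp add: schur_fun_def Abs_pseries_inverse)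
next
  show "bounded_degree (schur_fun (lst f))" if "ptn f" for f
    unfolding bounded_degree_def using schur_degree[OF that] by (metis order_refl)
qed ((rule schur_terms_ptn schur_mult schur_terms_out schur_terms_box schur_square_all schur_square_hook
    schur_rect_ptn schur_rect_add schur_sqf schur_column; assumption)+)

lemma countable_Witt_Sch_iff: "countable (Witt_Sch (trunc_nat n)) \<longleftrightarrow> n \<le> 2"
  using schur.countable_Hom_iff unfolding Witt_Sch_def Lambda_Sch_def .

theorem theorem1p5:
  fixes n :: nat
  shows "(countable (Witt (trunc_nat n)) \<longleftrightarrow> n \<le> 2) \<and>
         (countable (Witt_Sch (trunc_nat n)) \<longleftrightarrow> n \<le> 2)"
  using countable_Witt_iff countable_Witt_Sch_iff by blast

end
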